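(* Let $n\ge 1$ and $j\ge1$ be integers, $a<b$ real numbers, $0<\alpha\le 1$ and $\beta>0$. Let $\varphi:\mathbb{R}^n\times\mathbb{R}^n\to\mathbb{R}$ and $L:\mathbb{R}^n\times\mathbb{R}^n\times[a,b]\to\mathbb{R}$ be of class $C^2$, let $g:\mathbb{R}^n\times\mathbb{R}^n\to\mathbb{R}^j$ be of class $C^1$, and let $S\subset\mathbb{R}^j$ be a nonempty closed convex set. Define $\mathcal{L}:{}_{c}AC^{\alpha,\infty}_{a+}\to\mathbb{R}$ by $$\mathcal{L}(x):=\varphi(x(a),x(b))+I^{\beta}_{a+}\left[L(x,{}_{c}D^\alpha_{a+}[x],\cdot)\right](b)$$ and let $$K:=\{x\in{}_{c}AC^{\alpha,\infty}_{a+}\mid g(x(a),x(b))\in S\}.$$ If $x\in K$ is a minimizer of $\mathcal{L}$ over $K$ (i.e. $\mathcal{L}(x)\le\mathcal{L}(X)$ for all $X\in K$) and $g$ is regular at $(x(a),x(b))$, then: (i) (Euler-Lagrange equation) the function $\frac{(b-\cdot)^{\beta-1}}{\Gamma(\beta)}\partial_2L(x,{}_{c}D^\alpha_{a+}[x],\cdot)$ belongs to $AC^\alpha_{b-}$ and $$D^\alpha_{b-}\left[\frac{(b-\cdot)^{\beta-1}}{\Gamma(\beta)}\partial_2L(x,{}_{c}D^\alpha_{a+}[x],\cdot)\right](t)=-\frac{(b-t)^{\beta-1}}{\Gamma(\beta)}\partial_1L(x(t),{}_{c}D^\alpha_{a+}[x](t),t)$$ for almost every $t\in[a,b]$; (ii)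 (Transversality conditions) there exists $\psi\in\mathbb{R}^j$ with $-\psi\in N_S[g(x(a),x(b))]$ such that both equalities $$I^{1-\alpha}_{b-}\left[\frac{(b-\cdot)^{\beta-1}}{\Gamma(\beta)}\partial_2L(x,{}_{c}D^\alpha_{a+}[x],\cdot)\right](a)=\partial_1\varphi(x(a),x(b))-\partial_1g(x(a),x(b))^\top\psi,$$ $$-I^{1-\alpha}_{b-}\left[\frac{(b-\cdot)^{\beta-1}}{\Gamma(\beta)}\partial_2L(x,{}_{c}D^\alpha_{a+}[x],\cdot)\right](b)=\partial_2\varphi(x(a),x(b))-\partial_2g(x(a),x(b))^\top\psi$$ hold; (iii) (Legendre condition) the matrix $\frac{(b-t)^{\beta-1}}{\Gamma(\beta)}\partial^2_{22}L(x(t),{}_{c}D^\alpha_{a+}[x](t),t)\in\mathbb{R}^{n\times n}$ is positive semi-definite for almost every $t\in[a,b]$.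
   Context: All functions are defined (a.e.) on $[a,b]$ with values in $\mathbb{R}^n$. $L^1$, $L^\infty$ are the usual Lebesgue spaces, $C$ the continuous functions, $AC$ the absolutely continuous functions. $\Gamma$ is the Gamma function. Fractional integrals: for $\gamma>0$ and $f\in L^1$ (scalar or vector valued), $I^\gamma_{a+}[f](t):=\int_a^t\frac{(t-s)^{\gamma-1}}{\Gamma(\gamma)}f(s)\,ds$ and $I^\gamma_{b-}[f](t):=\int_t^b\frac{(s-t)^{\gamma-1}}{\Gamma(\gamma)}f(s)\,ds$ (whenever these exist; they do for a.e. $t$); $I^0_{a+}[f]=I^0_{b-}[f]:=f$. If a fractional integral is a.e. equal to a continuous function it is identified with its continuous representative, and pointwise values (e.g. at $a$ and $b$) refer to that representative. Fractional derivatives, for $0\le\alpha\le1$: $AC^\alpha_{a+}$ is the set of $f\in L^1$ with $I^{1-\alpha}_{a+}[f]\in AC$, and then $D^\alpha_{a+}[f]:=\frac{d}{dt}I^{1-\alpha}_{a+}[f]$ a.e.; $AC^\alpha_{b-}$ is the set of $f\in L^1$ with $I^{1-\alpha}_{b-}[f]\in AC$, and then $D^\alpha_{b-}[f]:=-\frac{d}{dt}I^{1-\alpha}_{b-}[f]$ a.e. The space ${}_{c}AC^\alpha_{a+}$ is the set of $x\in C$ with $x-x(a)\in AC^\alpha_{a+}$, and then the left Caputo derivative is ${}_{c}D^\alpha_{a+}[x]:=D^\alpha_{a+}[x-x(a)]\in L^1$. Finally ${}_{c}AC^{\alpha,\infty}_{a+}:=\{x\in{}_{c}AC^\alpha_{a+}\mid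 {}_{c}D^\alpha_{a+}[x]\in L^\infty\}$. Notation: $L(x,{}_{c}D^\alpha_{a+}[x],\cdot)$ denotes the function $t\mapsto L(x(t),{}_{c}D^\alpha_{a+}[x](t),t)$, and similarly for derivatives of $L$. For $\varphi$ and $L$, $\partial_1,\partial_2$ denote gradients (in $\mathbb{R}^n$) with respect to the first and second $\mathbb{R}^n$-variable, and $\partial^2_{22}L$ is the $n\times n$ Hessian with respect to the second variable; $\partial_1g,\partial_2g$ are the $j\times n$ partial Jacobian matrices of $g$. The map $g$ is regular at $(x_1,x_2)$ if its differential $\mathcal{D}g(x_1,x_2):\mathbb{R}^n\times\mathbb{R}^n\to\mathbb{R}^j$ is surjective. The normal cone to $S$ at $z\in S$ is $N_S[z]:=\{z'\in\mathbb{R}^j\mid \forall z''\in S,\ z'\cdot(z''-z)\le0\}$. *)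

theory Defs
  imports "HOL-Analysis.Analysis"
begin

section \<open>Function spaces on an interval\<close>

text \<open>
  Functions on the interval from \<open>a\<close> to \<open>b\<close>, and classes of such functions modulo equality almost
  everywhere, are represented by total functions on the reals. Values outside the interval are
  irrelevant to every notion below.
\<close>

definition Linfty :: "real \<Rightarrow> real \<Rightarrow> (real \<Rightarrow> 'a::euclidean_space) set" where
  "Linfty a b = {f. f \<in> borel_measurable (lebesgue_on {a..b}) \<and>
                    (\<exists>C. AE t in lebesgue_on {a..b}. norm (f t) \<le> C)}"

definition AC :: "real \<Rightarrow> real \<Rightarrow> (real \<Rightarrow> 'a::euclidean_space) set" where
  "AC a b = {f. \<forall>\<epsilon>>0. \<exists>\<delta>>0. \<forall>(m::nat) s t.
       (\<forall>i<m. a \<le> s i \<and> s i \<le> t i \<and> t i \<le> b) \<and>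
       (\<forall>i<m. \<forall>k<m. i \<noteq> k \<longrightarrow> {s i<..<t i} \<inter> {s k<..<t k} = {}) \<and>
       (\<Sum>i<m. t i - s i) < \<delta>
       \<longrightarrow> (\<Sum>i<m. norm (f (t i) - f (s i))) < \<epsilon>}"


section \<open>Fractional integrals and derivatives\<close>

text \<open>
  A function that is almost everywhere equal to a continuous one is replaced by its continuous
  representative, which is unique on the interval. This matters for pointwise values:
  for \<open>\<alpha> < 1\<close> the integral defining the right fractional integral of order \<open>1 - \<alpha>\<close>
  is always \<open>0\<close> at \<open>b\<close>, while its continuous representative need not vanish there.
\<close>

definition is_cont_rep :: "real \<Rightarrow> real \<Rightarrow> (real \<Rightarrow> 'a::euclidean_space) \<Rightarrow> (real \<Rightarrow> 'a) \<Rightarrow> bool" where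
  "is_cont_rep a b f h \<longleftrightarrow> continuous_on {a..b} h \<and> (AE t in lebesgue_on {a..b}. f t = h t)"

definition cont_rep :: "real \<Rightarrow> real \<Rightarrow> (real \<Rightarrow> 'a::euclidean_space) \<Rightarrow> real \<Rightarrow> 'a" where
  "cont_rep a b f = (if \<exists>h. is_cont_rep a b f h then SOME h. is_cont_rep a b f h else f)"

definition frac_int_left ::
    "real \<Rightarrow> real \<Rightarrow> real \<Rightarrow> (real \<Rightarrow> 'a::euclidean_space) \<Rightarrow> real \<Rightarrow> 'a" where
  "frac_int_left a b \<gamma> f = cont_rep a b (\<lambda>t.
     if \<gamma> = 0 then f t
     else integral\<^sup>L (lebesgue_on {a..t}) (\<lambda>s. ((t - s) powr (\<gamma> - 1) / Gamma \<gamma>) *\<^sub>R f s))"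

definition frac_int_right ::
    "real \<Rightarrow> real \<Rightarrow> real \<Rightarrow> (real \<Rightarrow> 'a::euclidean_space) \<Rightarrow> real \<Rightarrow> 'a" where
  "frac_int_right a b \<gamma> f = cont_rep a b (\<lambda>t.
     if \<gamma> = 0 then f t
     else integral\<^sup>L (lebesgue_on {t..b}) (\<lambda>s. ((s - t) powr (\<gamma> - 1) / Gamma \<gamma>) *\<^sub>R f s))"

definition AC_left :: "real \<Rightarrow> real \<Rightarrow> real \<Rightarrow> (real \<Rightarrow> 'a::euclidean_space) set" where
  "AC_left a b \<alpha> = {f. integrable (lebesgue_on {a..b}) f \<and> frac_int_left a b (1 - \<alpha>) f \<in> AC a b}"

definition AC_right :: "real \<Rightarrow> real \<Rightarrow> real \<Rightarrow> (real \<Rightarrow> 'a::euclidean_space) set" where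
  "AC_right a b \<alpha> = {f. integrable (lebesgue_on {a..b}) f \<and> frac_int_right a b (1 - \<alpha>) f \<in> AC a b}"

text \<open>The derivatives are meaningful, almost everywhere, for functions in \<open>AC_left\<close> and \<open>AC_right\<close>.\<close>

definition frac_deriv_left ::
    "real \<Rightarrow> real \<Rightarrow> real \<Rightarrow> (real \<Rightarrow> 'a::euclidean_space) \<Rightarrow> real \<Rightarrow> 'a" where
  "frac_deriv_left a b \<alpha> f t = vector_derivative (frac_int_left a b (1 - \<alpha>) f) (at t within {a..b})"

definition frac_deriv_right ::
    "real \<Rightarrow> real \<Rightarrow> real \<Rightarrow> (real \<Rightarrow> 'a::euclidean_space) \<Rightarrow> real \<Rightarrow> 'a" where
  "frac_deriv_right a b \<alpha> f t = - vector_derivative (frac_int_right a b (1 - \<alpha>) f) (at t within {a..b})"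

definition caputo_AC :: "real \<Rightarrow> real \<Rightarrow> real \<Rightarrow> (real \<Rightarrow> 'a::euclidean_space) set" where
  "caputo_AC a b \<alpha> = {x. continuous_on {a..b} x \<and> (\<lambda>t. x t - x a) \<in> AC_left a b \<alpha>}"

definition caputo_deriv ::
    "real \<Rightarrow> real \<Rightarrow> real \<Rightarrow> (real \<Rightarrow> 'a::euclidean_space) \<Rightarrow> real \<Rightarrow> 'a" where
  "caputo_deriv a b \<alpha> x = frac_deriv_left a b \<alpha> (\<lambda>t. x t - x a)"

definition caputo_AC_Linfty :: "real \<Rightarrow> real \<Rightarrow> real \<Rightarrow> (real \<Rightarrow> 'a::euclidean_space) set" where
  "caputo_AC_Linfty a b \<alpha> = {x \<in> caputo_AC a b \<alpha>. caputo_deriv a b \<alpha> x \<in> Linfty a b}"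


section \<open>Differential calculus\<close>

text \<open>
  Derivatives are taken within the domain, so that the domain may be the product of a vector space
  with a compact interval (one-sided derivatives at the end points).
\<close>

definition C1_on :: "'a::real_normed_vector set \<Rightarrow> ('a \<Rightarrow> 'b::real_normed_vector) \<Rightarrow> bool" where
  "C1_on D f \<longleftrightarrow> (\<exists>f'. (\<forall>z\<in>D. (f has_derivative blinfun_apply (f' z)) (at z within D)) \<and>
                      continuous_on D f')"

definition C2_on :: "'a::real_normed_vector set \<Rightarrow> ('a \<Rightarrow> 'b::real_normed_vector) \<Rightarrow> bool" where
  "C2_on D f \<longleftrightarrow> (\<exists>f'. (\<forall>z\<in>D. (f has_derivative blinfun_apply (f' z)) (at z within D)) \<and>
                      C1_on D f')"

definition grad :: "('a::real_inner \<Rightarrow> real) \<Rightarrow> 'a \<Rightarrow> 'a" where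
  "grad f x = (THE D. GDERIV f x :> D)"

definition hessian :: "(real^'n \<Rightarrow> real) \<Rightarrow> real^'n \<Rightarrow> real^'n^'n" where
  "hessian f x = jacobian (grad f) (at x)"

definition pos_semidef :: "real^'n^'n \<Rightarrow> bool" where
  "pos_semidef A \<longleftrightarrow> transpose A = A \<and> (\<forall>v. 0 \<le> v \<bullet> (A *v v))"

definition regular_at :: "(real^'n \<Rightarrow> real^'n \<Rightarrow> real^'j) \<Rightarrow> real^'n \<Rightarrow> real^'n \<Rightarrow> bool" where
  "regular_at g x1 x2 \<longleftrightarrow> surj (frechet_derivative (\<lambda>(y1, y2). g y1 y2) (at (x1, x2)))"

definition normal_cone :: "'a::real_inner set \<Rightarrow> 'a \<Rightarrow> 'a set" where
  "normal_cone S z = {z'. \<forall>z''\<in>S. z' \<bullet> (z'' - z) \<le> 0}"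


section \<open>The variational problem\<close>

definition cost ::
    "real \<Rightarrow> real \<Rightarrow> real \<Rightarrow> real \<Rightarrow> (real^'n \<Rightarrow> real^'n \<Rightarrow> real) \<Rightarrow>
     (real^'n \<Rightarrow> real^'n \<Rightarrow> real \<Rightarrow> real) \<Rightarrow> (real \<Rightarrow> real^'n) \<Rightarrow> real" where
  "cost a b \<alpha> \<beta> \<phi> L x =
     \<phi> (x a) (x b) + frac_int_left a b \<beta> (\<lambda>t. L (x t) (caputo_deriv a b \<alpha> x t) t) b"

definition admissible ::
    "real \<Rightarrow> real \<Rightarrow> real \<Rightarrow> (real^'n \<Rightarrow> real^'n \<Rightarrow> real^'j) \<Rightarrow> (real^'j) set \<Rightarrow>
     (real \<Rightarrow> real^'n) set" where
  "admissible a b \<alpha> g S = {x \<in> caputo_AC_Linfty a b \<alpha>. g (x a) (x b) \<in> S}"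

end

theory Submission
  imports Defs
begin

text \<open>
  Perturb the state \<open>x\<close> by a constant plus the left fractional integral of order \<open>\<alpha>\<close> of a bounded function
  \<open>v\<close>. This changes the Caputo derivative by exactly \<open>v\<close> (\<open>caputo_perturbation\<close>), and the two end points
  of the state can be moved independently of each other. Only the end points, a vector of finite
  dimension, see the constraint \<open>g \<in> S\<close>.

  Perturbations that fix both end points are always admissible. The first variation vanishes along
  them; fractional integration by parts (\<open>rl_integral_duality\<close>) and a lemma of du Bois-Reymond type
  (\<open>du_Bois_Reymond\<close>) show that the weighted velocity gradient \<open>p\<close> plus the right fractional integral
  of the weighted state gradient is a constant vector \<open>\<mu>\<close> times the kernel \<open>(b - t) powr (\<alpha> - 1) / Gamma \<alpha>\<close>.
  Applying the right integral of order \<open>1 - \<alpha>\<close> turns the kernel into the constant \<open>1\<close> and, by the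
  semigroup law, the fractional integral into an ordinary one. So the integral of order \<open>1 - \<alpha>\<close> of \<open>p\<close>
  has an absolutely continuous representative, with the value \<open>\<mu>\<close> at \<open>b\<close>, and differentiating it gives the
  Euler-Lagrange equation.

  Perturbations that move the end points have a first variation which, by this equation, depends on the
  end points only. A multiplier rule in finite dimension (\<open>multiplier_rule\<close>) gives the transversality
  conditions; regularity of \<open>g\<close> enters through the inverse function theorem, which produces admissible
  curves of end points with prescribed tangent.

  The Legendre condition comes from needle variations with fixed end points: \<open>v\<close> takes the value \<open>z\<close> on one
  part of a small set and \<open>-z\<close> on the rest, the parts being balanced so that the end point does not move.
  The state then changes so little that the increment of the cost is governed by the excesses
  \<open>L (u + z) - L u - \<partial>\<^sub>2L z\<close> and \<open>L (u - z) - L u + \<partial>\<^sub>2L z\<close>. For almost every time they cannot both be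
  negative, which forces the Hessian to be positive semidefinite; its symmetry is Schwarz's theorem.

  The Caputo derivative is defined through pointwise derivatives of an absolutely continuous function, so the
  perturbation formula requires that absolutely continuous functions are differentiable almost everywhere and
  that an integral has its integrand as derivative almost everywhere. Both are derived from Vitali's
  covering theorem: the first by Austin's argument for functions of bounded variation, the second with
  the help of Henstock's lemma.
\<close>

section \<open>Vitali coverings and functions of bounded variation\<close>

text \<open>
  Vitali's theorem selects countably many disjoint members of \<open>Q\<close> that cover \<open>E\<close> up to a null set. Each finite
  part of the selection has total length at most \<open>M\<close>, hence so has its union. All exceptional sets
  of this section and the next are estimated in this form.
\<close>

lemma vitali_outer_bound:
  fixes E :: "real set" and Q :: "real set set"
  assumes int: "\<And>K. K \<in> Q \<Longrightarrow> \<exists>s t. s < t \<and> K = {s..t}"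
    and fine: "\<And>x d. \<lbrakk>x \<in> E; 0 < d\<rbrakk> \<Longrightarrow> \<exists>K\<in>Q. x \<in> K \<and> Sup K - Inf K < d"
    and bound: "\<And>p. \<lbrakk>finite p; p \<subseteq> Q; pairwise disjnt p\<rbrakk> \<Longrightarrow> (\<Sum>K\<in>p. Sup K - Inf K) \<le> M"
  obtains T where "E \<subseteq> T" "T \<in> lmeasurable" "measure lebesgue T \<le> M"
proof -
  define c where "c K = (Inf K + Sup K) / 2" for K :: "real set"
  define r where "r K = (Sup K - Inf K) / 2" for K :: "real set"
  have cb: "cball (c K) (r K) = K" and rp: "0 < r K" if "K \<in> Q" for K
  proof -
    obtain s t where st: "s < t" "K = {s..t}" using int[OF \<open>K \<in> Q\<close>] by blast
    show "cball (c K) (r K) = K" using st by (auto simp: c_def r_def cball_def dist_real_def abs_if field_simps)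
    show "0 < r K" using st by (simp add: r_def)
  qed
  have "\<exists>i. i \<in> Q \<and> x \<in> cball (c i) (r i) \<and> r i < d" if xd: "x \<in> E" "0 < d" for x d
  proof -
    obtain K where K: "K \<in> Q" "x \<in> K" "Sup K - Inf K < d" using fine[OF xd] by blast
    have "r K < d" using K(3) rp[OF K(1)] by (simp add: r_def)
    then show ?thesis using K(1,2) cb[OF K(1)] by (intro exI[of _ K]) simp
  qed
  note cov = this
  obtain C where C: "countable C" "C \<subseteq> Q"
     "pairwise (\<lambda>i j. disjnt (cball (c i) (r i)) (cball (c j) (r j))) C"
     "negligible (E - (\<Union>i \<in> C. cball (c i) (r i)))"
    using Vitali_covering_theorem_cballs[of Q r E c, OF rp cov] by blast
  have CU: "(\<Union>i \<in> C. cball (c i) (r i)) = \<Union>C" using C(2) cb by auto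
  have disj: "pairwise disjnt C" using C(2,3) cb by (simp add: pairwise_def subset_iff)
  have lm: "K \<in> lmeasurable" if "K \<in> C" for K using int C(2) that by blast
  have len: "measure lebesgue K = Sup K - Inf K" if "K \<in> C" for K
  proof -
    obtain s t where "s < t" "K = {s..t}" using int C(2) \<open>K \<in> C\<close> by blast
    then show ?thesis by simp
  qed
  have mb: "measure lebesgue (\<Union>\<D>) \<le> M" if "\<D> \<subseteq> C" "finite \<D>" for \<D>
  proof -
    have "measure lebesgue (\<Union>\<D>) = (\<Sum>K\<in>\<D>. measure lebesgue K)"
    proof (rule measure_Union')
      show "pairwise disjnt \<D>" using disj that(1) by (rule pairwise_subset)
    qed (use that lm in auto)
    also have "\<dots> = (\<Sum>K\<in>\<D>. Sup K - Inf K)" by (rule sum.cong) (use len that in auto)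
    also have "\<dots> \<le> M"
      by (rule bound) (use that C(2) disj in \<open>auto intro: pairwise_subset\<close>)
    finally show ?thesis .
  qed
  have U: "\<Union>C \<in> lmeasurable" "measure lebesgue (\<Union>C) \<le> M"
    using fmeasurable_Union_bound[OF C(1) lm mb] measure_Union_bound[OF C(1) lm mb] by auto
  have neg: "negligible (E - \<Union>C)" using C(4) CU by simp
  then have lE: "E - \<Union>C \<in> lmeasurable" by (rule negligible_imp_measurable)
  show ?thesis
  proof
    show "E \<subseteq> \<Union>C \<union> (E - \<Union>C)" by auto
    show "\<Union>C \<union> (E - \<Union>C) \<in> lmeasurable" using U(1) lE by (rule fmeasurable.Un)
    have "measure lebesgue (\<Union>C \<union> (E - \<Union>C)) \<le> measure lebesgue (\<Union>C) + measure lebesgue (E - \<Union>C)"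
      by (rule measure_Un_le) (use U(1) lE in auto)
    also have "measure lebesgue (E - \<Union>C) = 0" using neg negligible_imp_measure0 by blast
    finally show "measure lebesgue (\<Union>C \<union> (E - \<Union>C)) \<le> M" using U(2) by simp
  qed
qed

definition incr :: "(real \<Rightarrow> real) \<Rightarrow> real set \<Rightarrow> real" where
  "incr F K = F (Sup K) - F (Inf K)"

text \<open>
  Families of intervals that leave gaps are allowed, so that disjoint intervals found by a covering argument can
  be inserted directly.
\<close>

definition bounded_variation :: "real \<Rightarrow> real \<Rightarrow> (real \<Rightarrow> real) \<Rightarrow> bool" where
  "bounded_variation a b F \<longleftrightarrow>
     (\<exists>M. \<forall>d. d division_of \<Union>d \<and> \<Union>d \<subseteq> {a..b} \<longrightarrow> (\<Sum>K\<in>d. \<bar>incr F K\<bar>) \<le> M)"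

lemma bounded_variationE:
  assumes "bounded_variation a b F"
  obtains M where "\<And>d. \<lbrakk>d division_of \<Union>d; \<Union>d \<subseteq> {a..b}\<rbrakk> \<Longrightarrow> (\<Sum>K\<in>d. \<bar>incr F K\<bar>) \<le> M"
proof -
  obtain M where "\<forall>d. d division_of \<Union>d \<and> \<Union>d \<subseteq> {a..b} \<longrightarrow> (\<Sum>K\<in>d. \<bar>incr F K\<bar>) \<le> M"
    using assms unfolding bounded_variation_def by (rule exE)
  then show ?thesis by (intro that[of M]) simp
qed

lemma sum_incr_division:
  assumes "d division_of {c..e}" "c \<le> e"
  shows "(\<Sum>K\<in>d. incr F K) = F e - F c"
proof -
  let ?t = "(\<lambda>K. (Inf K, K)) ` d"
  have K: "\<exists>u v. K = {u..v} \<and> u \<le> v" if "K \<in> d" for K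
    using assms(1) that by (metis box_real(2) cbox_division_memE atLeastatMost_empty_iff)
  have Kc: "\<exists>u v. K = cbox u v" if "K \<in> d" for K using assms(1) that by (auto simp: division_of_def)
  have Ks: "K \<subseteq> {c..e}" if "K \<in> d" for K using assms(1) that by (auto simp: division_of_def)
  have InfK: "Inf K \<in> K" if "K \<in> d" for K using K[OF that] by auto
  have "?t tagged_division_of {c..e}"
  proof (rule tagged_division_ofI)
    show "finite ?t" using assms(1) by auto
    fix x K assume "(x,K) \<in> ?t"
    then have "K \<in> d" "x = Inf K" by auto
    then show "x \<in> K" "K \<subseteq> {c..e}" "\<exists>a b. K = cbox a b" using InfK Ks Kc by simp_all
  next
    fix x1 K1 x2 K2 assume "(x1, K1) \<in> ?t" "(x2, K2) \<in> ?t" "(x1, K1) \<noteq> (x2, K2)"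
    then have "K1 \<in> d" "K2 \<in> d" "K1 \<noteq> K2" by auto
    then show "interior K1 \<inter> interior K2 = {}" by (rule division_ofD(5)[OF assms(1)])
  next
    have "{K. \<exists>x. (x, K) \<in> ?t} = d" by (auto simp: image_iff)
    then show "\<Union> {K. \<exists>x. (x, K) \<in> ?t} = {c..e}" using division_ofD(6)[OF assms(1)] by simp
  qed
  from additive_tagged_division_1[OF assms(2) this, of F]
  show ?thesis by (simp add: sum.reindex inj_on_def incr_def)
qed

lemma intervals_division_of:
  assumes "finite p" "pairwise disjnt p" "\<And>K. K \<in> p \<Longrightarrow> \<exists>s t. s < t \<and> K = {s..(t::real)}"
  shows "p division_of \<Union>p"
proof (rule division_ofI)
  fix K assume "K \<in> p"
  then obtain s t where st: "s < t" "K = {s..t}" using assms(3) by blast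
  show "K \<noteq> {}" using st by simp
  show "\<exists>a b. K = cbox a b" using st by auto
next
  fix K1 K2 assume "K1 \<in> p" "K2 \<in> p" "K1 \<noteq> K2"
  then have "K1 \<inter> K2 = {}" using assms(2) by (auto simp: pairwise_def disjnt_def)
  then show "interior K1 \<inter> interior K2 = {}" using interior_subset by blast
qed (use assms in auto)

lemma sum_length_division_le:
  assumes "d division_of \<Union>d" "\<Union>d \<subseteq> {a..b::real}" "a \<le> b"
  shows "(\<Sum>K\<in>d. Sup K - Inf K) \<le> b - a"
proof -
  obtain q where q: "d \<subseteq> q" "q division_of {a..b}"
    using partial_division_extend_interval[of d a b] assms by auto
  have "(\<Sum>K\<in>d. Sup K - Inf K) \<le> (\<Sum>K\<in>q. Sup K - Inf K)"
  proof (rule sum_mono2)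
    show "0 \<le> Sup K - Inf K" if "K \<in> q - d" for K
      using that q(2) by (metis DiffD1 box_real(2) cbox_division_memE atLeastatMost_empty_iff cInf_atLeastAtMost cSup_atLeastAtMost diff_ge_0_iff_ge)
  qed (use q in auto)
  also have "\<dots> = b - a" using sum_incr_division[OF q(2) assms(3), of "\<lambda>x. x"] by (simp add: incr_def)
  finally show ?thesis .
qed

lemma bounded_variation_add_linear:
  assumes "bounded_variation a b F" "a \<le> b"
  shows "bounded_variation a b (\<lambda>t. F t - c * t)"
proof -
  obtain M where M: "\<And>d. d division_of \<Union>d \<Longrightarrow> \<Union>d \<subseteq> {a..b} \<Longrightarrow> (\<Sum>K\<in>d. \<bar>incr F K\<bar>) \<le> M"
    using bounded_variationE[OF assms(1)] by blast
  have "(\<Sum>K\<in>d. \<bar>incr (\<lambda>t. F t - c * t) K\<bar>) \<le> M + \<bar>c\<bar> * (b - a)"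
    if d: "d division_of \<Union>d" "\<Union>d \<subseteq> {a..b}" for d
  proof -
    have "(\<Sum>K\<in>d. \<bar>incr (\<lambda>t. F t - c * t) K\<bar>) \<le> (\<Sum>K\<in>d. \<bar>incr F K\<bar> + \<bar>c\<bar> * (Sup K - Inf K))"
    proof (rule sum_mono)
      fix K assume "K \<in> d"
      then have "Inf K \<le> Sup K"
        using d(1) by (metis box_real(2) cbox_division_memE atLeastatMost_empty_iff cInf_atLeastAtMost cSup_atLeastAtMost)
      then have e: "\<bar>c\<bar> * (Sup K - Inf K) = \<bar>c * (Sup K - Inf K)\<bar>" by (simp add: abs_mult)
      have "incr (\<lambda>t. F t - c * t) K = incr F K - c * (Sup K - Inf K)"
        by (simp add: incr_def algebra_simps)
      then show "\<bar>incr (\<lambda>t. F t - c * t) K\<bar> \<le> \<bar>incr F K\<bar> + \<bar>c\<bar> * (Sup K - Inf K)"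
        unfolding e by linarith
    qed
    also have "\<dots> = (\<Sum>K\<in>d. \<bar>incr F K\<bar>) + \<bar>c\<bar> * (\<Sum>K\<in>d. Sup K - Inf K)"
      by (simp add: sum.distrib sum_distrib_left)
    also have "\<dots> \<le> M + \<bar>c\<bar> * (b - a)"
      by (intro add_mono M d mult_left_mono sum_length_division_le assms(2)) auto
    finally show ?thesis .
  qed
  then show ?thesis unfolding bounded_variation_def by blast
qed

text \<open>
  The increments over a division of \<open>{c..e}\<close> add up to \<open>G e - G c\<close>. The members of \<open>p\<close> run against the sign of
  this difference, by at least \<open>r\<close> times their total length, and the other members must make up for them. The
  absolute increments therefore exceed a single step from \<open>c\<close> to \<open>e\<close> by twice that amount.
\<close>

lemma sum_abs_incr_opposite:
  assumes "p division_of \<Union>p" "\<Union>p \<subseteq> {c..e}" "c \<le> e"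
    and opp: "(G c \<le> G e \<and> (\<forall>K\<in>p. incr G K \<le> - r * (Sup K - Inf K))) \<or>
              (G e < G c \<and> (\<forall>K\<in>p. r * (Sup K - Inf K) \<le> incr G K))"
  obtains q where "q division_of {c..e}"
    "\<bar>incr G {c..e}\<bar> + 2 * r * (\<Sum>K\<in>p. Sup K - Inf K) \<le> (\<Sum>K\<in>q. \<bar>incr G K\<bar>)"
proof -
  obtain q where q: "p \<subseteq> q" "q division_of {c..e}"
    using partial_division_extend_interval[of p c e] assms by auto
  have fin: "finite q" "finite p" using q assms(1) by auto
  have ss: "(\<Sum>K\<in>q. h K) = (\<Sum>K\<in>p. h K) + (\<Sum>K\<in>q-p. h K)" for h :: "real set \<Rightarrow> real"
    using fin q(1) by (metis add.commute sum.subset_diff)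
  define S where "S = (\<Sum>K\<in>p. Sup K - Inf K)"
  define D where "D = (\<Sum>K\<in>p. incr G K)"
  have tot: "D + (\<Sum>K\<in>q-p. incr G K) = G e - G c"
    using sum_incr_division[OF q(2) assms(3), of G] unfolding D_def ss by simp
  have 1: "\<bar>D\<bar> \<le> (\<Sum>K\<in>p. \<bar>incr G K\<bar>)" unfolding D_def by (rule sum_abs)
  have 2: "\<bar>\<Sum>K\<in>q-p. incr G K\<bar> \<le> (\<Sum>K\<in>q-p. \<bar>incr G K\<bar>)" by (rule sum_abs)
  have "(G c \<le> G e \<and> D \<le> - r * S) \<or> (G e < G c \<and> r * S \<le> D)"
    using opp unfolding D_def S_def sum_distrib_left by (auto intro: sum_mono)
  then have "\<bar>G e - G c\<bar> + 2 * (r * S) \<le> \<bar>D\<bar> + \<bar>G e - G c - D\<bar>" by auto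
  also have "\<dots> \<le> (\<Sum>K\<in>q. \<bar>incr G K\<bar>)" using 1 2 tot unfolding ss[of "\<lambda>K. \<bar>incr G K\<bar>"] by linarith
  finally show ?thesis using that[OF q(2)] assms(3) by (simp add: S_def incr_def)
qed

text \<open>
  Divisions of neighbouring intervals may share degenerate intervals, whose increments are zero.
\<close>

lemma sum_UN_overlap_zero:
  fixes h :: "'a \<Rightarrow> 'b::comm_monoid_add"
  assumes "finite I" "\<And>i. i \<in> I \<Longrightarrow> finite (A i)"
    and "\<And>i j x. \<lbrakk>i \<in> I; j \<in> I; i \<noteq> j; x \<in> A i; x \<in> A j\<rbrakk> \<Longrightarrow> h x = 0"
  shows "(\<Sum>x\<in>\<Union>(A ` I). h x) = (\<Sum>i\<in>I. \<Sum>x\<in>A i. h x)"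
  using assms
proof (induction I rule: finite_induct)
  case (insert i I)
  have "(\<Sum>x\<in>A i \<union> \<Union>(A ` I). h x) = (\<Sum>x\<in>A i. h x) + (\<Sum>x\<in>\<Union>(A ` I). h x)"
  proof (rule sum.union_inter_neutral)
    show "finite (A i)" "finite (\<Union>(A ` I))" using insert.hyps(1) insert.prems(1) by simp_all
    show "\<forall>x\<in>A i \<inter> \<Union>(A ` I). h x = 0"
    proof
      fix x assume "x \<in> A i \<inter> \<Union>(A ` I)"
      then obtain j where "j \<in> I" "x \<in> A j" "x \<in> A i" by blast
      moreover have "i \<noteq> j" using \<open>j \<in> I\<close> insert.hyps(2) by blast
      ultimately show "h x = 0" using insert.prems(2)[of i j x] by simp
    qed
  qed
  moreover have "(\<Sum>x\<in>\<Union>(A ` I). h x) = (\<Sum>j\<in>I. \<Sum>x\<in>A j. h x)"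
    by (rule insert.IH) (use insert.prems in \<open>simp; blast\<close>)+
  ultimately show ?case using insert.hyps by simp
qed simp

text \<open>
  Austin's argument. Take a division whose sum of absolute increments is within \<open>r * e\<close> of the supremum. Inside a
  member with nonnegative increment, the points of \<open>E\<close> lie in arbitrarily short intervals of slope at
  most \<open>-r\<close>; inside the other members they lie in short intervals of slope at least \<open>r\<close>. Inserting disjoint
  intervals of these kinds of total length \<open>l\<close> raises the sum by at least \<open>2 * r * l\<close>, so that \<open>l < e / 2\<close>, and
  Vitali's theorem covers \<open>E\<close> by a set of measure at most \<open>e\<close>.
\<close>

lemma oscillating_slopes_negligible:
  assumes bv: "bounded_variation a b G" and ab: "a < b" and r: "0 < r"
    and E: "E \<subseteq> {a<..<b}"
    and up: "\<And>x d. \<lbrakk>x \<in> E; 0 < d\<rbrakk> \<Longrightarrow> \<exists>s t. s < t \<and> x \<in> {s..t} \<and> t - s < d \<and> r * (t - s) \<le> G t - G s"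
    and dn: "\<And>x d. \<lbrakk>x \<in> E; 0 < d\<rbrakk> \<Longrightarrow> \<exists>s t. s < t \<and> x \<in> {s..t} \<and> t - s < d \<and> G t - G s \<le> - r * (t - s)"
  shows "negligible E"
  unfolding negligible_outer_le
proof (intro allI impI)
  fix e :: real assume e: "0 < e"
  define \<V> where "\<V> = {d. d division_of \<Union>d \<and> \<Union>d \<subseteq> {a..b}}"
  define var where "var d = (\<Sum>K\<in>d. \<bar>incr G K\<bar>)" for d
  define V where "V = Sup (var ` \<V>)"
  obtain M where "\<And>d. \<lbrakk>d division_of \<Union>d; \<Union>d \<subseteq> {a..b}\<rbrakk> \<Longrightarrow> (\<Sum>K\<in>d. \<bar>incr G K\<bar>) \<le> M"
    using bounded_variationE[OF bv] by blast
  then have M: "\<And>d. d \<in> \<V> \<Longrightarrow> var d \<le> M" by (simp add: \<V>_def var_def)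
  have bdd: "bdd_above (var ` \<V>)" using M by (auto intro!: bdd_aboveI)
  have leV: "var d \<le> V" if "d \<in> \<V>" for d unfolding V_def using that bdd by (intro cSup_upper) auto
  have "{} \<in> \<V>" by (auto simp: \<V>_def)
  then have "var ` \<V> \<noteq> {}" by auto
  then obtain d0 where d0: "d0 \<in> \<V>" "V - r * e < var d0"
    using less_cSupD[of "var ` \<V>" "V - r * e"] r e unfolding V_def by auto
  obtain d where d: "d0 \<subseteq> d" "d division_of {a..b}"
    using partial_division_extend_interval[of d0 a b] d0(1) by (auto simp: \<V>_def)
  have fd: "finite d" using d by auto
  have "var d0 \<le> var d" unfolding var_def by (rule sum_mono2) (use d fd in auto)
  then have dV: "V - r * e < var d" using d0 by linarith
  have dK: "\<exists>u v. K = {u..v} \<and> u \<le> v" if "K \<in> d" for K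
    using d(2) that by (metis box_real(2) cbox_division_memE atLeastatMost_empty_iff)
  define good where "good K k \<longleftrightarrow> k \<subseteq> interior K \<and>
      ((0 \<le> incr G K \<and> incr G k \<le> - r * (Sup k - Inf k)) \<or>
       (incr G K < 0 \<and> r * (Sup k - Inf k) \<le> incr G k))" for K k :: "real set"
  define Q where "Q = {k. (\<exists>s t. s < t \<and> k = {s..t}) \<and> (\<exists>K\<in>d. good K k)}"
  define N where "N = (\<Union>K\<in>d. {Inf K, Sup K})"
  have finN: "finite N" using fd by (auto simp: N_def)
  have Eint: "\<exists>K\<in>d. x \<in> interior K" if "x \<in> E - N" for x
  proof -
    have "x \<in> {a..b}" using that E by (auto simp: subset_iff)
    then obtain K where K: "K \<in> d" "x \<in> K" using division_contains[OF d(2)] by blast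
    obtain u v where uv: "K = {u..v}" "u \<le> v" using dK[OF K(1)] by blast
    have "x \<noteq> u" "x \<noteq> v" using that K uv by (auto simp: N_def)
    then have "x \<in> interior K" using K uv by auto
    then show ?thesis using K by blast
  qed
  have fine: "\<exists>k\<in>Q. x \<in> k \<and> Sup k - Inf k < \<delta>" if x: "x \<in> E - N" and "0 < \<delta>" for x \<delta>
  proof -
    obtain K where K: "K \<in> d" "x \<in> interior K" using Eint[OF x] by blast
    obtain \<rho> where \<rho>: "\<rho> > 0" "ball x \<rho> \<subseteq> interior K"
      using K(2) open_interior open_contains_ball by blast
    define \<eta> where "\<eta> = min \<rho> \<delta>"
    have \<eta>: "\<eta> > 0" using \<rho> \<open>0 < \<delta>\<close> by (simp add: \<eta>_def)
    obtain s t where st: "s < t" "x \<in> {s..t}" "t - s < \<eta>"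
      "(0 \<le> incr G K \<and> G t - G s \<le> - r * (t - s)) \<or> (incr G K < 0 \<and> r * (t - s) \<le> G t - G s)"
      using up[of x \<eta>] dn[of x \<eta>] x \<eta> by (metis DiffD1 not_le)
    have "{s..t} \<subseteq> ball x \<rho>" using st(2,3) by (auto simp: \<eta>_def dist_real_def)
    then have "good K {s..t}" using st \<rho>(2) by (auto simp: good_def incr_def)
    then have "{s..t} \<in> Q" using st(1) K(1) by (auto simp: Q_def)
    then show ?thesis using st by (intro bexI[of _ "{s..t}"]) (auto simp: \<eta>_def)
  qed
  have bound: "(\<Sum>k\<in>p. Sup k - Inf k) \<le> e / 2" if p: "finite p" "p \<subseteq> Q" "pairwise disjnt p" for p
  proof -
    have pst: "\<exists>s t. s < t \<and> k = {s..t}" if "k \<in> p" for k using that p(2) by (auto simp: Q_def)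
    have pdiv: "p division_of \<Union>p" by (rule intervals_division_of[OF p(1,3) pst])
    define P where "P K = {k \<in> p. good K k}" for K
    have disjP: "P K \<inter> P K' = {}" if "K \<in> d" "K' \<in> d" "K \<noteq> K'" for K K'
    proof (rule ccontr)
      assume "P K \<inter> P K' \<noteq> {}"
      then obtain k where k: "k \<in> p" "k \<subseteq> interior K" "k \<subseteq> interior K'" by (auto simp: P_def good_def)
      moreover have "k \<noteq> {}" using pst[OF k(1)] by auto
      moreover have "interior K \<inter> interior K' = {}" using d(2) that by auto
      ultimately show False by blast
    qed
    have pU: "p = (\<Union>K\<in>d. P K)" using p(2) by (auto simp: P_def Q_def)
    have "\<exists>q. q division_of K \<and> \<bar>incr G K\<bar> + 2 * r * (\<Sum>k\<in>P K. Sup k - Inf k) \<le> var q" if K: "K \<in> d" for K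
    proof -
      obtain u v where uv: "K = {u..v}" "u \<le> v" using dK[OF K] by blast
      have 1: "P K division_of \<Union>(P K)" by (rule division_of_subset[OF pdiv]) (auto simp: P_def)
      have 2: "\<Union>(P K) \<subseteq> {u..v}" using uv interior_subset by (auto simp: P_def good_def) 
      have 3: "(G u \<le> G v \<and> (\<forall>k\<in>P K. incr G k \<le> - r * (Sup k - Inf k))) \<or>
              (G v < G u \<and> (\<forall>k\<in>P K. r * (Sup k - Inf k) \<le> incr G k))"
        using uv by (auto simp: P_def good_def incr_def)
      obtain q where "q division_of {u..v}"
          "\<bar>incr G {u..v}\<bar> + 2 * r * (\<Sum>K\<in>P K. Sup K - Inf K) \<le> (\<Sum>K\<in>q. \<bar>incr G K\<bar>)"
        by (rule sum_abs_incr_opposite[OF 1 2 uv(2) 3])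
      then show ?thesis using uv by (auto simp: var_def)
    qed
    then obtain q where q: "\<And>K. K \<in> d \<Longrightarrow> q K division_of K"
        "\<And>K. K \<in> d \<Longrightarrow> \<bar>incr G K\<bar> + 2 * r * (\<Sum>k\<in>P K. Sup k - Inf k) \<le> var (q K)" by metis
    have qdisj: "interior k1 \<inter> interior k2 = {}"
      if "K1 \<in> d" "K2 \<in> d" "K1 \<noteq> K2" "k1 \<in> q K1" "k2 \<in> q K2" for K1 K2 k1 k2
    proof -
      have "k1 \<subseteq> K1" "k2 \<subseteq> K2" using q(1) that by auto
      then have "interior k1 \<subseteq> interior K1" "interior k2 \<subseteq> interior K2" by (simp_all add: interior_mono)
      moreover have "interior K1 \<inter> interior K2 = {}" using d(2) that by auto
      ultimately show ?thesis by blast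
    qed
    have div: "\<Union>(q ` d) division_of \<Union>(\<Union>(q ` d))"
    proof (rule division_of_Union)
      show "finite (q ` d)" using fd by simp
      show "p division_of \<Union> p" if "p \<in> q ` d" for p using that q(1) by auto
      fix k1 k2 assume "k1 \<in> \<Union> (q ` d)" "k2 \<in> \<Union> (q ` d)" "k1 \<noteq> k2"
      then obtain K1 K2 where K: "K1 \<in> d" "K2 \<in> d" "k1 \<in> q K1" "k2 \<in> q K2" by auto
      show "interior k1 \<inter> interior k2 = {}"
      proof (cases "K1 = K2")
        case True then show ?thesis using q(1)[of K1] K \<open>k1 \<noteq> k2\<close> by auto
      next
        case False then show ?thesis using qdisj K by blast
      qed
    qed
    have "\<Union>(\<Union>(q ` d)) \<subseteq> {a..b}" using q(1) d(2) by (fastforce simp: division_of_def)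
    with div have inV: "\<Union>(q ` d) \<in> \<V>" by (simp add: \<V>_def)
    have zero: "\<bar>incr G k\<bar> = 0" if "K1 \<in> d" "K2 \<in> d" "K1 \<noteq> K2" "k \<in> q K1" "k \<in> q K2" for K1 K2 k
    proof -
      have "interior k = {}" using qdisj[OF that] by simp
      moreover obtain u v where "k = {u..v}" "k \<noteq> {}" 
        using division_ofD(3,4)[OF q(1)[OF \<open>K1 \<in> d\<close>] \<open>k \<in> q K1\<close>] by auto
      ultimately have "u = v" "k = {u..v}" by auto
      then show ?thesis by (simp add: incr_def)
    qed
    have "var (\<Union>(q ` d)) = (\<Sum>K\<in>d. var (q K))"
      unfolding var_def
      by (rule sum_UN_overlap_zero) (use fd q(1) zero in auto)
    also have "\<dots> \<ge> (\<Sum>K\<in>d. \<bar>incr G K\<bar> + 2 * r * (\<Sum>k\<in>P K. Sup k - Inf k))"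
      by (rule sum_mono) (use q(2) in auto)
    also have "(\<Sum>K\<in>d. \<bar>incr G K\<bar> + 2 * r * (\<Sum>k\<in>P K. Sup k - Inf k)) =
        var d + 2 * r * (\<Sum>K\<in>d. \<Sum>k\<in>P K. Sup k - Inf k)"
      by (simp add: sum.distrib sum_distrib_left var_def)
    also have "(\<Sum>K\<in>d. \<Sum>k\<in>P K. Sup k - Inf k) = (\<Sum>k\<in>p. Sup k - Inf k)"
      unfolding pU by (subst sum.UNION_disjoint) (use fd disjP p(1) in \<open>auto simp: P_def\<close>)
    finally have "2 * r * (\<Sum>k\<in>p. Sup k - Inf k) \<le> V - var d" using leV[OF inV] by linarith
    also have "\<dots> < r * e" using dV by linarith
    finally show ?thesis using r by (simp add: field_simps)
  qed
  obtain T where T: "E - N \<subseteq> T" "T \<in> lmeasurable" "measure lebesgue T \<le> e / 2"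
    by (rule vitali_outer_bound[of Q "E - N" "e/2"]) (use fine bound in \<open>auto simp: Q_def\<close>)
  have nN: "negligible N" using finN by (rule negligible_finite)
  show "\<exists>T. E \<subseteq> T \<and> T \<in> lmeasurable \<and> measure lebesgue T \<le> e"
  proof (intro exI conjI)
    show "E \<subseteq> T \<union> N" using T by auto
    show "T \<union> N \<in> lmeasurable" using T nN negligible_imp_measurable by blast
    have "measure lebesgue (T \<union> N) \<le> measure lebesgue T + measure lebesgue N"
      by (rule measure_Un_le) (use T nN negligible_imp_measurable in auto)
    then show "measure lebesgue (T \<union> N) \<le> e" using T nN e negligible_imp_measure0 by fastforce
  qed
qed

section \<open>Differentiability almost everywhere\<close>

lemma division_member_interval:
  fixes K :: "real set"
  assumes "d division_of S" "K \<in> d"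
  obtains u v where "K = {u..v}" "u \<le> v"
  using assms by (metis box_real(2) cbox_division_memE atLeastatMost_empty_iff)

lemma frequently_slope_interval:
  fixes F :: "real \<Rightarrow> real"
  assumes "\<exists>\<^sub>F s in at x. P ((F s - F x) / (s - x))" "0 < d"
  shows "\<exists>s t. s < t \<and> x \<in> {s..t} \<and> t - s < d \<and> P ((F t - F s) / (t - s))"
proof -
  obtain y where y: "y \<noteq> x" "dist y x < d" "P ((F y - F x) / (y - x))"
    using assms unfolding frequently_at by auto
  show ?thesis
  proof (cases "y < x")
    case True
    have "(F y - F x) / (y - x) = (F x - F y) / (x - y)" by (metis minus_diff_eq minus_divide_divide)
    then show ?thesis using y True by (intro exI[of _ y] exI[of _ x]) (auto simp: dist_real_def)
  next
    case False
    then show ?thesis using y by (intro exI[of _ x] exI[of _ y]) (auto simp: dist_real_def)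
  qed
qed

text \<open>
  If \<open>q\<close> is eventually bounded, its lower and upper limits are finite; if they differ, rational numbers fit
  strictly between them. Rational bounds keep the number of exceptional sets countable.
\<close>

lemma limit_dichotomy:
  fixes q :: "'a \<Rightarrow> real"
  assumes F: "F \<noteq> bot" and no: "\<nexists>D. (q \<longlongrightarrow> D) F"
  shows "(\<forall>N::nat. \<exists>\<^sub>F s in F. real N \<le> \<bar>q s\<bar>) \<or>
    (\<exists>c d. c \<in> \<rat> \<and> d \<in> \<rat> \<and> c < d \<and> (\<exists>\<^sub>F s in F. q s < c) \<and> (\<exists>\<^sub>F s in F. d < q s))"
proof (rule ccontr)
  assume neg: "\<not> ?thesis"
  then obtain N :: nat where N: "\<forall>\<^sub>F s in F. \<bar>q s\<bar> < real N" by (auto simp: frequently_def not_le)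
  define l where "l = Liminf F (\<lambda>s. ereal (q s))"
  define u where "u = Limsup F (\<lambda>s. ereal (q s))"
  have lu: "l \<le> u" unfolding l_def u_def by (rule Liminf_le_Limsup[OF F])
  have l1: "ereal (- real N) \<le> l" unfolding l_def
    by (rule Liminf_bounded) (use N in \<open>eventually_elim, auto\<close>)
  have u1: "u \<le> ereal (real N)" unfolding u_def
    by (rule Limsup_bounded) (use N in \<open>eventually_elim, auto\<close>)
  have "l = u"
  proof (rule ccontr)
    assume "l \<noteq> u"
    then have "l < u" using lu by simp
    then obtain c' where c': "l < ereal c'" "ereal c' < u" using ereal_dense2 by blast
    then obtain d' where d': "ereal c' < ereal d'" "ereal d' < u" using ereal_dense2 by blast
    obtain c where c: "c \<in> \<rat>" "c' < c" "c < d'" using Rats_dense_in_real d' by auto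
    obtain d where d: "d \<in> \<rat>" "c < d" "d < d'" using Rats_dense_in_real c by auto
    have "\<exists>\<^sub>F s in F. q s < c"
    proof (rule ccontr)
      assume "\<not> (\<exists>\<^sub>F s in F. q s < c)"
      then have "\<forall>\<^sub>F s in F. ereal c \<le> ereal (q s)" by (simp add: frequently_def not_less)
      then have "ereal c \<le> l" unfolding l_def by (rule Liminf_bounded)
      with c' c show False by (metis ereal_less_le less_ereal.simps(1) not_le order_less_trans)
    qed
    moreover have "\<exists>\<^sub>F s in F. d < q s"
    proof (rule ccontr)
      assume "\<not> (\<exists>\<^sub>F s in F. d < q s)"
      then have "\<forall>\<^sub>F s in F. ereal (q s) \<le> ereal d" by (simp add: frequently_def not_less)
      then have "u \<le> ereal d" unfolding u_def by (rule Limsup_bounded)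
      with d' d show False by (metis less_ereal.simps(1) not_le order_less_trans)
    qed
    ultimately show False using neg c d by blast
  qed
  moreover obtain D where D: "l = ereal D" using l1 u1 \<open>l = u\<close> by (cases l) auto
  ultimately have "((\<lambda>s. ereal (q s)) \<longlongrightarrow> ereal D) F"
    unfolding l_def u_def by (metis F tendsto_iff_Liminf_eq_Limsup)
  then have "(q \<longlongrightarrow> D) F" by (simp add: lim_ereal)
  with no show False by blast
qed

text \<open>
  Disjoint intervals with slopes of absolute value at least \<open>N\<close> have total length at most \<open>M / N\<close>, where \<open>M\<close>
  bounds the variation.
\<close>

lemma infinite_slopes_negligible:
  assumes bv: "bounded_variation a b F" and E: "E \<subseteq> {a<..<b}"
    and big: "\<And>x N. x \<in> E \<Longrightarrow> \<exists>\<^sub>F s in at x. real N \<le> \<bar>(F s - F x) / (s - x)\<bar>"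
  shows "negligible E"
  unfolding negligible_outer_le
proof (intro allI impI)
  fix e :: real assume e: "0 < e"
  obtain M where M: "\<And>d. d division_of \<Union>d \<Longrightarrow> \<Union>d \<subseteq> {a..b} \<Longrightarrow> (\<Sum>K\<in>d. \<bar>incr F K\<bar>) \<le> M"
    using bounded_variationE[OF bv] by blast
  obtain N :: nat where N: "max 1 (M / e) < real N" using reals_Archimedean2 by blast
  then have N0: "real N > 0" "M \<le> e * real N" using e by (auto simp: field_simps)
  define Q where "Q = {k. \<exists>s t. s < t \<and> k = {s..t} \<and> k \<subseteq> {a..b} \<and> real N * (t - s) \<le> \<bar>F t - F s\<bar>}"
  have fine: "\<exists>k\<in>Q. x \<in> k \<and> Sup k - Inf k < d" if x: "x \<in> E" and d: "0 < d" for x d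
  proof -
    have "x \<in> {a<..<b}" using x E by auto
    then obtain \<rho> where \<rho>: "\<rho> > 0" "ball x \<rho> \<subseteq> {a<..<b}"
      using openE[OF open_greaterThanLessThan] by blast
    obtain s t where st: "s < t" "x \<in> {s..t}" "t - s < min \<rho> d" "real N \<le> \<bar>(F t - F s) / (t - s)\<bar>"
      using frequently_slope_interval[OF big[OF x, of N], of "min \<rho> d"] \<rho> d by auto
    have "{s..t} \<subseteq> ball x \<rho>" using st(2,3) by (auto simp: dist_real_def)
    then have sub: "{s..t} \<subseteq> {a..b}" using \<rho>(2) by (meson greaterThanLessThan_subseteq_atLeastAtMost_iff order.refl subset_trans)
    have "real N * (t - s) \<le> \<bar>F t - F s\<bar>" using st(1,4) by (simp add: abs_divide field_simps)
    then have "{s..t} \<in> Q" using sub st(1) unfolding Q_def by blast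
    then show ?thesis using st by (intro bexI[of _ "{s..t}"]) auto
  qed
  have bound: "(\<Sum>k\<in>p. Sup k - Inf k) \<le> e" if p: "finite p" "p \<subseteq> Q" "pairwise disjnt p" for p
  proof -
    have "p division_of \<Union>p" by (rule intervals_division_of[OF p(1,3)]) (use p(2) in \<open>auto simp: Q_def\<close>)
    moreover have "\<Union>p \<subseteq> {a..b}" using p(2) unfolding Q_def by blast
    ultimately have "(\<Sum>K\<in>p. \<bar>incr F K\<bar>) \<le> M" by (rule M)
    moreover have "(\<Sum>K\<in>p. real N * (Sup K - Inf K)) \<le> (\<Sum>K\<in>p. \<bar>incr F K\<bar>)"
      by (rule sum_mono) (use p(2) in \<open>auto simp: Q_def incr_def\<close>)
    ultimately have "real N * (\<Sum>k\<in>p. Sup k - Inf k) \<le> e * real N"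
      using N0 by (simp add: sum_distrib_left)
    then show ?thesis using N0 by (simp add: mult.commute)
  qed
  show "\<exists>T. E \<subseteq> T \<and> T \<in> lmeasurable \<and> measure lebesgue T \<le> e"
    by (rule vitali_outer_bound[of Q E e]) (use fine bound in \<open>auto simp: Q_def\<close>)
qed

text \<open>
  Where difference quotients below \<open>c\<close> and above \<open>d\<close> occur at arbitrarily small distances, subtracting the line of
  slope \<open>(c + d) / 2\<close> produces slopes of both signs that are bounded away from zero.
\<close>

lemma bounded_variation_differentiable_ae:
  assumes bv: "bounded_variation a b F" and ab: "a < b"
  shows "negligible {t \<in> {a<..<b}. \<nexists>D. (F has_real_derivative D) (at t)}"
proof -
  let ?q = "\<lambda>x s. (F s - F x) / (s - x)"
  define E0 where "E0 = {x \<in> {a<..<b}. \<forall>N::nat. \<exists>\<^sub>F s in at x. real N \<le> \<bar>?q x s\<bar>}"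
  define E where "E c d = {x \<in> {a<..<b}. (\<exists>\<^sub>F s in at x. ?q x s < c) \<and> (\<exists>\<^sub>F s in at x. d < ?q x s)}" for c d
  have "negligible E0"
    by (rule infinite_slopes_negligible[OF bv]) (auto simp: E0_def)
  moreover have "negligible (E c d)" if cd: "c < d" for c d
  proof (rule oscillating_slopes_negligible)
    let ?m = "(c + d) / 2" and ?r = "(d - c) / 2"
    show "bounded_variation a b (\<lambda>t. F t - ?m * t)"
      by (rule bounded_variation_add_linear[OF bv]) (use ab in simp)
    show "0 < ?r" using cd by simp
    show "E c d \<subseteq> {a<..<b}" by (auto simp: E_def)
    fix x \<delta> :: real assume x: "x \<in> E c d" and \<delta>: "0 < \<delta>"
    have "\<exists>\<^sub>F s in at x. d < ?q x s" "\<exists>\<^sub>F s in at x. ?q x s < c" using x by (auto simp: E_def)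
    note f = this[THEN frequently_slope_interval[OF _ \<delta>]]
    obtain s t where "s < t" "x \<in> {s..t}" "t - s < \<delta>" "d < (F t - F s) / (t - s)" using f(1) by blast
    then show "\<exists>s t. s < t \<and> x \<in> {s..t} \<and> t - s < \<delta> \<and>
        ?r * (t - s) \<le> (F t - ?m * t) - (F s - ?m * s)"
      by (intro exI[of _ s] exI[of _ t]) (auto simp: field_simps)
    obtain s t where "s < t" "x \<in> {s..t}" "t - s < \<delta>" "(F t - F s) / (t - s) < c" using f(2) by blast
    then show "\<exists>s t. s < t \<and> x \<in> {s..t} \<and> t - s < \<delta> \<and>
        (F t - ?m * t) - (F s - ?m * s) \<le> - ?r * (t - s)"
      by (intro exI[of _ s] exI[of _ t]) (auto simp: field_simps)
  qed (use ab in auto)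
  then have "negligible (\<Union>(c,d)\<in>{(c,d). c \<in> \<rat> \<and> d \<in> \<rat> \<and> c < d}. E c d)"
  proof (intro negligible_countable_Union)
    have "countable (\<rat> \<times> \<rat> :: (real \<times> real) set)" by (intro countable_SIGMA countable_rat)
    then show "countable ((\<lambda>(c,d). E c d) ` {(c,d). c \<in> \<rat> \<and> d \<in> \<rat> \<and> c < d})"
      by (intro countable_image) (erule countable_subset[rotated], auto)
  qed auto
  ultimately have "negligible (E0 \<union> (\<Union>(c,d)\<in>{(c,d). c \<in> \<rat> \<and> d \<in> \<rat> \<and> c < d}. E c d))"
    by (rule negligible_Un)
  then show ?thesis
  proof (rule negligible_subset, safe)
    fix t assume t: "t \<in> {a<..<b}" and nd: "\<nexists>D. (F has_real_derivative D) (at t)"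
      and nE: "t \<notin> (\<Union>(c,d)\<in>{(c,d). c \<in> \<rat> \<and> d \<in> \<rat> \<and> c < d}. E c d)"
    have "\<nexists>D. (?q t \<longlongrightarrow> D) (at t)" using nd by (simp add: has_field_derivative_iff)
    from limit_dichotomy[OF _ this]
    have "(\<forall>N::nat. \<exists>\<^sub>F s in at t. real N \<le> \<bar>?q t s\<bar>) \<or>
      (\<exists>c d. c \<in> \<rat> \<and> d \<in> \<rat> \<and> c < d \<and> (\<exists>\<^sub>F s in at t. ?q t s < c) \<and> (\<exists>\<^sub>F s in at t. d < ?q t s))" by simp
    then show "t \<in> E0" using nE t unfolding E0_def E_def by blast
  qed
qed

text \<open>
  Divisions are sets of intervals, so absolute continuity is needed for families over arbitrary finite index sets.
\<close>

lemma AC_finite_family: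
  assumes F: "F \<in> AC a b" and e: "0 < \<epsilon>"
  obtains \<delta> where "0 < \<delta>"
    "\<And>I s t. \<lbrakk>finite I; \<And>i. i \<in> I \<Longrightarrow> a \<le> s i \<and> s i \<le> t i \<and> t i \<le> b;
        \<And>i k. \<lbrakk>i \<in> I; k \<in> I; i \<noteq> k\<rbrakk> \<Longrightarrow> {s i<..<t i} \<inter> {s k<..<t k} = {}; (\<Sum>i\<in>I. t i - s i) < \<delta>\<rbrakk>
      \<Longrightarrow> (\<Sum>i\<in>I. norm (F (t i) - F (s i))) < \<epsilon>"
proof -
  obtain \<delta> where \<delta>: "0 < \<delta>" and *: "\<forall>(m::nat) s t.
       (\<forall>i<m. a \<le> s i \<and> s i \<le> t i \<and> t i \<le> b) \<and>
       (\<forall>i<m. \<forall>k<m. i \<noteq> k \<longrightarrow> {s i<..<t i} \<inter> {s k<..<t k} = {}) \<and>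
       (\<Sum>i<m. t i - s i) < \<delta> \<longrightarrow> (\<Sum>i<m. norm (F (t i) - F (s i))) < \<epsilon>"
    using F[unfolded AC_def mem_Collect_eq, THEN spec, THEN mp, OF e] by (elim exE conjE)
  show ?thesis
  proof (rule that[OF \<delta>])
    fix I :: "'b set" and s t :: "'b \<Rightarrow> real"
    assume I: "finite I" "\<And>i. i \<in> I \<Longrightarrow> a \<le> s i \<and> s i \<le> t i \<and> t i \<le> b"
      "\<And>i k. \<lbrakk>i \<in> I; k \<in> I; i \<noteq> k\<rbrakk> \<Longrightarrow> {s i<..<t i} \<inter> {s k<..<t k} = {}" "(\<Sum>i\<in>I. t i - s i) < \<delta>"
    obtain h where h: "bij_betw h {..<card I} I"
      using ex_bij_betw_nat_finite[OF I(1)] by (auto simp: atLeast0LessThan)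
    have hI: "h i \<in> I" if "i < card I" for i using h that by (auto simp: bij_betw_def)
    have hne: "h i \<noteq> h k" if "i < card I" "k < card I" "i \<noteq> k" for i k
      using h that by (auto simp: bij_betw_def inj_on_def)
    have re: "(\<Sum>i<card I. g (h i)) = (\<Sum>i\<in>I. g i)" for g :: "'b \<Rightarrow> real"
      by (rule sum.reindex_bij_betw[OF h])
    have "(\<Sum>i<card I. norm (F (t (h i)) - F (s (h i)))) < \<epsilon>"
      using *[rule_format, of "card I" "\<lambda>i. s (h i)" "\<lambda>i. t (h i)"] I(2,4) I(3)[OF hI hI hne] hI re[of "\<lambda>i. t i - s i"]
      by simp
    then show "(\<Sum>i\<in>I. norm (F (t i) - F (s i))) < \<epsilon>" unfolding re[of "\<lambda>i. norm (F (t i) - F (s i))"] .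
  qed
qed

text \<open>
  The interval is cut into \<open>N\<close> pieces that are shorter than the \<open>\<delta>\<close> belonging to \<open>\<epsilon> = 1\<close>. The clamping map \<open>c j\<close>
  moves any family of intervals into the \<open>j\<close>-th piece, where its increments sum to less than \<open>1\<close>, and the
  increment of \<open>F\<close> over an interval is the sum over \<open>j\<close> of the increments over the clamped intervals.
\<close>

lemma AC_imp_bounded_variation:
  fixes F :: "real \<Rightarrow> real"
  assumes F: "F \<in> AC a b" and ab: "a < b"
  shows "bounded_variation a b F"
proof -
  obtain \<delta> where \<delta>: "0 < \<delta>" and small:
    "\<And>(I::real set set) s t. \<lbrakk>finite I; \<And>i. i \<in> I \<Longrightarrow> a \<le> s i \<and> s i \<le> t i \<and> t i \<le> b;
        \<And>i k. \<lbrakk>i \<in> I; k \<in> I; i \<noteq> k\<rbrakk> \<Longrightarrow> {s i<..<t i} \<inter> {s k<..<t k} = {}; (\<Sum>i\<in>I. t i - s i) < \<delta>\<rbrakk>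
      \<Longrightarrow> (\<Sum>i\<in>I. norm (F (t i) - F (s i))) < 1"
    by (rule AC_finite_family[OF F zero_less_one]) blast
  obtain N :: nat where "(b - a) / \<delta> < real N" using reals_Archimedean2 by blast
  moreover have "0 < (b - a) / \<delta>" using ab \<delta> by simp
  ultimately have N0: "real N > 0" and N1: "(b - a) / \<delta> < real N" by linarith+
  have N: "(b - a) / real N < \<delta>" "real N > 0" using N0 N1 \<delta> by (simp_all add: field_simps)
  define P where "P j = a + real j * ((b - a) / real N)" for j
  have P0: "P 0 = a" and PN: "P N = b" using N by (auto simp: P_def)
  have PS: "P (Suc j) - P j = (b - a) / real N" for j by (simp add: P_def algebra_simps add_divide_distrib diff_divide_distrib)
  have Pmono: "P j \<le> P (Suc j)" for j 
  proof -
    have "0 \<le> (b - a) / real N" using ab by simp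
    then show ?thesis using PS[of j] by linarith
  qed
  have PI: "a \<le> P j \<and> P j \<le> b" if "j \<le> N" for j
  proof -
    have "P 0 \<le> P j" "P j \<le> P N" using lift_Suc_mono_le[of P, OF Pmono] that by simp_all
    then show ?thesis using P0 PN by simp
  qed
  define c where "c j t = max (P j) (min (P (Suc j)) t)" for j t
  have telescope: "(\<Sum>j<k. F (c j t) - F (P j)) = F (min t (P k)) - F a" if "a \<le> t" for t k
  proof (induction k)
    case 0 then show ?case using that P0 by simp
  next
    case (Suc k)
    show ?case
    proof (cases "t \<le> P k")
      case True
      then have "c k t = P k" "min t (P (Suc k)) = t" "min t (P k) = t"
        using Pmono[of k] by (auto simp: c_def)
      then show ?thesis using Suc by simp
    next
      case False
      then have "c k t = min t (P (Suc k))" "min t (P k) = P k"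
        using Pmono[of k] by (auto simp: c_def)
      then show ?thesis using Suc by simp
    qed
  qed
  have full: "(\<Sum>j<N. F (c j t) - F (c j s)) = F t - F s" if "a \<le> s" "s \<le> b" "a \<le> t" "t \<le> b" for s t
  proof -
    have "(\<Sum>j<N. F (c j t) - F (c j s)) = (\<Sum>j<N. F (c j t) - F (P j)) - (\<Sum>j<N. F (c j s) - F (P j))"
      by (simp add: sum_subtractf)
    then show ?thesis using telescope[of t N] telescope[of s N] that PN by (simp add: min_def)
  qed
  have "(\<Sum>K\<in>d. \<bar>incr F K\<bar>) \<le> real N" if d: "d division_of \<Union>d" "\<Union>d \<subseteq> {a..b}" for d
  proof -
    have dK: "a \<le> Inf K \<and> Inf K \<le> Sup K \<and> Sup K \<le> b" if K: "K \<in> d" for K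
    proof -
      obtain u v where uv: "K = {u..v}" "u \<le> v" using d(1) K by (rule division_member_interval)
      then have "u \<in> {a..b}" "v \<in> {a..b}" using d(2) K by fastforce+
      then show ?thesis using uv by auto
    qed
    obtain q where q: "d \<subseteq> q" "q division_of {a..b}"
      using partial_division_extend_interval[of d a b] d by auto
    have inner: "(\<Sum>K\<in>d. norm (F (c j (Sup K)) - F (c j (Inf K)))) < 1" if j: "j < N" for j
    proof (rule small)
      show "finite d" using d by auto
      show "a \<le> c j (Inf K) \<and> c j (Inf K) \<le> c j (Sup K) \<and> c j (Sup K) \<le> b" if "K \<in> d" for K
        using dK[OF that] PI[of j] PI[of "Suc j"] j by (auto simp: c_def)
      show "{c j (Inf i)<..<c j (Sup i)} \<inter> {c j (Inf k)<..<c j (Sup k)} = {}"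
        if "i \<in> d" "k \<in> d" "i \<noteq> k" for i k
      proof -
        have sub: "{c j (Inf K)<..<c j (Sup K)} \<subseteq> interior K" if K: "K \<in> d" for K
        proof -
          obtain u v where uv: "K = {u..v}" "u \<le> v" using d(1) K by (rule division_member_interval)
          then show ?thesis by (auto simp: c_def)
        qed
        have "interior i \<inter> interior k = {}" using d(1) that by auto
        then show ?thesis using sub that by blast
      qed
      have "(\<Sum>K\<in>d. c j (Sup K) - c j (Inf K)) \<le> (\<Sum>K\<in>q. c j (Sup K) - c j (Inf K))"
      proof (rule sum_mono2)
        show "0 \<le> c j (Sup K) - c j (Inf K)" if "K \<in> q - d" for K
        proof -
          have "K \<in> q" using that by simp
          with q(2) obtain u v where uv: "K = {u..v}" "u \<le> v" by (rule division_member_interval)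
          then show ?thesis by (auto simp: c_def)
        qed
      qed (use q in auto)
      also have "\<dots> = c j b - c j a"
        using sum_incr_division[OF q(2), of "c j"] ab by (simp add: incr_def)
      also have "\<dots> \<le> P (Suc j) - P j" using Pmono[of j] by (auto simp: c_def)
      also have "\<dots> < \<delta>" using N PS by simp
      finally show "(\<Sum>K\<in>d. c j (Sup K) - c j (Inf K)) < \<delta>" .
    qed
    have "(\<Sum>K\<in>d. \<bar>incr F K\<bar>) \<le> (\<Sum>K\<in>d. \<Sum>j<N. norm (F (c j (Sup K)) - F (c j (Inf K))))"
    proof (rule sum_mono)
      fix K assume K: "K \<in> d"
      have "incr F K = (\<Sum>j<N. F (c j (Sup K)) - F (c j (Inf K)))"
        using full[of "Inf K" "Sup K"] dK[OF K] by (simp add: incr_def)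
      then show "\<bar>incr F K\<bar> \<le> (\<Sum>j<N. norm (F (c j (Sup K)) - F (c j (Inf K))))"
        unfolding real_norm_def by (simp only: sum_abs)
    qed
    also have "\<dots> = (\<Sum>j<N. \<Sum>K\<in>d. norm (F (c j (Sup K)) - F (c j (Inf K))))" by (rule sum.swap)
    also have "\<dots> \<le> (\<Sum>j<N. 1)" by (rule sum_mono) (use inner in \<open>auto intro: less_imp_le\<close>)
    finally show ?thesis by simp
  qed
  then show ?thesis unfolding bounded_variation_def by blast
qed

lemma AC_inner:
  assumes F: "F \<in> AC a b" and i: "norm i \<le> 1"
  shows "(\<lambda>t. F t \<bullet> i) \<in> AC a b"
  unfolding AC_def
proof (clarify)
  fix \<epsilon> :: real assume e: "0 < \<epsilon>"
  obtain \<delta> where \<delta>: "0 < \<delta>" and *: "\<forall>(m::nat) s t.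
       (\<forall>i<m. a \<le> s i \<and> s i \<le> t i \<and> t i \<le> b) \<and>
       (\<forall>i<m. \<forall>k<m. i \<noteq> k \<longrightarrow> {s i<..<t i} \<inter> {s k<..<t k} = {}) \<and>
       (\<Sum>i<m. t i - s i) < \<delta> \<longrightarrow> (\<Sum>i<m. norm (F (t i) - F (s i))) < \<epsilon>"
    using F[unfolded AC_def mem_Collect_eq, THEN spec, THEN mp, OF e] by (elim exE conjE)
  show "\<exists>\<delta>>0. \<forall>(m::nat) s t. (\<forall>i<m. a \<le> s i \<and> s i \<le> t i \<and> t i \<le> b) \<and>
       (\<forall>i<m. \<forall>k<m. i \<noteq> k \<longrightarrow> {s i<..<t i} \<inter> {s k<..<t k} = {}) \<and> (\<Sum>i<m. t i - s i) < \<delta>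
       \<longrightarrow> (\<Sum>j<m. norm (F (t j) \<bullet> i - F (s j) \<bullet> i)) < \<epsilon>"
  proof (intro exI[of _ \<delta>] conjI allI impI \<delta>)
    fix m :: nat and s t
    assume A: "(\<forall>i<m. a \<le> s i \<and> s i \<le> t i \<and> t i \<le> b) \<and>
       (\<forall>i<m. \<forall>k<m. i \<noteq> k \<longrightarrow> {s i<..<t i} \<inter> {s k<..<t k} = {}) \<and> (\<Sum>i<m. t i - s i) < \<delta>"
    have "(\<Sum>j<m. norm (F (t j) \<bullet> i - F (s j) \<bullet> i)) \<le> (\<Sum>j<m. norm (F (t j) - F (s j)))"
    proof (rule sum_mono)
      fix j
      have "norm ((F (t j) - F (s j)) \<bullet> i) \<le> norm (F (t j) - F (s j)) * norm i"
        using Cauchy_Schwarz_ineq2 by simp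
      also have "\<dots> \<le> norm (F (t j) - F (s j)) * 1" by (rule mult_left_mono) (use i in auto)
      finally show "norm (F (t j) \<bullet> i - F (s j) \<bullet> i) \<le> norm (F (t j) - F (s j))"
        by (simp add: inner_diff_left)
    qed
    also have "\<dots> < \<epsilon>" by (rule *[THEN spec, THEN spec, THEN spec, THEN mp, OF A])
    finally show "(\<Sum>j<m. norm (F (t j) \<bullet> i - F (s j) \<bullet> i)) < \<epsilon>" .
  qed
qed

text \<open>
  A \<open>vector_derivative\<close> is unspecified where no derivative exists. This result confines such points to a null set
  for the functions through which fractional derivatives are defined.
\<close>

proposition AC_has_vector_derivative_ae:
  fixes F :: "real \<Rightarrow> 'a::euclidean_space"
  assumes F: "F \<in> AC a b" and ab: "a < b"
  shows "negligible {t \<in> {a..b}. \<nexists>D. (F has_vector_derivative D) (at t within {a..b})}"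
proof -
  let ?N = "\<lambda>i. {t \<in> {a<..<b}. \<nexists>D. ((\<lambda>t. F t \<bullet> i) has_real_derivative D) (at t)}"
  have neg: "negligible ({a, b} \<union> (\<Union>i\<in>Basis. ?N i))"
    using bounded_variation_differentiable_ae[OF AC_imp_bounded_variation[OF AC_inner[OF F] ab] ab]
    by (intro negligible_Un negligible_Union) auto
  show ?thesis
  proof (rule negligible_subset[OF neg], rule subsetI)
    fix t assume tt: "t \<in> {t \<in> {a..b}. \<nexists>D. (F has_vector_derivative D) (at t within {a..b})}"
    then have t: "t \<in> {a..b}" and nd: "\<nexists>D. (F has_vector_derivative D) (at t within {a..b})" by auto
    show "t \<in> {a, b} \<union> (\<Union>i\<in>Basis. ?N i)"
    proof (rule ccontr)
      assume nt: "t \<notin> {a, b} \<union> (\<Union>i\<in>Basis. ?N i)"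
      then have ti: "t \<in> {a<..<b}" using t by auto
      have "\<forall>i\<in>Basis. \<exists>D. ((\<lambda>t. F t \<bullet> i) has_real_derivative D) (at t)" using nt ti by auto
      then obtain D where D: "\<And>i. i \<in> Basis \<Longrightarrow> ((\<lambda>t. F t \<bullet> i) has_real_derivative D i) (at t)" by metis
      have "(F has_derivative (\<lambda>h. h *\<^sub>R (\<Sum>i\<in>Basis. D i *\<^sub>R i))) (at t)"
      proof (subst has_derivative_componentwise_within, intro ballI)
        fix j :: 'a assume j: "j \<in> Basis"
        then show "((\<lambda>x. F x \<bullet> j) has_derivative (\<lambda>x. x *\<^sub>R (\<Sum>i\<in>Basis. D i *\<^sub>R i) \<bullet> j)) (at t)"
          using D[OF j] by (simp add: has_field_derivative_def mult.commute[of _ "D j"])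
      qed
      then have "(F has_vector_derivative (\<Sum>i\<in>Basis. D i *\<^sub>R i)) (at t)"
        by (simp add: has_vector_derivative_def)
      then show False using nd has_vector_derivative_at_within by blast
    qed
  qed
qed


text \<open>
  At a point \<open>x\<close> where \<open>f x\<close> fails to be the derivative of the integral \<open>F\<close>, some \<open>n\<close> admits arbitrarily short
  intervals with end point \<open>x\<close> over which the error \<open>F y - F x - (y - x) *\<^sub>R f x\<close> is at least the length divided
  by \<open>n + 1\<close>. Henstock's lemma makes the sum of the errors small over every disjoint family that is fine for a
  suitable gauge, hence also its total length.
\<close>

theorem indefinite_integral_has_vector_derivative_ae:
  fixes f :: "real \<Rightarrow> 'a::euclidean_space"
  assumes f: "f integrable_on {a..b}" and ab: "a < b"
  shows "negligible {t \<in> {a..b}. \<not> ((\<lambda>t. integral {a..t} f) has_vector_derivative f t) (at t within {a..b})}"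
proof -
  define F where "F t = integral {a..t} f" for t
  have Fdiff: "F t - F s = integral {s..t} f" if "a \<le> s" "s \<le> t" "t \<le> b" for s t
  proof -
    have "f integrable_on {a..t}" using f that by (auto intro: integrable_subinterval_real)
    then show ?thesis using Henstock_Kurzweil_Integration.integral_combine[of a s t f] that by (simp add: F_def algebra_simps)
  qed
  define R where "R x y = norm (F y - F x - (y - x) *\<^sub>R f x)" for x y
  define E where "E n = {x \<in> {a<..<b}. \<exists>\<^sub>F y in at x. inverse (real (Suc n)) * \<bar>y - x\<bar> \<le> R x y}" for n :: nat
  have "negligible (E n)" for n
    unfolding negligible_outer_le
  proof (intro allI impI)
    fix e :: real assume e: "0 < e"
    define \<eta> where "\<eta> = e / real (Suc n)"
    have \<eta>: "0 < \<eta>" using e by (simp add: \<eta>_def)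
    obtain \<gamma> where \<gamma>: "gauge \<gamma>" and hen: "\<And>p. \<lbrakk>p tagged_partial_division_of {a..b}; \<gamma> fine p\<rbrakk> \<Longrightarrow>
             sum (\<lambda>(x,k). norm (measure lborel k *\<^sub>R f x - integral k f)) p < \<eta>"
      using Henstock_lemma[of f a b \<eta>] f \<eta> by auto
    define good where "good x k \<longleftrightarrow> x \<in> k \<and> k \<subseteq> \<gamma> x \<and>
        inverse (real (Suc n)) * (Sup k - Inf k) \<le> norm (measure lborel k *\<^sub>R f x - integral k f)" for x k
    define Q where "Q = {k. (\<exists>s t. s < t \<and> k = {s..t}) \<and> k \<subseteq> {a..b} \<and> (\<exists>x. good x k)}"
    have fine: "\<exists>k\<in>Q. x \<in> k \<and> Sup k - Inf k < d" if x: "x \<in> E n" and d: "0 < d" for x d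
    proof -
      have xab: "x \<in> {a<..<b}" and fr: "\<exists>\<^sub>F y in at x. inverse (real (Suc n)) * \<bar>y - x\<bar> \<le> R x y"
        using x by (auto simp: E_def)
      have "open (\<gamma> x \<inter> {a<..<b})" "x \<in> \<gamma> x \<inter> {a<..<b}" using \<gamma> xab by (auto simp: gauge_def)
      then obtain \<rho> where \<rho>: "\<rho> > 0" "ball x \<rho> \<subseteq> \<gamma> x \<inter> {a<..<b}" by (rule openE)
      obtain y where y: "y \<noteq> x" "dist y x < min \<rho> d" "inverse (real (Suc n)) * \<bar>y - x\<bar> \<le> R x y"
        using fr \<rho>(1) d unfolding frequently_at by (metis UNIV_I min_less_iff_conj)
      define k where "k = {min x y..max x y}"
      have kb: "k \<subseteq> ball x \<rho>" using y(2) by (auto simp: k_def dist_real_def)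
      have len: "Sup k - Inf k = \<bar>y - x\<bar>" "measure lborel k = \<bar>y - x\<bar>" by (auto simp: k_def)
      have kab: "k \<subseteq> {a..b}" using kb \<rho>(2) by (meson greaterThanLessThan_subseteq_atLeastAtMost_iff inf.boundedE order.refl subset_trans)
      then have "x \<in> {a..b}" "y \<in> {a..b}" by (auto simp: k_def min_def max_def split: if_splits)
      then have R: "R x y = norm (measure lborel k *\<^sub>R f x - integral k f)"
        using Fdiff[of x y] Fdiff[of y x] unfolding R_def len
        by (cases "x \<le> y") (auto simp: k_def min_def max_def norm_minus_commute algebra_simps)
      have "good x k" using y(3) kb \<rho>(2) R len by (auto simp: good_def k_def)
      moreover have "min x y < max x y" using y(1) by auto
      ultimately have "k \<in> Q" using kab unfolding Q_def k_def by blast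
      moreover have "x \<in> k" by (auto simp: k_def)
      ultimately show ?thesis using y(2) len by (intro bexI[of _ k]) (auto simp: dist_real_def)
    qed
    have bound: "(\<Sum>k\<in>p. Sup k - Inf k) \<le> e" if p: "finite p" "p \<subseteq> Q" "pairwise disjnt p" for p
    proof -
      have "\<forall>k\<in>p. \<exists>x. good x k" using p(2) by (auto simp: Q_def)
      then obtain z where z: "\<And>k. k \<in> p \<Longrightarrow> good (z k) k" by metis
      let ?p = "(\<lambda>k. (z k, k)) ` p"
      have "?p tagged_partial_division_of {a..b}"
        unfolding tagged_partial_division_of_def
      proof (intro conjI allI impI)
        show "finite ?p" using p(1) by simp
        fix x K assume "(x, K) \<in> ?p"
        then have K: "K \<in> p" "x = z K" by auto
        then show "x \<in> K" "K \<subseteq> {a..b}" using z[OF K(1)] p(2) by (auto simp: good_def Q_def)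
        have "K \<in> Q" using K p(2) by blast
        then show "\<exists>a b. K = cbox a b" by (auto simp: Q_def)
      next
        fix x1 K1 x2 K2
        assume "(x1, K1) \<in> ?p \<and> (x2, K2) \<in> ?p \<and> (x1, K1) \<noteq> (x2, K2)"
        then have "K1 \<in> p" "K2 \<in> p" "K1 \<noteq> K2" by auto
        then have "K1 \<inter> K2 = {}" using p(3) by (auto simp: pairwise_def disjnt_def)
        then show "interior K1 \<inter> interior K2 = {}" using interior_subset by blast
      qed
      moreover have "\<gamma> fine ?p" using z by (auto simp: fine_def good_def)
      ultimately have "sum (\<lambda>(x,k). norm (measure lborel k *\<^sub>R f x - integral k f)) ?p < \<eta>" by (rule hen)
      then have *: "(\<Sum>k\<in>p. norm (measure lborel k *\<^sub>R f (z k) - integral k f)) < \<eta>"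
        by (simp add: sum.reindex inj_on_def)
      have "inverse (real (Suc n)) * (\<Sum>k\<in>p. Sup k - Inf k) \<le> (\<Sum>k\<in>p. norm (measure lborel k *\<^sub>R f (z k) - integral k f))"
        unfolding sum_distrib_left by (rule sum_mono) (use z in \<open>auto simp: good_def\<close>)
      with * have "inverse (real (Suc n)) * (\<Sum>k\<in>p. Sup k - Inf k) < \<eta>" by linarith
      then have "(\<Sum>k\<in>p. Sup k - Inf k) / real (Suc n) < e / real (Suc n)"
        by (simp only: \<eta>_def divide_inverse mult.commute)
      then show ?thesis by (simp only: divide_less_cancel) simp
    qed
    show "\<exists>T. E n \<subseteq> T \<and> T \<in> lmeasurable \<and> measure lebesgue T \<le> e"
      by (rule vitali_outer_bound[of Q "E n" e]) (use fine bound in \<open>auto simp: Q_def\<close>)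
  qed
  then have neg: "negligible ({a, b} \<union> (\<Union>n. E n))"
    by (intro negligible_Un negligible_countable_Union) auto
  show ?thesis
    unfolding F_def[symmetric]
  proof (rule negligible_subset[OF neg], rule subsetI)
    fix t assume tt: "t \<in> {t \<in> {a..b}. \<not> (F has_vector_derivative f t) (at t within {a..b})}"
    show "t \<in> {a, b} \<union> (\<Union>n. E n)"
    proof (rule ccontr)
      assume "t \<notin> {a, b} \<union> (\<Union>n. E n)"
      then have t: "t \<in> {a<..<b}" and nE: "\<And>n. t \<notin> E n" using tt by auto
      have ev: "\<forall>\<^sub>F y in at t. R t y < inverse (real (Suc n)) * \<bar>y - t\<bar>" for n
        using nE[of n] t by (auto simp: E_def frequently_def not_le)
      have "(F has_vector_derivative f t) (at t)"
        unfolding has_vector_derivative_def has_derivative_at2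
      proof
        show "bounded_linear (\<lambda>h. h *\<^sub>R f t)" by (rule bounded_linear_scaleR_left)
        show "(\<lambda>y. (1 / norm (y - t)) *\<^sub>R (F y - (F t + (y - t) *\<^sub>R f t))) \<midarrow>t\<rightarrow> 0"
        proof (rule tendstoI)
          fix e :: real assume "0 < e"
          then obtain n where n: "inverse (real (Suc n)) < e" using reals_Archimedean by blast
          have "\<forall>\<^sub>F y in at t. y \<noteq> t" by (simp add: eventually_at_filter)
          with ev[of n] show "\<forall>\<^sub>F y in at t. dist ((1 / norm (y - t)) *\<^sub>R (F y - (F t + (y - t) *\<^sub>R f t))) 0 < e"
          proof eventually_elim
            case (elim y)
            have "R t y / \<bar>y - t\<bar> < inverse (real (Suc n))" using elim by (simp add: field_simps)
            then show ?case using n by (simp add: R_def diff_diff_eq)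
          qed
        qed
      qed
      then show False using tt has_vector_derivative_at_within by blast
    qed
  qed
qed

section \<open>Riemann-Liouville integrals on the line\<close>

text \<open>
  The kernel is extended by zero, so that left and right fractional integrals become integrals over the whole line
  and the limits of integration need no separate treatment.
\<close>

definition rl_kernel :: "real \<Rightarrow> real \<Rightarrow> real" where
  "rl_kernel \<gamma> r = (if 0 < r then r powr (\<gamma> - 1) / Gamma \<gamma> else 0)"

lemma rl_kernel_nonneg [simp]: "0 < \<gamma> \<Longrightarrow> 0 \<le> rl_kernel \<gamma> r"
  by (auto simp: rl_kernel_def intro!: divide_nonneg_nonneg Gamma_real_nonneg)

lemma rl_kernel_pos: "0 < \<gamma> \<Longrightarrow> 0 < r \<Longrightarrow> 0 < rl_kernel \<gamma> r"
  by (auto simp: rl_kernel_def intro!: divide_pos_pos Gamma_real_pos)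

lemma rl_kernel_measurable [measurable]: "rl_kernel \<gamma> \<in> borel_measurable borel"
  unfolding rl_kernel_def by measurable

lemma rl_kernel_1: "rl_kernel 1 r = indicator {0<..} r"
  by (auto simp: rl_kernel_def indicator_def)

lemma rl_kernel_nonpos [simp]: "r \<le> 0 \<Longrightarrow> rl_kernel \<gamma> r = 0"
  by (simp add: rl_kernel_def)

lemma nn_integral_Beta:
  assumes "0 < p" "0 < (q::real)"
  shows "(\<integral>\<^sup>+z. ennreal (indicator {0<..<1} z * (z powr (p - 1) * (1 - z) powr (q - 1))) \<partial>lborel) = ennreal (Beta p q)"
proof -
  have "(\<integral>\<^sup>+z. ennreal (z powr (p - 1) * (1 - z) powr (q - 1)) * indicator {0..1} z \<partial>lborel) = ennreal (Beta p q)"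
    by (rule nn_integral_has_integral_lebesgue'[OF _ has_integral_Beta_real[OF assms]]) auto
  also have "(\<integral>\<^sup>+z. ennreal (z powr (p - 1) * (1 - z) powr (q - 1)) * indicator {0..1} z \<partial>lborel) =
    (\<integral>\<^sup>+z. ennreal (indicator {0<..<1} z * (z powr (p - 1) * (1 - z) powr (q - 1))) \<partial>lborel)"
    by (rule nn_integral_cong) (auto simp: indicator_def)
  finally show ?thesis .
qed

text \<open>
  The substitution \<open>s = r + (t - r) * z\<close> leads to Euler's Beta integral. Besides the semigroup law this gives the
  integrability of the kernel on half lines (with \<open>\<delta> = 1\<close>) and the right fractional integral of the weight.
\<close>

lemma rl_kernel_convolution:
  assumes g: "0 < \<gamma>" and d: "0 < \<delta>"
  shows "(\<integral>\<^sup>+s. ennreal (rl_kernel \<gamma> (t - s) * rl_kernel \<delta> (s - r)) \<partial>lborel) = ennreal (rl_kernel (\<gamma> + \<delta>) (t - r))"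
proof (cases "r < t")
  case False
  then have z: "rl_kernel \<gamma> (t - s) * rl_kernel \<delta> (s - r) = 0" for s by (auto simp: rl_kernel_def)
  show ?thesis unfolding z using False by simp
next
  case True
  define T where "T = t - r"
  have T: "0 < T" using True by (simp add: T_def)
  let ?c = "T powr (\<gamma> - 1) * T powr (\<delta> - 1) / (Gamma \<gamma> * Gamma \<delta>)"
  have c0: "0 \<le> ?c" using g d by (intro divide_nonneg_nonneg mult_nonneg_nonneg Gamma_real_nonneg) auto
  have pt: "rl_kernel \<gamma> (t - (r + T * z)) * rl_kernel \<delta> (r + T * z - r) =
      ?c * (indicator {0<..<1} z * (z powr (\<delta> - 1) * (1 - z) powr (\<gamma> - 1)))" for z
  proof (cases "0 < z \<and> z < 1")
    case True
    have e: "t - (r + T * z) = T * (1 - z)" by (simp add: T_def algebra_simps)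
    have "(T * (1 - z)) powr (\<gamma> - 1) = T powr (\<gamma> - 1) * (1 - z) powr (\<gamma> - 1)"
      "(T * z) powr (\<delta> - 1) = T powr (\<delta> - 1) * z powr (\<delta> - 1)"
      using T True by (auto simp: powr_mult)
    then show ?thesis using T True unfolding e by (simp add: rl_kernel_def)
  next
    case False
    have e: "t - (r + T * z) = T * (1 - z)" by (simp add: T_def algebra_simps)
    show ?thesis using T False unfolding e
      by (auto simp: rl_kernel_def indicator_def zero_less_mult_iff)
  qed
  have "(\<integral>\<^sup>+s. ennreal (rl_kernel \<gamma> (t - s) * rl_kernel \<delta> (s - r)) \<partial>lborel) =
      ennreal \<bar>T\<bar> * (\<integral>\<^sup>+z. ennreal (rl_kernel \<gamma> (t - (r + T * z)) * rl_kernel \<delta> (r + T * z - r)) \<partial>lborel)"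
    by (rule nn_integral_real_affine) (use T in auto)
  also have "(\<integral>\<^sup>+z. ennreal (rl_kernel \<gamma> (t - (r + T * z)) * rl_kernel \<delta> (r + T * z - r)) \<partial>lborel) =
      ennreal ?c * (\<integral>\<^sup>+z. ennreal (indicator {0<..<1} z * (z powr (\<delta> - 1) * (1 - z) powr (\<gamma> - 1))) \<partial>lborel)"
    unfolding pt ennreal_mult'[OF c0] by (rule nn_integral_cmult) measurable
  also have "\<dots> = ennreal ?c * ennreal (Beta \<delta> \<gamma>)" by (simp only: nn_integral_Beta[OF d g])
  also have "ennreal \<bar>T\<bar> * (ennreal ?c * ennreal (Beta \<delta> \<gamma>)) = ennreal (T * (?c * Beta \<delta> \<gamma>))"
    using T c0 by (simp add: ennreal_mult'[symmetric])
  also have "T * (?c * Beta \<delta> \<gamma>) = rl_kernel (\<gamma> + \<delta>) (t - r)"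
  proof -
    have G: "Gamma \<gamma> \<noteq> 0" "Gamma \<delta> \<noteq> 0" using g d Gamma_real_pos by (metis less_irrefl)+
    have "T * (T powr (\<gamma> - 1) * T powr (\<delta> - 1)) = T powr 1 * (T powr (\<gamma> - 1) * T powr (\<delta> - 1))" using T by simp
    also have "\<dots> = T powr (\<gamma> + \<delta> - 1)" unfolding powr_add[symmetric] by (simp add: algebra_simps)
    finally have P: "T * (T powr (\<gamma> - 1) * T powr (\<delta> - 1)) = T powr (\<gamma> + \<delta> - 1)" .
    have "T * (?c * Beta \<delta> \<gamma>) = (T * (T powr (\<gamma> - 1) * T powr (\<delta> - 1))) / Gamma (\<gamma> + \<delta>)"
      using G by (simp add: Beta_def add.commute)
    then show ?thesis unfolding P using T by (simp add: rl_kernel_def T_def)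
  qed
  finally show ?thesis .
qed

text \<open>
  Tonelli's theorem for the absolute values reduces integrability on the plane to that of \<open>R r *\<^sub>R v r\<close>, and Fubini's
  theorem exchanges the integrals. The left and the right semigroup laws are instances.
\<close>

lemma kernel_composition:
  fixes v :: "real \<Rightarrow> 'a::euclidean_space"
  assumes [measurable]: "P \<in> borel_measurable borel" "(\<lambda>x. Q (fst x) (snd x)) \<in> borel_measurable (borel \<Otimes>\<^sub>M borel)"
      "v \<in> borel_measurable borel"
    and nn: "\<And>s. 0 \<le> P s" "\<And>s r. 0 \<le> Q s r" "\<And>r. 0 \<le> R r"
    and PQ: "\<And>r. (\<integral>\<^sup>+s. ennreal (P s * Q s r) \<partial>lborel) = ennreal (R r)"
    and int: "integrable lborel (\<lambda>r. R r *\<^sub>R v r)"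
  shows "(\<integral>s. P s *\<^sub>R (\<integral>r. Q s r *\<^sub>R v r \<partial>lborel) \<partial>lborel) = (\<integral>r. R r *\<^sub>R v r \<partial>lborel)"
    and "integrable lborel (\<lambda>s. P s *\<^sub>R (\<integral>r. Q s r *\<^sub>R v r \<partial>lborel))"
proof -
  have [measurable]: "(\<lambda>s. Q s r) \<in> borel_measurable borel" for r
    using measurable_compose[of "\<lambda>s. (s, r)" borel "borel \<Otimes>\<^sub>M borel", OF _ assms(2)] by simp
  let ?f = "\<lambda>s r. (P s * Q s r) *\<^sub>R v r"
  have fm: "(\<lambda>(s, r). ?f s r) \<in> borel_measurable (lborel \<Otimes>\<^sub>M lborel)"
    by (simp add: split_beta') 
  have "(\<integral>\<^sup>+x. ennreal (norm (case x of (s, r) \<Rightarrow> ?f s r)) \<partial>(lborel \<Otimes>\<^sub>M lborel)) =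
      (\<integral>\<^sup>+r. (\<integral>\<^sup>+s. ennreal (norm (?f s r)) \<partial>lborel) \<partial>lborel)"
    using lborel_pair.nn_integral_snd[of "\<lambda>x. ennreal (norm (case x of (s, r) \<Rightarrow> ?f s r))"] fm by simp
  also have "\<dots> = (\<integral>\<^sup>+r. ennreal (norm (R r *\<^sub>R v r)) \<partial>lborel)"
  proof (rule nn_integral_cong)
    fix r
    have "(\<integral>\<^sup>+s. ennreal (norm (?f s r)) \<partial>lborel) = (\<integral>\<^sup>+s. ennreal (P s * Q s r) * ennreal (norm (v r)) \<partial>lborel)"
      by (rule nn_integral_cong) (use nn in \<open>simp add: ennreal_mult'[symmetric] abs_mult\<close>)
    also have "\<dots> = ennreal (R r) * ennreal (norm (v r))"
      by (subst nn_integral_multc) (auto simp: PQ)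
    finally show "(\<integral>\<^sup>+s. ennreal (norm (?f s r)) \<partial>lborel) = ennreal (norm (R r *\<^sub>R v r))"
      using nn by (simp add: ennreal_mult'[symmetric])
  qed
  also have "\<dots> < \<infinity>" using int by (simp add: integrable_iff_bounded)
  finally have fi: "integrable (lborel \<Otimes>\<^sub>M lborel) (case_prod ?f)"
    using fm by (simp add: integrable_iff_bounded)
  have "(\<integral>r. (\<integral>s. ?f s r \<partial>lborel) \<partial>lborel) = (\<integral>s. (\<integral>r. ?f s r \<partial>lborel) \<partial>lborel)"
    by (rule lborel_pair.Fubini_integral[OF fi])
  moreover have "(\<integral>s. ?f s r \<partial>lborel) = R r *\<^sub>R v r" for r
  proof -
    have "(\<integral>s. P s * Q s r \<partial>lborel) = R r"
      by (subst integral_eq_nn_integral) (use nn PQ in auto)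
    moreover have "integrable lborel (\<lambda>s. P s * Q s r)"
      by (rule integrableI_nonneg) (use nn PQ in auto)
    ultimately show ?thesis by (subst integral_scaleR_left) auto
  qed
  moreover have e: "(\<integral>r. ?f s r \<partial>lborel) = P s *\<^sub>R (\<integral>r. Q s r *\<^sub>R v r \<partial>lborel)" for s
    by (simp only: scaleR_scaleR[symmetric] integral_scaleR_right)
  ultimately show "(\<integral>s. P s *\<^sub>R (\<integral>r. Q s r *\<^sub>R v r \<partial>lborel) \<partial>lborel) = (\<integral>r. R r *\<^sub>R v r \<partial>lborel)" by simp
  show "integrable lborel (\<lambda>s. P s *\<^sub>R (\<integral>r. Q s r *\<^sub>R v r \<partial>lborel))"
    using lborel_pair.integrable_fst[OF fi] by (simp add: e)
qed

definition rl_left :: "real \<Rightarrow> (real \<Rightarrow> 'a::euclidean_space) \<Rightarrow> real \<Rightarrow> 'a" where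
  "rl_left \<gamma> v t = (\<integral>s. rl_kernel \<gamma> (t - s) *\<^sub>R v s \<partial>lborel)"

definition rl_right :: "real \<Rightarrow> (real \<Rightarrow> 'a::euclidean_space) \<Rightarrow> real \<Rightarrow> 'a" where
  "rl_right \<gamma> f t = (\<integral>s. rl_kernel \<gamma> (s - t) *\<^sub>R f s \<partial>lborel)"

lemma integrable_rl_kernel_1:
  fixes v :: "real \<Rightarrow> 'a::euclidean_space"
  assumes "integrable lborel v"
  shows "integrable lborel (\<lambda>r. rl_kernel 1 (t - r) *\<^sub>R v r)" "integrable lborel (\<lambda>r. rl_kernel 1 (r - t) *\<^sub>R v r)"
  by (rule Bochner_Integration.integrable_bound[OF assms]; use assms in \<open>auto simp: rl_kernel_1 indicator_def\<close>)+

lemma rl_left_semigroup: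
  fixes v :: "real \<Rightarrow> 'a::euclidean_space"
  assumes a: "0 < \<alpha>" "\<alpha> < 1" and v: "integrable lborel v"
  shows "rl_left (1 - \<alpha>) (rl_left \<alpha> v) t = rl_left 1 v t"
    and "integrable lborel (\<lambda>s. rl_kernel (1 - \<alpha>) (t - s) *\<^sub>R rl_left \<alpha> v s)"
  unfolding rl_left_def
  by (rule kernel_composition[where R = "\<lambda>r. rl_kernel 1 (t - r)"];
      use a v integrable_rl_kernel_1[OF v] rl_kernel_convolution[of "1 - \<alpha>" \<alpha>] in \<open>auto simp: \<close>)+

lemma rl_right_semigroup:
  fixes f :: "real \<Rightarrow> 'a::euclidean_space"
  assumes a: "0 < \<alpha>" "\<alpha> < 1" and f: "integrable lborel f"
  shows "rl_right (1 - \<alpha>) (rl_right \<alpha> f) t = rl_right 1 f t"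
    and "integrable lborel (\<lambda>s. rl_kernel (1 - \<alpha>) (s - t) *\<^sub>R rl_right \<alpha> f s)"
  unfolding rl_right_def
  by (rule kernel_composition[where R = "\<lambda>r. rl_kernel 1 (r - t)"];
      use a f integrable_rl_kernel_1[OF f] rl_kernel_convolution[of \<alpha> "1 - \<alpha>"] in \<open>auto simp: mult.commute\<close>)+


lemma rl_kernel_has_integral_Ioi:
  assumes g: "0 < \<gamma>"
  shows "integrable lborel (\<lambda>s. indicator {c<..} s * rl_kernel \<gamma> (t - s))"
    and "(\<integral>s. indicator {c<..} s * rl_kernel \<gamma> (t - s) \<partial>lborel) = rl_kernel (\<gamma> + 1) (t - c)"
proof -
  have e: "(\<lambda>s. indicator {c<..} s * rl_kernel \<gamma> (t - s)) = (\<lambda>s. rl_kernel \<gamma> (t - s) * rl_kernel 1 (s - c))"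
    by (auto simp: rl_kernel_1 indicator_def)
  have nn: "(\<integral>\<^sup>+s. ennreal (rl_kernel \<gamma> (t - s) * rl_kernel 1 (s - c)) \<partial>lborel) = ennreal (rl_kernel (\<gamma> + 1) (t - c))"
    by (rule rl_kernel_convolution) (use g in auto)
  show "integrable lborel (\<lambda>s. indicator {c<..} s * rl_kernel \<gamma> (t - s))"
    unfolding e by (rule integrableI_nonneg) (use g nn in auto)
  show "(\<integral>s. indicator {c<..} s * rl_kernel \<gamma> (t - s) \<partial>lborel) = rl_kernel (\<gamma> + 1) (t - c)"
    unfolding e by (subst integral_eq_nn_integral) (use g nn in auto)
qed

lemma integrable_rl_kernel_Icc:
  assumes g: "0 < \<gamma>"
  shows "integrable lborel (\<lambda>s. indicator {a..b} s * rl_kernel \<gamma> (t - s))"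
    and "integrable lborel (\<lambda>s. indicator {a..b} s * rl_kernel \<gamma> (s - t))"
    and "integrable lborel (\<lambda>r. indicator {a..b} r * rl_kernel \<gamma> r)"
proof -
  show 1: "integrable lborel (\<lambda>s. indicator {a..b} s * rl_kernel \<gamma> (t - s))" for a b t
    by (rule Bochner_Integration.integrable_bound[OF rl_kernel_has_integral_Ioi(1)[OF g, of "a - 1" t]])
       (use g in \<open>auto simp: indicator_def\<close>)
  have "integrable lborel (\<lambda>s. indicator {-b..-a} (0 + (-1) * s) * rl_kernel \<gamma> (- t - (0 + (-1) * s)))"
    by (rule lborel_integrable_real_affine[OF 1]) auto
  moreover have "(\<lambda>s. indicator {-b..-a} (0 + (-1) * s) * rl_kernel \<gamma> (- t - (0 + (-1) * s))) =
      (\<lambda>s. indicator {a..b} s * rl_kernel \<gamma> (s - t))" by (auto simp: indicator_def)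
  ultimately show "integrable lborel (\<lambda>s. indicator {a..b} s * rl_kernel \<gamma> (s - t))" by simp
  have "integrable lborel (\<lambda>s. indicator {-b..-a} (0 + (-1) * s) * rl_kernel \<gamma> (0 - (0 + (-1) * s)))"
    by (rule lborel_integrable_real_affine[OF 1]) auto
  moreover have "(\<lambda>s. indicator {-b..-a} (0 + (-1) * s) * rl_kernel \<gamma> (0 - (0 + (-1) * s))) =
      (\<lambda>s. indicator {a..b} s * rl_kernel \<gamma> s)" by (auto simp: indicator_def)
  ultimately show "integrable lborel (\<lambda>r. indicator {a..b} r * rl_kernel \<gamma> r)" by simp
qed

text \<open>
  The representatives of essentially bounded functions on \<open>{a..b}\<close> that serve as perturbations of the velocity.
\<close>

definition bounded_control :: "real \<Rightarrow> real \<Rightarrow> (real \<Rightarrow> 'a::euclidean_space) \<Rightarrow> bool" where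
  "bounded_control a b v \<longleftrightarrow> v \<in> borel_measurable borel \<and> bounded (range v) \<and> (\<forall>s. s \<notin> {a..b} \<longrightarrow> v s = 0)"

lemma bounded_controlD:
  assumes "bounded_control a b v"
  obtains C where "0 < C" "\<And>s. norm (v s) \<le> C * indicator {a..b} s"
proof -
  obtain C where C: "0 < C" "\<And>s. norm (v s) \<le> C"
    using assms unfolding bounded_control_def bounded_pos by auto
  then have "norm (v s) \<le> C * indicator {a..b} s" for s
    using assms by (auto simp: bounded_control_def indicator_def)
  with C(1) show ?thesis by (rule that)
qed

lemma bounded_control_measurable: "bounded_control a b v \<Longrightarrow> v \<in> borel_measurable borel"
  by (simp add: bounded_control_def)

lemma bounded_controlI:
  assumes "v \<in> borel_measurable borel" "\<And>s. norm (v s) \<le> C" "\<And>s. s \<notin> {a..b} \<Longrightarrow> v s = 0"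
  shows "bounded_control a b v"
  using assms unfolding bounded_control_def bounded_iff by auto

lemma integrable_bounded_control_mult:
  fixes v :: "real \<Rightarrow> 'a::euclidean_space"
  assumes v: "bounded_control a b v" and k: "integrable lborel (\<lambda>s. indicator {a..b} s * k s)"
    and [measurable]: "k \<in> borel_measurable borel"
  shows "integrable lborel (\<lambda>s. k s *\<^sub>R v s)"
proof -
  note [measurable] = bounded_control_measurable[OF v]
  obtain C where C: "0 < C" "\<And>s. norm (v s) \<le> C * indicator {a..b} s"
    using bounded_controlD[OF v] by blast
  show ?thesis
  proof (rule Bochner_Integration.integrable_bound[OF integrable_mult_right[OF k, of C]])
    show "AE s in lborel. norm (k s *\<^sub>R v s) \<le> norm (C * (indicator {a..b} s * k s))"
    proof (rule AE_I2)
      fix s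
      have "\<bar>k s\<bar> * norm (v s) \<le> \<bar>k s\<bar> * (C * indicator {a..b} s)" by (rule mult_left_mono[OF C(2)]) simp
      then show "norm (k s *\<^sub>R v s) \<le> norm (C * (indicator {a..b} s * k s))"
        using C(1) by (simp add: abs_mult mult.commute mult.left_commute)
    qed
  qed measurable
qed

lemma integrable_bounded_control:
  fixes v :: "real \<Rightarrow> 'a::euclidean_space"
  assumes v: "bounded_control a b v"
  shows "integrable lborel v"
  using integrable_bounded_control_mult[OF v, of "\<lambda>_. 1"]
  by (simp add: integrable_real_indicator emeasure_lborel_Icc_eq)

lemma rl_left_integrable:
  fixes v :: "real \<Rightarrow> 'a::euclidean_space"
  assumes "0 < \<gamma>" "bounded_control a b v"
  shows "integrable lborel (\<lambda>s. rl_kernel \<gamma> (t - s) *\<^sub>R v s)"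
  by (rule integrable_bounded_control_mult[OF assms(2) integrable_rl_kernel_Icc(1)[OF assms(1)]]) simp

lemma rl_left_add:
  assumes "0 < \<gamma>" "bounded_control a b v" "bounded_control a b w"
  shows "rl_left \<gamma> (\<lambda>s. v s + w s) t = rl_left \<gamma> v t + rl_left \<gamma> w t"
  unfolding rl_left_def scaleR_add_right
  by (rule Bochner_Integration.integral_add) (use assms rl_left_integrable in blast)+

lemma rl_left_scaleR: "rl_left \<gamma> (\<lambda>s. c *\<^sub>R v s) t = c *\<^sub>R rl_left \<gamma> v t"
proof -
  have "(\<lambda>s. rl_kernel \<gamma> (t - s) *\<^sub>R c *\<^sub>R v s) = (\<lambda>s. c *\<^sub>R (rl_kernel \<gamma> (t - s) *\<^sub>R v s))"
    by (simp add: mult.commute)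
  then show ?thesis unfolding rl_left_def by (simp only: integral_scaleR_right)
qed

lemma rl_left_start: "bounded_control a b v \<Longrightarrow> t \<le> a \<Longrightarrow> rl_left \<gamma> v t = 0"
proof -
  assume v: "bounded_control a b v" and t: "t \<le> a"
  have "(\<lambda>s. rl_kernel \<gamma> (t - s) *\<^sub>R v s) = (\<lambda>_. 0)"
  proof
    show "rl_kernel \<gamma> (t - s) *\<^sub>R v s = 0" for s
      using v t by (cases "s < a") (auto simp: bounded_control_def)
  qed
  then show "rl_left \<gamma> v t = 0" by (simp add: rl_left_def)
qed

lemma rl_left_measurable [measurable (raw)]:
  assumes [measurable]: "v \<in> borel_measurable borel"
  shows "rl_left \<gamma> v \<in> borel_measurable borel"
  unfolding rl_left_def by measurable

lemma rl_right_measurable [measurable (raw)]: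
  assumes [measurable]: "v \<in> borel_measurable borel"
  shows "rl_right \<gamma> v \<in> borel_measurable borel"
  unfolding rl_right_def by measurable

text \<open>
  The substitution \<open>r = t - s\<close> bounds the truncation error, uniformly in \<open>t\<close>, by that of the kernel on \<open>{0..b-a}\<close>,
  which tends to zero by dominated convergence.
\<close>

lemma rl_kernel_tail:
  assumes g: "0 < \<gamma>" and e: "0 < \<epsilon>"
  obtains n :: nat where
    "\<And>t. t \<in> {a..b} \<Longrightarrow> (\<integral>s. indicator {a..b} s * (rl_kernel \<gamma> (t - s) - min (rl_kernel \<gamma> (t - s)) n) \<partial>lborel) < \<epsilon>"
proof -
  let ?h = "\<lambda>(n::nat) r. indicator {0..b-a} r * (rl_kernel \<gamma> r - min (rl_kernel \<gamma> r) n)"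
  have nn: "0 \<le> rl_kernel \<gamma> r - min (rl_kernel \<gamma> r) (real n)" for r n by simp
  have ub: "rl_kernel \<gamma> r - min (rl_kernel \<gamma> r) (real n) \<le> rl_kernel \<gamma> r" for r n using g by simp
  have hint: "integrable lborel (?h n)" for n
    by (rule Bochner_Integration.integrable_bound[OF integrable_rl_kernel_Icc(3)[OF g, of 0 "b-a"]])
       (use nn ub g in \<open>auto simp: indicator_def\<close>)
  have "(\<lambda>n. integral\<^sup>L lborel (?h n)) \<longlonglongrightarrow> integral\<^sup>L lborel (\<lambda>_::real. 0::real)"
  proof (rule integral_dominated_convergence)
    show "integrable lborel (\<lambda>r. indicator {0..b-a} r * rl_kernel \<gamma> r)" by (rule integrable_rl_kernel_Icc(3)[OF g])
    show "AE r in lborel. norm (?h n r) \<le> indicator {0..b-a} r * rl_kernel \<gamma> r" for n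
      using nn ub g by (auto simp: indicator_def)
    show "AE r in lborel. (\<lambda>n. ?h n r) \<longlonglongrightarrow> 0"
    proof (rule AE_I2)
      fix r
      obtain N :: nat where "rl_kernel \<gamma> r \<le> real N" using real_arch_simple by blast
      then have "?h n r = 0" if "N \<le> n" for n using that by (simp add: min_def)
      then have "\<forall>\<^sub>F n in sequentially. ?h n r = 0" by (rule eventually_sequentiallyI)
      then show "(\<lambda>n. ?h n r) \<longlonglongrightarrow> 0" by (rule tendsto_eventually)
    qed
  qed auto
  then have "\<forall>\<^sub>F n in sequentially. integral\<^sup>L lborel (?h n) < \<epsilon>"
    using e by (intro order_tendstoD(2)) auto
  then obtain n where n: "integral\<^sup>L lborel (?h n) < \<epsilon>" by (auto simp: eventually_sequentially)
  show ?thesis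
  proof (rule that[of n])
    fix t assume t: "t \<in> {a..b}"
    have "(\<integral>s. indicator {a..b} s * (rl_kernel \<gamma> (t - s) - min (rl_kernel \<gamma> (t - s)) n) \<partial>lborel) =
      \<bar>-1\<bar> *\<^sub>R (\<integral>r. indicator {a..b} (t + (-1) * r) * (rl_kernel \<gamma> (t - (t + (-1) * r)) - min (rl_kernel \<gamma> (t - (t + (-1) * r))) n) \<partial>lborel)"
      by (rule lborel_integral_real_affine) simp
    also have "\<dots> = (\<integral>r. indicator {a..b} (t - r) * (rl_kernel \<gamma> r - min (rl_kernel \<gamma> r) n) \<partial>lborel)" by simp
    also have "\<dots> \<le> integral\<^sup>L lborel (?h n)"
    proof (rule integral_mono)
      have le: "indicator {a..b} (t - r) * (rl_kernel \<gamma> r - min (rl_kernel \<gamma> r) n) \<le> ?h n r" for r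
        using t by (cases "r \<le> 0") (auto simp: indicator_def)
      show "indicator {a..b} (t - r) * (rl_kernel \<gamma> r - min (rl_kernel \<gamma> r) n) \<le> ?h n r" for r by (rule le)
      show "integrable lborel (?h n)" by (rule hint)
      show "integrable lborel (\<lambda>r. indicator {a..b} (t - r) * (rl_kernel \<gamma> r - min (rl_kernel \<gamma> r) n))"
      proof (rule Bochner_Integration.integrable_bound[OF hint[of n]])
        show "AE r in lborel. norm (indicator {a..b} (t - r) * (rl_kernel \<gamma> r - min (rl_kernel \<gamma> r) n)) \<le> norm (?h n r)"
          using t by (intro AE_I2) (auto simp: indicator_def)
      qed measurable
    qed
    finally show "(\<integral>s. indicator {a..b} s * (rl_kernel \<gamma> (t - s) - min (rl_kernel \<gamma> (t - s)) n) \<partial>lborel) < \<epsilon>"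
      using n by linarith
  qed
qed

text \<open>
  The part of the kernel below the level \<open>n\<close> contributes at most \<open>n\<close> times the measure of the set.
\<close>

lemma rl_kernel_small_set:
  assumes g: "0 < \<gamma>" and e: "0 < \<epsilon>"
  obtains \<delta> where "0 < \<delta>"
    "\<And>A t. \<lbrakk>A \<in> sets borel; A \<subseteq> {a..b}; measure lborel A < \<delta>; t \<in> {a..b}\<rbrakk>
       \<Longrightarrow> (\<integral>s. indicator A s * rl_kernel \<gamma> (t - s) \<partial>lborel) < \<epsilon>"
proof -
  have e2: "0 < \<epsilon> / 2" using e by simp
  obtain n :: nat where n: "\<And>t. t \<in> {a..b} \<Longrightarrow>
      (\<integral>s. indicator {a..b} s * (rl_kernel \<gamma> (t - s) - min (rl_kernel \<gamma> (t - s)) n) \<partial>lborel) < \<epsilon> / 2"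
    using rl_kernel_tail[OF g e2] by blast
  show ?thesis
  proof (rule that[of "\<epsilon> / (2 * (real n + 1))"])
    show "0 < \<epsilon> / (2 * (real n + 1))" using e by simp
    fix A t assume A: "A \<in> sets borel" "A \<subseteq> {a..b}" "measure lborel A < \<epsilon> / (2 * (real n + 1))" and t: "t \<in> {a..b}"
    note [measurable] = A(1)
    let ?d = "\<lambda>s. indicator {a..b} s * (rl_kernel \<gamma> (t - s) - min (rl_kernel \<gamma> (t - s)) n)"
    have fin: "emeasure lborel A < \<infinity>"
      by (rule emeasure_bounded_finite[OF bounded_subset[OF bounded_closed_interval A(2)]])
    have i1: "integrable lborel ?d"
      by (rule Bochner_Integration.integrable_bound[OF integrable_rl_kernel_Icc(1)[OF g, of a b t]])
         (use g in \<open>auto simp: indicator_def\<close>)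
    have i2: "integrable lborel (\<lambda>s. real n * indicator A s)" using fin by (intro integrable_mult_right) auto
    have "(\<integral>s. indicator A s * rl_kernel \<gamma> (t - s) \<partial>lborel) \<le> (\<integral>s. ?d s + real n * indicator A s \<partial>lborel)"
    proof (rule integral_mono_AE')
      show "integrable lborel (\<lambda>s. ?d s + real n * indicator A s)" using i1 i2 by (rule Bochner_Integration.integrable_add)
      show "AE s in lborel. indicator A s * rl_kernel \<gamma> (t - s) \<le> ?d s + real n * indicator A s"
        using A(2) by (intro AE_I2) (auto simp: indicator_def)
      show "AE s in lborel. 0 \<le> ?d s + real n * indicator A s" by (intro AE_I2) (auto simp: indicator_def)
    qed
    also have "\<dots> = integral\<^sup>L lborel ?d + real n * measure lborel A"
      using i1 i2 A(1) by (subst Bochner_Integration.integral_add) (auto simp: )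
    also have "real n * measure lborel A \<le> (real n + 1) * measure lborel A" by (rule mult_right_mono) auto
    also have "(real n + 1) * measure lborel A < (real n + 1) * (\<epsilon> / (2 * (real n + 1)))"
      by (rule mult_strict_left_mono[OF A(3)]) simp
    also have "\<dots> = \<epsilon> / 2" by (simp add: field_simps)
    finally show "(\<integral>s. indicator A s * rl_kernel \<gamma> (t - s) \<partial>lborel) < \<epsilon>" using n[OF t] by linarith
  qed
qed

text \<open>
  With a truncated kernel the integral is continuous by dominated convergence, and the truncation error is uniform
  in \<open>t\<close>.
\<close>

lemma rl_left_continuous:
  fixes v :: "real \<Rightarrow> 'a::euclidean_space"
  assumes g: "0 < \<gamma>" and v: "bounded_control a b v"
  shows "continuous_on {a..b} (rl_left \<gamma> v)"
proof -
  note [measurable] = bounded_control_measurable[OF v]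
  obtain C where C: "0 < C" "\<And>s. norm (v s) \<le> C * indicator {a..b} s"
    using bounded_controlD[OF v] by blast
  let ?k = "\<lambda>(n::nat) r. min (rl_kernel \<gamma> r) (real n)"
  define J where "J n t = (\<integral>s. ?k n (t - s) *\<^sub>R v s \<partial>lborel)" for n :: nat and t
  have k0: "0 \<le> ?k n r" "?k n r \<le> real n" for n r using g by auto
  have i: "integrable lborel (\<lambda>s. ?k n (t - s) *\<^sub>R v s)" for n t
  proof (rule integrable_bounded_control_mult[OF v])
    show "integrable lborel (\<lambda>s. indicator {a..b} s * ?k n (t - s))"
      by (rule Bochner_Integration.integrable_bound[OF integrable_rl_kernel_Icc(1)[OF g, of a b t]])
       (use g in \<open>auto simp: indicator_def\<close>)
  qed measurable
  have Jc: "continuous_on UNIV (J n)" for n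
  proof (intro continuous_at_imp_continuous_on ballI)
    fix t
    show "isCont (J n) t"
      unfolding continuous_at_sequentially comp_def
    proof (intro allI impI)
      fix X assume X: "X \<longlonglongrightarrow> t"
      show "(\<lambda>m. J n (X m)) \<longlonglongrightarrow> J n t"
        unfolding J_def
      proof (rule integral_dominated_convergence[where w = "\<lambda>s. real n * (C * indicator {a..b} s)"])
        show "integrable lborel (\<lambda>s. real n * (C * indicator {a..b} s))"
          by (simp add: emeasure_lborel_Icc_eq)
        show "AE s in lborel. norm (?k n (X m - s) *\<^sub>R v s) \<le> real n * (C * indicator {a..b} s)" for m
        proof (rule AE_I2)
          fix s
          have "\<bar>?k n (X m - s)\<bar> * norm (v s) \<le> real n * (C * indicator {a..b} s)"
            by (rule mult_mono) (use k0[of "X m - s" n] C(2)[of s] in auto)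
          then show "norm (?k n (X m - s) *\<^sub>R v s) \<le> real n * (C * indicator {a..b} s)" by simp
        qed
        show "AE s in lborel. (\<lambda>m. ?k n (X m - s) *\<^sub>R v s) \<longlonglongrightarrow> ?k n (t - s) *\<^sub>R v s"
          using AE_lborel_singleton[of t]
        proof eventually_elim
          case (elim s)
          have "isCont (rl_kernel \<gamma>) (t - s)"
          proof (cases "s < t")
            case True
            have "\<forall>\<^sub>F r in nhds (t - s). rl_kernel \<gamma> r = r powr (\<gamma> - 1) / Gamma \<gamma>"
              using eventually_nhds_in_open[of "{0<..}" "t - s"] True
              by (auto elim!: eventually_mono simp: rl_kernel_def)
            moreover have "isCont (\<lambda>r. r powr (\<gamma> - 1) / Gamma \<gamma>) (t - s)"
              using True Gamma_real_pos[OF g] by (intro continuous_intros) auto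
            ultimately show ?thesis by (simp add: isCont_cong)
          next
            case False
            have "\<forall>\<^sub>F r in nhds (t - s). r \<in> {..<0}"
              by (rule eventually_nhds_in_open) (use False elim in auto)
            then have "\<forall>\<^sub>F r in nhds (t - s). rl_kernel \<gamma> r = 0"
              by eventually_elim simp
            then show ?thesis by (simp add: isCont_cong)
          qed
          moreover have "(\<lambda>m. X m - s) \<longlonglongrightarrow> t - s" using X by (intro tendsto_intros)
          ultimately have "(\<lambda>m. rl_kernel \<gamma> (X m - s)) \<longlonglongrightarrow> rl_kernel \<gamma> (t - s)"
            by (rule isCont_tendsto_compose)
          then show ?case by (intro tendsto_intros)
        qed
      qed measurable
    qed
  qed
  have diff: "norm (rl_left \<gamma> v t - J n t) \<le>
     C * (\<integral>s. indicator {a..b} s * (rl_kernel \<gamma> (t - s) - ?k n (t - s)) \<partial>lborel)" for t n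
  proof -
    have i3: "integrable lborel (\<lambda>s. indicator {a..b} s * (rl_kernel \<gamma> (t - s) - ?k n (t - s)))"
      by (rule Bochner_Integration.integrable_bound[OF integrable_rl_kernel_Icc(1)[OF g, of a b t]])
         (use g in \<open>auto simp: indicator_def\<close>)
    have "rl_left \<gamma> v t - J n t = (\<integral>s. (rl_kernel \<gamma> (t - s) - ?k n (t - s)) *\<^sub>R v s \<partial>lborel)"
      unfolding rl_left_def J_def scaleR_diff_left
      by (rule Bochner_Integration.integral_diff[symmetric]) (rule rl_left_integrable[OF g v], rule i)
    also have "norm \<dots> \<le> (\<integral>s. norm ((rl_kernel \<gamma> (t - s) - ?k n (t - s)) *\<^sub>R v s) \<partial>lborel)"
      by (rule integral_norm_bound)
    also have "\<dots> \<le> (\<integral>s. C * (indicator {a..b} s * (rl_kernel \<gamma> (t - s) - ?k n (t - s))) \<partial>lborel)"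
    proof (rule integral_mono)
      show "integrable lborel (\<lambda>s. norm ((rl_kernel \<gamma> (t - s) - ?k n (t - s)) *\<^sub>R v s))"
        by (rule integrable_norm, rule integrable_bounded_control_mult[OF v i3]) measurable
      show "integrable lborel (\<lambda>s. C * (indicator {a..b} s * (rl_kernel \<gamma> (t - s) - ?k n (t - s))))"
        using i3 by (rule integrable_mult_right)
      fix s
      have "(rl_kernel \<gamma> (t - s) - ?k n (t - s)) * norm (v s) \<le> (rl_kernel \<gamma> (t - s) - ?k n (t - s)) * (C * indicator {a..b} s)"
        by (rule mult_left_mono[OF C(2)]) simp
      then show "norm ((rl_kernel \<gamma> (t - s) - ?k n (t - s)) *\<^sub>R v s) \<le> C * (indicator {a..b} s * (rl_kernel \<gamma> (t - s) - ?k n (t - s)))"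
        by (simp add: mult.commute mult.left_commute)
    qed
    finally show ?thesis by simp
  qed
  show ?thesis
    unfolding continuous_on_iff
  proof (intro ballI allI impI)
    fix t e :: real assume t: "t \<in> {a..b}" and e: "0 < e"
    have e3: "0 < e / 3 / C" using e C(1) by simp
    obtain n :: nat where n: "\<And>t. t \<in> {a..b} \<Longrightarrow>
      (\<integral>s. indicator {a..b} s * (rl_kernel \<gamma> (t - s) - ?k n (t - s)) \<partial>lborel) < e / 3 / C"
      using rl_kernel_tail[OF g e3] by blast
    have close: "norm (rl_left \<gamma> v t - J n t) < e / 3" if "t \<in> {a..b}" for t
    proof -
      have "C * (\<integral>s. indicator {a..b} s * (rl_kernel \<gamma> (t - s) - ?k n (t - s)) \<partial>lborel) < C * (e / 3 / C)"
        by (rule mult_strict_left_mono[OF n[OF that] C(1)])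
      with diff[of t n] show ?thesis using C(1) by simp
    qed
    obtain d where d: "0 < d" "\<And>t'. dist t' t < d \<Longrightarrow> dist (J n t') (J n t) < e / 3"
      using Jc[of n] e unfolding continuous_on_iff by (metis UNIV_I divide_pos_pos zero_less_numeral)
    show "\<exists>d>0. \<forall>t'\<in>{a..b}. dist t' t < d \<longrightarrow> dist (rl_left \<gamma> v t') (rl_left \<gamma> v t) < e"
    proof (intro exI[of _ d] conjI ballI impI d(1))
      fix t' assume t': "t' \<in> {a..b}" "dist t' t < d"
      have "rl_left \<gamma> v t' - rl_left \<gamma> v t = (rl_left \<gamma> v t' - J n t') + (J n t' - J n t) - (rl_left \<gamma> v t - J n t)" by simp
      also have "norm \<dots> < e / 3 + e / 3 + e / 3"
        using close[OF t'(1)] close[OF t] d(2)[OF t'(2)]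
        by (smt (verit) dist_norm norm_triangle_ineq norm_triangle_ineq4)
      finally show "dist (rl_left \<gamma> v t') (rl_left \<gamma> v t) < e" by (simp add: dist_norm)
    qed
  qed
qed

section \<open>Fractional integration by parts and absolutely continuous primitives\<close>

lemma integrable_rl_pair:
  fixes f :: "real \<Rightarrow> 'a::euclidean_space"
  assumes g: "0 < \<gamma>" and f: "integrable lborel f" and supp: "\<And>t. t \<notin> {a..b} \<Longrightarrow> f t = 0"
  shows "integrable (lborel \<Otimes>\<^sub>M lborel) (\<lambda>(t, s). (indicator {a..b} s * rl_kernel \<gamma> (t - s)) *\<^sub>R f t)"
proof -
  let ?F = "\<lambda>(t, s). (indicator {a..b} s * rl_kernel \<gamma> (t - s)) *\<^sub>R f t"
  have [measurable]: "f \<in> borel_measurable borel" using f by auto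
  have Fm: "?F \<in> borel_measurable (lborel \<Otimes>\<^sub>M lborel)" by (simp add: split_beta')
  define M where "M = (b - a + 1) powr \<gamma> / Gamma (\<gamma> + 1)"
  have M0: "0 \<le> M" using g Gamma_real_pos[of "\<gamma> + 1"] by (auto simp: M_def)
  have inner: "(\<integral>\<^sup>+s. ennreal (norm (?F (t, s))) \<partial>lborel) \<le> ennreal M * ennreal (norm (f t))" for t
  proof (cases "t \<in> {a..b}")
    case False then show ?thesis by (simp add: supp)
  next
    case True
    have "(\<integral>\<^sup>+s. ennreal (norm (?F (t, s))) \<partial>lborel) \<le>
        (\<integral>\<^sup>+s. ennreal (rl_kernel \<gamma> (t - s) * rl_kernel 1 (s - (a - 1))) * ennreal (norm (f t)) \<partial>lborel)"
      by (rule nn_integral_mono)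
         (use g in \<open>auto simp: rl_kernel_1 indicator_def ennreal_mult'[symmetric] intro!: ennreal_leI\<close>)
    also have "\<dots> = ennreal (rl_kernel (\<gamma> + 1) (t - (a - 1))) * ennreal (norm (f t))"
      using rl_kernel_convolution[OF g, of 1 t "a - 1"] by (subst nn_integral_multc) auto
    also have "\<dots> \<le> ennreal M * ennreal (norm (f t))"
    proof (intro mult_right_mono ennreal_leI)
      show "rl_kernel (\<gamma> + 1) (t - (a - 1)) \<le> M"
        using True g Gamma_real_pos[of "\<gamma> + 1"] unfolding rl_kernel_def M_def
        by (auto intro!: divide_right_mono powr_mono2)
    qed simp
    finally show ?thesis .
  qed
  have "(\<integral>\<^sup>+x. ennreal (norm (?F x)) \<partial>(lborel \<Otimes>\<^sub>M lborel)) =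
      (\<integral>\<^sup>+t. (\<integral>\<^sup>+s. ennreal (norm (?F (t, s))) \<partial>lborel) \<partial>lborel)"
    using lborel.nn_integral_fst[of "\<lambda>x. ennreal (norm (?F x))" lborel] Fm by simp
  also have "\<dots> \<le> (\<integral>\<^sup>+t. ennreal M * ennreal (norm (f t)) \<partial>lborel)"
    by (rule nn_integral_mono) (rule inner)
  also have "\<dots> = ennreal M * (\<integral>\<^sup>+t. ennreal (norm (f t)) \<partial>lborel)" by (rule nn_integral_cmult) simp
  also have "\<dots> < \<infinity>" using f by (auto simp: integrable_iff_bounded ennreal_mult_less_top)
  finally show ?thesis using Fm by (simp add: integrable_iff_bounded)
qed

lemma rl_right_integrable_Icc:
  fixes f :: "real \<Rightarrow> 'a::euclidean_space"
  assumes "0 < \<gamma>" "integrable lborel f" "\<And>t. t \<notin> {a..b} \<Longrightarrow> f t = 0"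
  shows "integrable lborel (\<lambda>s. indicator {a..b} s *\<^sub>R rl_right \<gamma> f s)"
proof -
  have "integrable lborel (\<lambda>s. \<integral>t. (indicator {a..b} s * rl_kernel \<gamma> (t - s)) *\<^sub>R f t \<partial>lborel)"
    using lborel_pair.integrable_snd[OF integrable_rl_pair[OF assms]] by simp
  then show ?thesis by (simp only: rl_right_def scaleR_scaleR[symmetric] integral_scaleR_right)
qed

text \<open>
  Fractional integration by parts, which is Fubini's theorem. The left integral at \<open>t\<close> looks at times before \<open>t\<close>, so
  the right integral at \<open>s\<close> looks at times after \<open>s\<close>.
\<close>

proposition rl_integral_duality:
  fixes f v :: "real \<Rightarrow> 'a::euclidean_space"
  assumes g: "0 < \<gamma>" and f: "integrable lborel f" and supp: "\<And>t. t \<notin> {a..b} \<Longrightarrow> f t = 0"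
    and v: "bounded_control a b v"
  shows "(\<integral>t. f t \<bullet> rl_left \<gamma> v t \<partial>lborel) = (\<integral>s. rl_right \<gamma> f s \<bullet> v s \<partial>lborel)"
    and "integrable lborel (\<lambda>t. f t \<bullet> rl_left \<gamma> v t)"
    and "integrable lborel (\<lambda>s. rl_right \<gamma> f s \<bullet> v s)"
proof -
  have [measurable]: "f \<in> borel_measurable borel" using f by auto
  note [measurable] = bounded_control_measurable[OF v]
  obtain C where C: "0 < C" "\<And>s. norm (v s) \<le> C * indicator {a..b} s"
    using bounded_controlD[OF v] by blast
  let ?G = "\<lambda>t s. rl_kernel \<gamma> (t - s) * (f t \<bullet> v s)"
  have G: "integrable (lborel \<Otimes>\<^sub>M lborel) (case_prod ?G)"
  proof (rule Bochner_Integration.integrable_bound[OF integrable_mult_right[OF integrable_norm[OF integrable_rl_pair[OF g f supp]], of C]])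
    show "AE x in lborel \<Otimes>\<^sub>M lborel. norm (case_prod ?G x)
        \<le> norm (C * norm (case x of (t, s) \<Rightarrow> (indicator {a..b} s * rl_kernel \<gamma> (t - s)) *\<^sub>R f t))"
    proof (rule AE_I2, clarify)
      fix t s :: real
      have "\<bar>f t \<bullet> v s\<bar> \<le> norm (f t) * norm (v s)" by (rule Cauchy_Schwarz_ineq2)
      also have "\<dots> \<le> norm (f t) * (C * indicator {a..b} s)" by (rule mult_left_mono[OF C(2)]) simp
      finally have "rl_kernel \<gamma> (t - s) * \<bar>f t \<bullet> v s\<bar> \<le> rl_kernel \<gamma> (t - s) * (norm (f t) * (C * indicator {a..b} s))"
        using g by (intro mult_left_mono) auto
      then show "norm (?G t s) \<le> norm (C * norm ((indicator {a..b} s * rl_kernel \<gamma> (t - s)) *\<^sub>R f t))"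
        using g C(1) by (simp add: abs_mult mult.commute mult.left_commute)
    qed
    show "case_prod ?G \<in> borel_measurable (lborel \<Otimes>\<^sub>M lborel)"
      unfolding split_beta' by measurable
  qed
  have "(\<integral>s. (\<integral>t. ?G t s \<partial>lborel) \<partial>lborel) = (\<integral>t. (\<integral>s. ?G t s \<partial>lborel) \<partial>lborel)"
    by (rule lborel_pair.Fubini_integral[OF G])
  moreover have 1: "(\<integral>s. ?G t s \<partial>lborel) = f t \<bullet> rl_left \<gamma> v t" for t
    using integral_inner_right[of "f t" lborel "\<lambda>s. rl_kernel \<gamma> (t - s) *\<^sub>R v s"] rl_left_integrable[OF g v]
    by (simp add: rl_left_def)
  moreover have ae: "AE s in lborel. integrable lborel (\<lambda>t. (indicator {a..b} s * rl_kernel \<gamma> (t - s)) *\<^sub>R f t)"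
    using lborel_pair.AE_integrable_snd[OF integrable_rl_pair[OF g f supp]] by simp
  moreover from ae have 2: "AE s in lborel. (\<integral>t. ?G t s \<partial>lborel) = rl_right \<gamma> f s \<bullet> v s"
  proof eventually_elim
    case (elim s)
    show ?case
    proof (cases "s \<in> {a..b}")
      case False
      then have "v s = 0" using v by (auto simp: bounded_control_def)
      then show ?thesis by simp
    next
      case True
      then have "integrable lborel (\<lambda>t. rl_kernel \<gamma> (t - s) *\<^sub>R f t)" using elim by simp
      then have "(\<integral>t. (rl_kernel \<gamma> (t - s) *\<^sub>R f t) \<bullet> v s \<partial>lborel) = rl_right \<gamma> f s \<bullet> v s"
        unfolding rl_right_def by (intro integral_inner_left)
      then show ?thesis by simp
    qed
  qed
  moreover have "(\<integral>s. (\<integral>t. ?G t s \<partial>lborel) \<partial>lborel) = (\<integral>s. rl_right \<gamma> f s \<bullet> v s \<partial>lborel)"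
    by (rule integral_cong_AE) (use 2 in measurable)
  ultimately show "(\<integral>t. f t \<bullet> rl_left \<gamma> v t \<partial>lborel) = (\<integral>s. rl_right \<gamma> f s \<bullet> v s \<partial>lborel)" by simp
  show "integrable lborel (\<lambda>t. f t \<bullet> rl_left \<gamma> v t)"
    using lborel_pair.integrable_fst[OF G] by (simp add: 1)
  have "integrable lborel (\<lambda>s. \<integral>t. ?G t s \<partial>lborel)"
    using lborel_pair.integrable_snd[OF G] by simp
  then show "integrable lborel (\<lambda>s. rl_right \<gamma> f s \<bullet> v s)"
    by (rule integrable_cong_AE_imp) (use 2 in \<open>auto elim: eventually_mono\<close>)
qed

lemma AC_I:
  assumes "\<And>\<epsilon>. 0 < \<epsilon> \<Longrightarrow> \<exists>\<delta>>0. \<forall>(m::nat) s t. (\<forall>i<m. a \<le> s i \<and> s i \<le> t i \<and> t i \<le> b) \<longrightarrow>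
       (\<forall>i<m. \<forall>k<m. i \<noteq> k \<longrightarrow> {s i<..<t i} \<inter> {s k<..<t k} = {}) \<longrightarrow>
       (\<Sum>i<m. t i - s i) < \<delta> \<longrightarrow> (\<Sum>i<m. norm (F (t i) - F (s i))) < \<epsilon>"
  shows "F \<in> AC a b"
  using assms unfolding AC_def by (simp only: mem_Collect_eq imp_conjL) simp

lemma AC_add:
  assumes "F \<in> AC a b" "G \<in> AC a b"
  shows "(\<lambda>t. F t + G t) \<in> AC a b"
proof (rule AC_I)
  fix \<epsilon> :: real assume "0 < \<epsilon>"
  then have e: "0 < \<epsilon> / 2" by simp
  obtain d1 where d1: "0 < d1" and F: "\<And>(I::nat set) s t. \<lbrakk>finite I; \<And>i. i \<in> I \<Longrightarrow> a \<le> s i \<and> s i \<le> t i \<and> t i \<le> b;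
        \<And>i k. \<lbrakk>i \<in> I; k \<in> I; i \<noteq> k\<rbrakk> \<Longrightarrow> {s i<..<t i} \<inter> {s k<..<t k} = {}; (\<Sum>i\<in>I. t i - s i) < d1\<rbrakk>
      \<Longrightarrow> (\<Sum>i\<in>I. norm (F (t i) - F (s i))) < \<epsilon> / 2"
    by (rule AC_finite_family[OF assms(1) e]) blast
  obtain d2 where d2: "0 < d2" and G: "\<And>(I::nat set) s t. \<lbrakk>finite I; \<And>i. i \<in> I \<Longrightarrow> a \<le> s i \<and> s i \<le> t i \<and> t i \<le> b;
        \<And>i k. \<lbrakk>i \<in> I; k \<in> I; i \<noteq> k\<rbrakk> \<Longrightarrow> {s i<..<t i} \<inter> {s k<..<t k} = {}; (\<Sum>i\<in>I. t i - s i) < d2\<rbrakk>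
      \<Longrightarrow> (\<Sum>i\<in>I. norm (G (t i) - G (s i))) < \<epsilon> / 2"
    by (rule AC_finite_family[OF assms(2) e]) blast
  show "\<exists>\<delta>>0. \<forall>(m::nat) s t. (\<forall>i<m. a \<le> s i \<and> s i \<le> t i \<and> t i \<le> b) \<longrightarrow>
       (\<forall>i<m. \<forall>k<m. i \<noteq> k \<longrightarrow> {s i<..<t i} \<inter> {s k<..<t k} = {}) \<longrightarrow>
       (\<Sum>i<m. t i - s i) < \<delta> \<longrightarrow> (\<Sum>i<m. norm (F (t i) + G (t i) - (F (s i) + G (s i)))) < \<epsilon>"
  proof (intro exI[of _ "min d1 d2"] conjI allI impI)
    show "0 < min d1 d2" using d1 d2 by simp
    fix m :: nat and s t
    assume A: "\<forall>i<m. a \<le> s i \<and> s i \<le> t i \<and> t i \<le> b"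
       "\<forall>i<m. \<forall>k<m. i \<noteq> k \<longrightarrow> {s i<..<t i} \<inter> {s k<..<t k} = {}" "(\<Sum>i<m. t i - s i) < min d1 d2"
    have "(\<Sum>i<m. norm (F (t i) + G (t i) - (F (s i) + G (s i)))) \<le>
        (\<Sum>i<m. norm (F (t i) - F (s i)) + norm (G (t i) - G (s i)))"
      by (rule sum_mono) (metis add_diff_add norm_triangle_ineq)
    also have "\<dots> = (\<Sum>i<m. norm (F (t i) - F (s i))) + (\<Sum>i<m. norm (G (t i) - G (s i)))"
      by (rule sum.distrib)
    also have "\<dots> < \<epsilon> / 2 + \<epsilon> / 2"
      by (intro add_strict_mono F G) (use A in auto)
    finally show "(\<Sum>i<m. norm (F (t i) + G (t i) - (F (s i) + G (s i)))) < \<epsilon>" by simp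
  qed
qed

text \<open>
  Absolute continuity sees a function only through the norms of its increments inside the interval. This transfers it
  between functions that agree there, or that differ by a constant.
\<close>

lemma AC_same_increments:
  assumes "F \<in> AC a b" and "\<And>s t. s \<in> {a..b} \<Longrightarrow> t \<in> {a..b} \<Longrightarrow> norm (G t - G s) = norm (F t - F s)"
  shows "G \<in> AC a b"
proof (rule AC_I)
  fix \<epsilon> :: real assume e: "0 < \<epsilon>"
  obtain d1 where d1: "0 < d1" and F: "\<And>(I::nat set) s t. \<lbrakk>finite I; \<And>i. i \<in> I \<Longrightarrow> a \<le> s i \<and> s i \<le> t i \<and> t i \<le> b;
        \<And>i k. \<lbrakk>i \<in> I; k \<in> I; i \<noteq> k\<rbrakk> \<Longrightarrow> {s i<..<t i} \<inter> {s k<..<t k} = {}; (\<Sum>i\<in>I. t i - s i) < d1\<rbrakk>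
      \<Longrightarrow> (\<Sum>i\<in>I. norm (F (t i) - F (s i))) < \<epsilon>"
    by (rule AC_finite_family[OF assms(1) e]) blast
  show "\<exists>\<delta>>0. \<forall>(m::nat) s t. (\<forall>i<m. a \<le> s i \<and> s i \<le> t i \<and> t i \<le> b) \<longrightarrow>
       (\<forall>i<m. \<forall>k<m. i \<noteq> k \<longrightarrow> {s i<..<t i} \<inter> {s k<..<t k} = {}) \<longrightarrow>
       (\<Sum>i<m. t i - s i) < \<delta> \<longrightarrow> (\<Sum>i<m. norm (G (t i) - G (s i))) < \<epsilon>"
  proof (intro exI[of _ d1] conjI allI impI d1)
    fix m :: nat and s t
    assume A: "\<forall>i<m. a \<le> s i \<and> s i \<le> t i \<and> t i \<le> b"
       "\<forall>i<m. \<forall>k<m. i \<noteq> k \<longrightarrow> {s i<..<t i} \<inter> {s k<..<t k} = {}" "(\<Sum>i<m. t i - s i) < d1"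
    have "(\<Sum>i<m. norm (G (t i) - G (s i))) = (\<Sum>i<m. norm (F (t i) - F (s i)))"
    proof (rule sum.cong[OF refl])
      fix i assume "i \<in> {..<m}"
      then have "a \<le> s i \<and> s i \<le> t i \<and> t i \<le> b" using A(1) by simp
      then have "s i \<in> {a..b}" "t i \<in> {a..b}" by auto
      then show "norm (G (t i) - G (s i)) = norm (F (t i) - F (s i))" by (rule assms(2))
    qed
    also have "\<dots> < \<epsilon>" by (rule F) (use A in auto)
    finally show "(\<Sum>i<m. norm (G (t i) - G (s i))) < \<epsilon>" .
  qed
qed

lemma AC_continuous_on:
  assumes "F \<in> AC a b"
  shows "continuous_on {a..b} F"
  unfolding continuous_on_iff
proof (intro ballI allI impI)
  fix t e :: real assume t: "t \<in> {a..b}" and e: "0 < e"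
  obtain d where d: "0 < d" and F: "\<And>(I::nat set) s t. \<lbrakk>finite I; \<And>i. i \<in> I \<Longrightarrow> a \<le> s i \<and> s i \<le> t i \<and> t i \<le> b;
        \<And>i k. \<lbrakk>i \<in> I; k \<in> I; i \<noteq> k\<rbrakk> \<Longrightarrow> {s i<..<t i} \<inter> {s k<..<t k} = {}; (\<Sum>i\<in>I. t i - s i) < d\<rbrakk>
      \<Longrightarrow> (\<Sum>i\<in>I. norm (F (t i) - F (s i))) < e"
    by (rule AC_finite_family[OF assms e]) blast
  show "\<exists>d>0. \<forall>t'\<in>{a..b}. dist t' t < d \<longrightarrow> dist (F t') (F t) < e"
  proof (intro exI[of _ d] conjI ballI impI d)
    fix t' assume t': "t' \<in> {a..b}" "dist t' t < d"
    have "(\<Sum>i\<in>{0::nat}. norm (F (max t t') - F (min t t'))) < e"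
      by (rule F) (use t t' in \<open>auto simp: dist_real_def\<close>)
    then show "dist (F t') (F t) < e"
      by (cases "t \<le> t'") (auto simp: dist_norm norm_minus_commute max_def min_def)
  qed
qed

text \<open>
  The part of \<open>norm (f r)\<close> above a high level has a small integral, and the part below contributes at most the level
  times the total length of the family.
\<close>

lemma integral_small_on_small_families:
  fixes f :: "real \<Rightarrow> 'a::euclidean_space"
  assumes f: "integrable lborel f" and e: "0 < \<epsilon>"
  obtains \<delta> where "0 < \<delta>"
    "\<And>(m::nat) s t. \<lbrakk>\<And>i. i < m \<Longrightarrow> s i \<le> t i; \<And>i k. \<lbrakk>i < m; k < m; i \<noteq> k\<rbrakk> \<Longrightarrow> {s i<..<t i} \<inter> {s k<..<t k} = {};
       (\<Sum>i<m. t i - s i) < \<delta>\<rbrakk> \<Longrightarrow> (\<Sum>i<m. \<integral>r. indicator {s i<..<t i} r * norm (f r) \<partial>lborel) < \<epsilon>"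
proof -
  have [measurable]: "f \<in> borel_measurable borel" using f by auto
  let ?h = "\<lambda>(n::nat) r. norm (f r) - min (norm (f r)) n"
  have hint: "integrable lborel (?h n)" for n
    by (rule Bochner_Integration.integrable_bound[OF f]) auto
  have "(\<lambda>n. integral\<^sup>L lborel (?h n)) \<longlonglongrightarrow> integral\<^sup>L lborel (\<lambda>_::real. 0::real)"
  proof (rule integral_dominated_convergence)
    show "integrable lborel (\<lambda>r. norm (f r))" using f by (rule integrable_norm)
    show "AE r in lborel. (\<lambda>n. ?h n r) \<longlonglongrightarrow> 0"
    proof (rule AE_I2)
      fix r
      obtain N :: nat where "norm (f r) \<le> real N" using real_arch_simple by blast
      then have "?h n r = 0" if "N \<le> n" for n using that by (simp add: min_def)
      then have "\<forall>\<^sub>F n in sequentially. ?h n r = 0" by (rule eventually_sequentiallyI)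
      then show "(\<lambda>n. ?h n r) \<longlonglongrightarrow> 0" by (rule tendsto_eventually)
    qed
  qed auto
  then have "\<forall>\<^sub>F n in sequentially. integral\<^sup>L lborel (?h n) < \<epsilon> / 2"
    using e by (intro order_tendstoD(2)) auto
  then obtain n where n: "integral\<^sup>L lborel (?h n) < \<epsilon> / 2" by (auto simp: eventually_sequentially)
  show ?thesis
  proof (rule that[of "\<epsilon> / (2 * (real n + 1))"])
    show "0 < \<epsilon> / (2 * (real n + 1))" using e by simp
    fix m :: nat and s t :: "nat \<Rightarrow> real"
    assume st: "\<And>i. i < m \<Longrightarrow> s i \<le> t i" "(\<Sum>i<m. t i - s i) < \<epsilon> / (2 * (real n + 1))"
      and dj: "\<And>i k. \<lbrakk>i < m; k < m; i \<noteq> k\<rbrakk> \<Longrightarrow> {s i<..<t i} \<inter> {s k<..<t k} = {}"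
    have one: "(\<Sum>i<m. indicator {s i<..<t i} r) \<le> (1::real)" for r
    proof -
      have "(\<Sum>i<m. indicator {s i<..<t i} r) = (indicator (\<Union>i<m. {s i<..<t i}) r :: real)"
        by (rule indicator_UN_disjoint[symmetric]) (use dj in \<open>auto simp: disjoint_family_on_def\<close>)
      then show ?thesis by (simp add: indicator_def)
    qed
    have ii: "integrable lborel (\<lambda>r. indicator {s i<..<t i} r * norm (f r))" for i
      using integrable_norm[OF f] by (rule Bochner_Integration.integrable_bound) (auto simp: indicator_def)
    have "emeasure lborel {s i<..<t i} < \<infinity>" for i by (rule emeasure_bounded_finite) simp
    then have ind: "integrable lborel (\<lambda>r. real n * indicator {s i<..<t i} r)" for i
      by (intro integrable_mult_right integrable_real_indicator) simp_all
    have i2: "integrable lborel (\<lambda>r. \<Sum>i<m. real n * indicator {s i<..<t i} r)"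
      by (rule Bochner_Integration.integrable_sum) (rule ind)
    have "(\<Sum>i<m. \<integral>r. indicator {s i<..<t i} r * norm (f r) \<partial>lborel) =
        (\<integral>r. (\<Sum>i<m. indicator {s i<..<t i} r * norm (f r)) \<partial>lborel)"
      by (rule Bochner_Integration.integral_sum[symmetric]) (rule ii)
    also have "\<dots> \<le> (\<integral>r. ?h n r + (\<Sum>i<m. real n * indicator {s i<..<t i} r) \<partial>lborel)"
    proof (rule integral_mono)
      show "integrable lborel (\<lambda>r. \<Sum>i<m. indicator {s i<..<t i} r * norm (f r))"
        by (rule Bochner_Integration.integrable_sum) (rule ii)
      show "integrable lborel (\<lambda>r. ?h n r + (\<Sum>i<m. real n * indicator {s i<..<t i} r))"
        using hint i2 by (rule Bochner_Integration.integrable_add)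
      fix r
      let ?S = "\<Sum>i<m. indicator {s i<..<t i} r :: real"
      have S0: "0 \<le> ?S" by (rule sum_nonneg) simp
      have "?S * norm (f r) = ?S * ?h n r + ?S * min (norm (f r)) n" by (simp add: algebra_simps)
      also have "?S * ?h n r \<le> 1 * ?h n r" by (rule mult_right_mono[OF one]) simp
      also have "?S * min (norm (f r)) n \<le> ?S * real n" by (rule mult_left_mono[OF _ S0]) simp
      finally show "(\<Sum>i<m. indicator {s i<..<t i} r * norm (f r)) \<le> ?h n r + (\<Sum>i<m. real n * indicator {s i<..<t i} r)"
        by (simp add: sum_distrib_left sum_distrib_right mult.commute)
    qed
    also have "\<dots> = integral\<^sup>L lborel (?h n) + (\<Sum>i<m. real n * (t i - s i))"
    proof -
      have "(\<integral>r. (\<Sum>i<m. real n * indicator {s i<..<t i} r) \<partial>lborel) = (\<Sum>i<m. \<integral>r. real n * indicator {s i<..<t i} r \<partial>lborel)"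
        by (rule Bochner_Integration.integral_sum) (rule ind)
      also have "\<dots> = (\<Sum>i<m. real n * (t i - s i))"
        by (rule sum.cong) (use st(1) in auto)
      finally show ?thesis using hint i2 by (subst Bochner_Integration.integral_add) auto
    qed
    also have "(\<Sum>i<m. real n * (t i - s i)) = real n * (\<Sum>i<m. t i - s i)" by (rule sum_distrib_left[symmetric])
    also have "\<dots> \<le> (real n + 1) * (\<Sum>i<m. t i - s i)"
      by (rule mult_right_mono) (use st(1) in \<open>auto intro!: sum_nonneg\<close>)
    also have "\<dots> < (real n + 1) * (\<epsilon> / (2 * (real n + 1)))" by (rule mult_strict_left_mono[OF st(2)]) simp
    also have "\<dots> = \<epsilon> / 2" by (simp add: field_simps)
    finally show "(\<Sum>i<m. \<integral>r. indicator {s i<..<t i} r * norm (f r) \<partial>lborel) < \<epsilon>" using n by linarith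
  qed
qed

lemma rl_left_1_increment:
  fixes f :: "real \<Rightarrow> 'a::euclidean_space"
  assumes f: "integrable lborel f" and st: "s \<le> t"
  shows "rl_left 1 f t - rl_left 1 f s = (\<integral>r. indicator {s<..<t} r *\<^sub>R f r \<partial>lborel)"
proof -
  have [measurable]: "f \<in> borel_measurable borel" using f by auto
  have "rl_left 1 f t - rl_left 1 f s = (\<integral>r. rl_kernel 1 (t - r) *\<^sub>R f r - rl_kernel 1 (s - r) *\<^sub>R f r \<partial>lborel)"
    unfolding rl_left_def by (rule Bochner_Integration.integral_diff[symmetric]) (rule integrable_rl_kernel_1[OF f])+
  also have "\<dots> = (\<integral>r. indicator {s<..<t} r *\<^sub>R f r \<partial>lborel)"
  proof (rule integral_cong_AE)
    show "AE r in lborel. rl_kernel 1 (t - r) *\<^sub>R f r - rl_kernel 1 (s - r) *\<^sub>R f r = indicator {s<..<t} r *\<^sub>R f r"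
      using AE_lborel_singleton[of s] by eventually_elim (use st in \<open>auto simp: rl_kernel_1 indicator_def\<close>)
  qed measurable
  finally show ?thesis .
qed

proposition rl_left_1_AC:
  fixes f :: "real \<Rightarrow> 'a::euclidean_space"
  assumes f: "integrable lborel f"
  shows "rl_left 1 f \<in> AC a b"
proof (rule AC_I)
  fix \<epsilon> :: real assume e: "0 < \<epsilon>"
  have [measurable]: "f \<in> borel_measurable borel" using f by auto
  obtain \<delta> where \<delta>: "0 < \<delta>"
    "\<And>(m::nat) s t. \<lbrakk>\<And>i. i < m \<Longrightarrow> s i \<le> t i; \<And>i k. \<lbrakk>i < m; k < m; i \<noteq> k\<rbrakk> \<Longrightarrow> {s i<..<t i} \<inter> {s k<..<t k} = {};
       (\<Sum>i<m. t i - s i) < \<delta>\<rbrakk> \<Longrightarrow> (\<Sum>i<m. \<integral>r. indicator {s i<..<t i} r * norm (f r) \<partial>lborel) < \<epsilon>"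
    by (rule integral_small_on_small_families[OF f e]) blast
  show "\<exists>\<delta>>0. \<forall>(m::nat) s t. (\<forall>i<m. a \<le> s i \<and> s i \<le> t i \<and> t i \<le> b) \<longrightarrow>
       (\<forall>i<m. \<forall>k<m. i \<noteq> k \<longrightarrow> {s i<..<t i} \<inter> {s k<..<t k} = {}) \<longrightarrow>
       (\<Sum>i<m. t i - s i) < \<delta> \<longrightarrow> (\<Sum>i<m. norm (rl_left 1 f (t i) - rl_left 1 f (s i))) < \<epsilon>"
  proof (intro exI[of _ \<delta>] conjI allI impI \<delta>(1))
    fix m :: nat and s t
    assume A: "\<forall>i<m. a \<le> s i \<and> s i \<le> t i \<and> t i \<le> b"
       "\<forall>i<m. \<forall>k<m. i \<noteq> k \<longrightarrow> {s i<..<t i} \<inter> {s k<..<t k} = {}" "(\<Sum>i<m. t i - s i) < \<delta>"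
    have "(\<Sum>i<m. norm (rl_left 1 f (t i) - rl_left 1 f (s i))) \<le> (\<Sum>i<m. \<integral>r. indicator {s i<..<t i} r * norm (f r) \<partial>lborel)"
    proof (rule sum_mono)
      fix i assume "i \<in> {..<m}"
      then have "rl_left 1 f (t i) - rl_left 1 f (s i) = (\<integral>r. indicator {s i<..<t i} r *\<^sub>R f r \<partial>lborel)"
        using A(1) by (intro rl_left_1_increment[OF f]) simp
      then have "norm (rl_left 1 f (t i) - rl_left 1 f (s i)) \<le> (\<integral>r. norm (indicator {s i<..<t i} r *\<^sub>R f r) \<partial>lborel)"
        using integral_norm_bound[of lborel "\<lambda>r. indicator {s i<..<t i} r *\<^sub>R f r"] by simp
      then show "norm (rl_left 1 f (t i) - rl_left 1 f (s i)) \<le> (\<integral>r. indicator {s i<..<t i} r * norm (f r) \<partial>lborel)" by simp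
    qed
    also have "\<dots> < \<epsilon>" by (rule \<delta>(2)) (use A in auto)
    finally show "(\<Sum>i<m. norm (rl_left 1 f (t i) - rl_left 1 f (s i))) < \<epsilon>" .
  qed
qed

proposition rl_left_1_has_vector_derivative_ae:
  fixes f :: "real \<Rightarrow> 'a::euclidean_space"
  assumes f: "integrable lborel f" and ab: "a < b"
  shows "negligible {t \<in> {a..b}. \<not> (rl_left 1 f has_vector_derivative f t) (at t within {a..b})}"
proof -
  have si: "set_integrable lborel {a..t} f" for t
    using f unfolding set_integrable_def by (intro integrable_mult_indicator) auto
  have eq: "rl_left 1 f t = rl_left 1 f a + integral {a..t} f" if "t \<in> {a..b}" for t
  proof -
    have [measurable]: "f \<in> borel_measurable borel" using f by auto
    have "rl_left 1 f t - rl_left 1 f a = (\<integral>r. indicator {a<..<t} r *\<^sub>R f r \<partial>lborel)"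
      by (rule rl_left_1_increment[OF f]) (use that in auto)
    also have "\<dots> = (\<integral>r. indicator {a..t} r *\<^sub>R f r \<partial>lborel)"
    proof (rule integral_cong_AE)
      show "AE r in lborel. indicator {a<..<t} r *\<^sub>R f r = indicator {a..t} r *\<^sub>R f r"
        using AE_lborel_singleton[of a] AE_lborel_singleton[of t] by eventually_elim (auto simp: indicator_def)
    qed measurable
    also have "\<dots> = integral {a..t} f"
      using set_borel_integral_eq_integral(2)[OF si[of t]] by (simp add: set_lebesgue_integral_def)
    finally show ?thesis by (simp add: algebra_simps)
  qed
  have neg: "negligible {t \<in> {a..b}. \<not> ((\<lambda>t. integral {a..t} f) has_vector_derivative f t) (at t within {a..b})}"
    by (rule indefinite_integral_has_vector_derivative_ae[OF set_borel_integral_eq_integral(1)[OF si] ab])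
  show ?thesis
  proof (rule negligible_subset[OF neg], safe)
    fix t assume t: "t \<in> {a..b}" and n: "\<not> (rl_left 1 f has_vector_derivative f t) (at t within {a..b})"
      and "((\<lambda>t. integral {a..t} f) has_vector_derivative f t) (at t within {a..b})"
    then have D: "((\<lambda>t. rl_left 1 f a + integral {a..t} f) has_vector_derivative f t) (at t within {a..b})"
      by (auto intro!: derivative_eq_intros)
    have "(rl_left 1 f has_vector_derivative f t) (at t within {a..b})"
    proof (rule has_vector_derivative_transform[OF t _ D])
      show "rl_left 1 f x = rl_left 1 f a + integral {a..x} f" if "x \<in> {a..b}" for x
        using that by (rule eq)
    qed
    with n show False by blast
  qed
qed

lemma rl_right_1_eq:
  fixes f :: "real \<Rightarrow> 'a::euclidean_space"
  assumes f: "integrable lborel f"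
  shows "rl_right 1 f t = integral\<^sup>L lborel f - rl_left 1 f t"
proof -
  have [measurable]: "f \<in> borel_measurable borel" using f by auto
  have "integral\<^sup>L lborel f = (\<integral>r. rl_kernel 1 (t - r) *\<^sub>R f r + rl_kernel 1 (r - t) *\<^sub>R f r \<partial>lborel)"
  proof (rule integral_cong_AE)
    show "AE r in lborel. f r = rl_kernel 1 (t - r) *\<^sub>R f r + rl_kernel 1 (r - t) *\<^sub>R f r"
      using AE_lborel_singleton[of t] by eventually_elim (auto simp: rl_kernel_1 indicator_def)
  qed measurable
  also have "\<dots> = rl_left 1 f t + rl_right 1 f t"
    unfolding rl_left_def rl_right_def by (rule Bochner_Integration.integral_add) (rule integrable_rl_kernel_1[OF f])+
  finally show ?thesis by simp
qed

section \<open>Second derivatives and a multiplier rule\<close>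

text \<open>
  By the mean value theorem in the direction \<open>k\<close>, the second difference is \<open>s\<close> times an increment of \<open>G\<close> along
  \<open>s *\<^sub>R h\<close>, paired with \<open>k\<close>; both gradients are expanded at \<open>u\<close>.
\<close>

lemma second_difference_estimate:
  fixes f :: "'a::euclidean_space \<Rightarrow> real"
  assumes f: "\<And>z. (f has_derivative (\<lambda>h. G z \<bullet> h)) (at z)"
    and G: "(G has_derivative H) (at u)" and e: "0 < e"
  shows "\<exists>d>0. \<forall>s. 0 < s \<and> s < d \<longrightarrow>
    \<bar>f (u + s *\<^sub>R h + s *\<^sub>R k) - f (u + s *\<^sub>R h) - f (u + s *\<^sub>R k) + f u - s\<^sup>2 * (H h \<bullet> k)\<bar> \<le> e * s\<^sup>2"
proof -
  \<comment> \<open>all increments used below have norm at most \<open>s * m\<close>\<close>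
  define m where "m = norm h + norm k + 1"
  have m: "0 < m" by (simp add: m_def add_nonneg_pos)
  define \<eta> where "\<eta> = e / (2 * m * m)"
  have \<eta>: "0 < \<eta>" using e m by (simp add: \<eta>_def)
  interpret H: bounded_linear H using G by (rule has_derivative_bounded_linear)
  obtain d where d: "0 < d" and rem: "\<And>y. norm (y - u) < d \<Longrightarrow> norm (G y - G u - H (y - u)) \<le> \<eta> * norm (y - u)"
    using G \<eta> unfolding has_derivative_at_alt by blast
  define r where "r z = G (u + z) - G u - H z" for z
  have r: "norm (r z) \<le> \<eta> * norm z" if "norm z < d" for z using rem[of "u + z"] that by (simp add: r_def)
  show ?thesis
  proof (intro exI[of _ "d / m"] conjI allI impI)
    show "0 < d / m" using d m by simp
    fix s assume s: "0 < s \<and> s < d / m"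
    then have sm: "s * m < d" using m by (simp add: field_simps)
    define \<psi> where "\<psi> \<tau> = f (u + s *\<^sub>R h + \<tau> *\<^sub>R k) - f (u + \<tau> *\<^sub>R k)" for \<tau>
    define \<psi>' where "\<psi>' \<tau> = (G (u + s *\<^sub>R h + \<tau> *\<^sub>R k) - G (u + \<tau> *\<^sub>R k)) \<bullet> k" for \<tau>
    have der: "(\<psi> has_real_derivative \<psi>' \<tau>) (at \<tau>)" for \<tau>
    proof -
      have 1: "((\<lambda>\<tau>. f (c + \<tau> *\<^sub>R k)) has_real_derivative (G (c + \<tau> *\<^sub>R k) \<bullet> k)) (at \<tau>)" for c
      proof -
        have "((\<lambda>\<tau>. c + \<tau> *\<^sub>R k) has_derivative (\<lambda>x. x *\<^sub>R k)) (at \<tau>)" by (auto intro!: derivative_eq_intros)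
        from has_derivative_compose[OF this f]
        show ?thesis by (simp add: has_field_derivative_def mult_commute_abs)
      qed
      show ?thesis unfolding \<psi>_def \<psi>'_def inner_diff_left by (intro DERIV_diff 1)
    qed
    obtain \<xi> where \<xi>: "0 < \<xi>" "\<xi> < s" "\<psi> s - \<psi> 0 = (s - 0) * \<psi>' \<xi>"
      using MVT2[of 0 s \<psi> \<psi>'] s der by auto
    have n1: "norm (s *\<^sub>R h + \<xi> *\<^sub>R k) \<le> s * m" "norm (\<xi> *\<^sub>R k) \<le> s * m"
    proof -
      have "norm (s *\<^sub>R h + \<xi> *\<^sub>R k) \<le> s * norm h + \<xi> * norm k"
        using s \<xi> by (intro order_trans[OF norm_triangle_ineq]) auto
      also have "\<xi> * norm k \<le> s * norm k" using \<xi> by (intro mult_right_mono) auto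
      finally show "norm (s *\<^sub>R h + \<xi> *\<^sub>R k) \<le> s * m" using s by (simp add: m_def algebra_simps)
      have "\<xi> * norm k \<le> s * m" using \<xi> s by (intro mult_mono) (auto simp: m_def)
      then show "norm (\<xi> *\<^sub>R k) \<le> s * m" using \<xi> by simp
    qed
    have r1: "norm (r (s *\<^sub>R h + \<xi> *\<^sub>R k)) \<le> \<eta> * (s * m)" "norm (r (\<xi> *\<^sub>R k)) \<le> \<eta> * (s * m)"
    proof -
      have "norm (r (s *\<^sub>R h + \<xi> *\<^sub>R k)) \<le> \<eta> * norm (s *\<^sub>R h + \<xi> *\<^sub>R k)" by (rule r) (use n1 sm in linarith)
      also have "\<dots> \<le> \<eta> * (s * m)" using n1 \<eta> by (intro mult_left_mono) auto
      finally show "norm (r (s *\<^sub>R h + \<xi> *\<^sub>R k)) \<le> \<eta> * (s * m)" .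
      have "norm (r (\<xi> *\<^sub>R k)) \<le> \<eta> * norm (\<xi> *\<^sub>R k)" by (rule r) (use n1 sm in linarith)
      also have "\<dots> \<le> \<eta> * (s * m)" using n1 \<eta> by (intro mult_left_mono) auto
      finally show "norm (r (\<xi> *\<^sub>R k)) \<le> \<eta> * (s * m)" .
    qed
    have "\<psi>' \<xi> - s * (H h \<bullet> k) = (r (s *\<^sub>R h + \<xi> *\<^sub>R k) - r (\<xi> *\<^sub>R k)) \<bullet> k"
      by (simp add: \<psi>'_def r_def H.add H.scaleR inner_diff_left inner_add_left algebra_simps)
    then have "\<bar>\<psi>' \<xi> - s * (H h \<bullet> k)\<bar> \<le> norm (r (s *\<^sub>R h + \<xi> *\<^sub>R k) - r (\<xi> *\<^sub>R k)) * norm k"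
      by (simp add: Cauchy_Schwarz_ineq2)
    also have "\<dots> \<le> (2 * (\<eta> * (s * m))) * m"
      using r1 \<eta> m s norm_triangle_ineq4[of "r (s *\<^sub>R h + \<xi> *\<^sub>R k)" "r (\<xi> *\<^sub>R k)"]
      by (intro mult_mono) (auto simp: m_def)
    also have "\<dots> = e * s" using m by (simp add: \<eta>_def field_simps)
    finally have b: "\<bar>\<psi>' \<xi> - s * (H h \<bullet> k)\<bar> \<le> e * s" .
    have "f (u + s *\<^sub>R h + s *\<^sub>R k) - f (u + s *\<^sub>R h) - f (u + s *\<^sub>R k) + f u - s\<^sup>2 * (H h \<bullet> k) =
        s * (\<psi>' \<xi> - s * (H h \<bullet> k))"
      using \<xi>(3) by (simp add: \<psi>_def power2_eq_square algebra_simps)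
    then have "\<bar>f (u + s *\<^sub>R h + s *\<^sub>R k) - f (u + s *\<^sub>R h) - f (u + s *\<^sub>R k) + f u - s\<^sup>2 * (H h \<bullet> k)\<bar> =
        s * \<bar>\<psi>' \<xi> - s * (H h \<bullet> k)\<bar>" using s by (simp add: abs_mult)
    also have "\<dots> \<le> s * (e * s)" using b s by (intro mult_left_mono) auto
    finally show "\<bar>f (u + s *\<^sub>R h + s *\<^sub>R k) - f (u + s *\<^sub>R h) - f (u + s *\<^sub>R k) + f u - s\<^sup>2 * (H h \<bullet> k)\<bar> \<le> e * s\<^sup>2"
      by (simp add: power2_eq_square mult.commute mult.left_commute)
  qed
qed

text \<open>
  Schwarz's theorem: the second difference is symmetric in \<open>h\<close> and \<open>k\<close>, hence so is its limit.
\<close>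

theorem second_derivative_symmetric:
  fixes f :: "'a::euclidean_space \<Rightarrow> real"
  assumes f: "\<And>z. (f has_derivative (\<lambda>h. G z \<bullet> h)) (at z)"
    and G: "(G has_derivative H) (at u)"
  shows "H h \<bullet> k = H k \<bullet> h"
proof -
  have "\<bar>H h \<bullet> k - H k \<bullet> h\<bar> \<le> 2 * e" if e: "0 < e" for e
  proof -
    obtain d1 where d1: "0 < d1" "\<And>s. 0 < s \<Longrightarrow> s < d1 \<Longrightarrow>
      \<bar>f (u + s *\<^sub>R h + s *\<^sub>R k) - f (u + s *\<^sub>R h) - f (u + s *\<^sub>R k) + f u - s\<^sup>2 * (H h \<bullet> k)\<bar> \<le> e * s\<^sup>2"
      using second_difference_estimate[OF f G e, of h k] by auto
    obtain d2 where d2: "0 < d2" "\<And>s. 0 < s \<Longrightarrow> s < d2 \<Longrightarrow>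
      \<bar>f (u + s *\<^sub>R k + s *\<^sub>R h) - f (u + s *\<^sub>R k) - f (u + s *\<^sub>R h) + f u - s\<^sup>2 * (H k \<bullet> h)\<bar> \<le> e * s\<^sup>2"
      using second_difference_estimate[OF f G e, of k h] by auto
    define s where "s = min d1 d2 / 2"
    have s: "0 < s" "s < d1" "s < d2" using d1 d2 by (auto simp: s_def min_def)
    have c: "u + s *\<^sub>R k + s *\<^sub>R h = u + s *\<^sub>R h + s *\<^sub>R k" by simp
    have "\<bar>s\<^sup>2 * (H h \<bullet> k) - s\<^sup>2 * (H k \<bullet> h)\<bar> \<le> e * s\<^sup>2 + e * s\<^sup>2"
      using d1(2)[OF s(1,2)] d2(2)[OF s(1,3)] unfolding c by linarith
    moreover have "\<bar>s\<^sup>2 * (H h \<bullet> k) - s\<^sup>2 * (H k \<bullet> h)\<bar> = s\<^sup>2 * \<bar>H h \<bullet> k - H k \<bullet> h\<bar>"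
      by (simp only: abs_mult right_diff_distrib[symmetric] abs_power2)
    ultimately have "s\<^sup>2 * \<bar>H h \<bullet> k - H k \<bullet> h\<bar> \<le> s\<^sup>2 * (2 * e)" by (simp add: mult.left_commute mult.commute)
    then show ?thesis using s(1) by (simp only: mult_le_cancel_left_pos zero_less_power)
  qed
  then have "\<bar>H h \<bullet> k - H k \<bullet> h\<bar> \<le> 0 + e" if "0 < e" for e using that[THEN half_gt_zero] by (metis add.left_neutral field_sum_of_halves mult_2)
  then have "\<bar>H h \<bullet> k - H k \<bullet> h\<bar> \<le> 0" by (rule field_le_epsilon)
  then show ?thesis by simp
qed

text \<open>
  The mean value theorem turns the excess into \<open>r\<close> times \<open>(G (u + \<xi> *\<^sub>R z) - G u) \<bullet> z\<close>, which equals \<open>\<xi> * (H z \<bullet> z)\<close>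
  up to an error that is small compared with \<open>\<xi>\<close>.
\<close>

lemma excess_negative_if_hessian_negative:
  fixes f :: "'a::euclidean_space \<Rightarrow> real"
  assumes f: "\<And>z. (f has_derivative (\<lambda>h. G z \<bullet> h)) (at z)"
    and G: "(G has_derivative H) (at u)" and neg: "H z \<bullet> z < 0"
  shows "\<exists>d>0. \<forall>r. 0 < r \<and> r < d \<longrightarrow> f (u + r *\<^sub>R z) - f u - G u \<bullet> (r *\<^sub>R z) < 0"
proof -
  interpret H: bounded_linear H using G by (rule has_derivative_bounded_linear)
  have z: "z \<noteq> 0" using neg by auto
  define \<eta> where "\<eta> = - (H z \<bullet> z) / (2 * norm z * norm z)"
  have \<eta>: "0 < \<eta>" using neg z unfolding \<eta>_def by (intro divide_pos_pos mult_pos_pos) auto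
  obtain d where d: "0 < d" and rem: "\<And>y. norm (y - u) < d \<Longrightarrow> norm (G y - G u - H (y - u)) \<le> \<eta> * norm (y - u)"
    using G \<eta> unfolding has_derivative_at_alt by blast
  show ?thesis
  proof (intro exI[of _ "d / norm z"] conjI allI impI)
    show "0 < d / norm z" using d z by simp
    fix r assume r: "0 < r \<and> r < d / norm z"
    define \<psi> where "\<psi> \<tau> = f (u + \<tau> *\<^sub>R z) - \<tau> * (G u \<bullet> z)" for \<tau>
    define \<psi>' where "\<psi>' \<tau> = G (u + \<tau> *\<^sub>R z) \<bullet> z - G u \<bullet> z" for \<tau>
    have der: "(\<psi> has_real_derivative \<psi>' \<tau>) (at \<tau>)" for \<tau>
    proof -
      have "((\<lambda>\<tau>. u + \<tau> *\<^sub>R z) has_derivative (\<lambda>x. x *\<^sub>R z)) (at \<tau>)" by (auto intro!: derivative_eq_intros)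
      from has_derivative_compose[OF this f]
      have 1: "((\<lambda>\<tau>. f (u + \<tau> *\<^sub>R z)) has_real_derivative (G (u + \<tau> *\<^sub>R z) \<bullet> z)) (at \<tau>)"
        by (simp add: has_field_derivative_def mult_commute_abs)
      show ?thesis unfolding \<psi>_def \<psi>'_def
        by (rule DERIV_diff[OF 1]) (auto intro!: derivative_eq_intros)
    qed
    obtain \<xi> where \<xi>: "0 < \<xi>" "\<xi> < r" "\<psi> r - \<psi> 0 = (r - 0) * \<psi>' \<xi>"
      using MVT2[of 0 r \<psi> \<psi>'] r der by auto
    have "\<xi> * norm z < d" using \<xi> r z by (smt (verit) divide_less_eq mult.commute mult_strict_right_mono zero_less_norm_iff pos_less_divide_eq)
    then have "norm (G (u + \<xi> *\<^sub>R z) - G u - H (\<xi> *\<^sub>R z)) \<le> \<eta> * (\<xi> * norm z)"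
      using rem[of "u + \<xi> *\<^sub>R z"] \<xi> by simp
    then have "norm (G (u + \<xi> *\<^sub>R z) - G u - H (\<xi> *\<^sub>R z)) * norm z \<le> \<eta> * (\<xi> * norm z) * norm z"
      by (rule mult_right_mono) simp
    moreover have "(G (u + \<xi> *\<^sub>R z) - G u - H (\<xi> *\<^sub>R z)) \<bullet> z \<le> norm (G (u + \<xi> *\<^sub>R z) - G u - H (\<xi> *\<^sub>R z)) * norm z"
      by (rule norm_cauchy_schwarz)
    moreover have "\<eta> * (\<xi> * norm z) * norm z = - \<xi> * (H z \<bullet> z) / 2" using z by (simp add: \<eta>_def)
    ultimately have "\<psi>' \<xi> \<le> \<xi> * (H z \<bullet> z) - \<xi> * (H z \<bullet> z) / 2"
      by (simp add: \<psi>'_def inner_diff_left H.scaleR)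
    also have "\<dots> < 0" using \<xi>(1) neg by (simp add: mult_less_0_iff)
    finally have "r * \<psi>' \<xi> < 0" using r by (simp add: mult_less_0_iff)
    then show "f (u + r *\<^sub>R z) - f u - G u \<bullet> (r *\<^sub>R z) < 0" using \<xi>(3) by (simp add: \<psi>_def)
  qed
qed

text \<open>
  The quadratic form takes the same value at \<open>z\<close> and \<open>-z\<close>. If it were negative, both excesses would be negative for
  short multiples of \<open>z\<close>.
\<close>

lemma hessian_nonneg_from_two_sided_excess:
  fixes f :: "'a::euclidean_space \<Rightarrow> real"
  assumes f: "\<And>z. (f has_derivative (\<lambda>h. G z \<bullet> h)) (at z)"
    and G: "(G has_derivative H) (at u)"
    and exc: "\<And>z. 0 \<le> f (u + z) - f u - G u \<bullet> z \<or> 0 \<le> f (u - z) - f u + G u \<bullet> z"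
  shows "0 \<le> H z \<bullet> z"
proof (rule ccontr)
  assume n: "\<not> 0 \<le> H z \<bullet> z"
  interpret H: bounded_linear H using G by (rule has_derivative_bounded_linear)
  have n1: "H z \<bullet> z < 0" and n2: "H (- z) \<bullet> (- z) < 0" using n by (auto simp: H.neg)
  obtain d1 where d1: "0 < d1" "\<And>r. 0 < r \<Longrightarrow> r < d1 \<Longrightarrow> f (u + r *\<^sub>R z) - f u - G u \<bullet> (r *\<^sub>R z) < 0"
    using excess_negative_if_hessian_negative[OF f G n1] by auto
  obtain d2 where d2: "0 < d2" "\<And>r. 0 < r \<Longrightarrow> r < d2 \<Longrightarrow> f (u + r *\<^sub>R (- z)) - f u - G u \<bullet> (r *\<^sub>R (- z)) < 0"
    using excess_negative_if_hessian_negative[OF f G n2] by auto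
  define r where "r = min d1 d2 / 2"
  have r: "0 < r" "r < d1" "r < d2" using d1 d2 by (auto simp: r_def min_def)
  show False using exc[of "r *\<^sub>R z"] d1(2)[OF r(1,2)] d2(2)[OF r(1,3)] by simp
qed

text \<open>
  The map \<open>M\<close> corrects \<open>P\<close> along a right inverse of the derivative \<open>A\<close> of \<open>G\<close> at \<open>P0\<close>, in such a way that
  \<open>A (M P - P0) = G P - G P0\<close>. Its derivative at \<open>P0\<close> is the identity, so the inverse function theorem lifts
  the line through \<open>P0\<close> with direction \<open>D0\<close> to a curve with the same tangent, along which \<open>G\<close> runs through the
  segment from \<open>G P0\<close> to \<open>G P0 + A D0\<close>. Convexity keeps this segment in \<open>S\<close>.
\<close>

lemma curve_through_constraint:
  fixes G :: "'p::euclidean_space \<Rightarrow> 'q::euclidean_space"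
  assumes G: "\<And>P. (G has_derivative blinfun_apply (G' P)) (at P)" and G'c: "continuous_on UNIV G'"
    and surj: "surj (blinfun_apply (G' P0))"
    and S: "convex S" "G P0 \<in> S" and z: "G P0 + G' P0 D0 \<in> S"
  obtains \<epsilon> :: "nat \<Rightarrow> real" and P :: "nat \<Rightarrow> 'p" where
    "\<epsilon> \<longlonglongrightarrow> 0" "\<And>k. 0 < \<epsilon> k" "P \<longlonglongrightarrow> D0" "\<And>k. G (P0 + \<epsilon> k *\<^sub>R P k) \<in> S"
proof -
  define A where "A = G' P0"
  have "linear (blinfun_apply A)" by (simp add: blinfun.bounded_linear_right bounded_linear.linear)
  then obtain R where R: "linear R" "blinfun_apply A \<circ> R = id"
    using linear_surjective_right_inverse[of "blinfun_apply A"] surj unfolding A_def by blast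
  have AR: "A (R y) = y" for y using R(2) by (metis comp_apply id_apply)
  have Rb: "bounded_linear R" using R(1) by (simp add: linear_conv_bounded_linear)
  define B where "B = Blinfun R"
  have B: "blinfun_apply B = R" unfolding B_def by (rule bounded_linear_Blinfun_apply[OF Rb])
  define M where "M P = P + B (G P - G P0 - A (P - P0))" for P
  define M' where "M' P = id_blinfun + (B o\<^sub>L (G' P - A))" for P
  have dM: "(M has_derivative blinfun_apply (M' P)) (at P)" for P
    unfolding M_def M'_def
    by (rule has_derivative_eq_rhs)
       (auto intro!: derivative_eq_intros G simp: fun_eq_iff blinfun.bilinear_simps)
  have cM: "continuous_on UNIV M'" unfolding M'_def by (intro continuous_intros G'c)
  have M'0: "M' P0 = id_blinfun" by (simp add: M'_def A_def)
  have M0: "M P0 = P0" by (simp add: M_def blinfun.bilinear_simps)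
  obtain U V g g' where inv: "open U" "P0 \<in> U" "open V" "M P0 \<in> V" "homeomorphism U V M g"
    "\<And>y. y \<in> V \<Longrightarrow> (g has_derivative (g' y)) (at y)"
    "\<And>y. y \<in> V \<Longrightarrow> g' y = inv (blinfun_apply (M' (g y)))"
  proof (rule inverse_function_theorem[of UNIV M M' P0 id_blinfun])
    show "id_blinfun o\<^sub>L M' P0 = id_blinfun" by (simp add: M'0 blinfun_eqI)
  qed (use dM cM in auto)
  have gP0: "g P0 = P0" using inv(2,5) M0 by (metis homeomorphism_apply1)
  have "blinfun_apply id_blinfun = (id :: 'p \<Rightarrow> 'p)" by auto
  then have "g' P0 = id" using inv(4,7) M0 gP0 M'0 by (metis inv_id)
  then have dg: "(g has_derivative id) (at P0)" using inv(6)[of P0] inv(4) M0 by simp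
  have MG: "G P = G P0 + A (M P - P0)" for P
    by (simp add: M_def B blinfun.bilinear_simps AR)
  define e where "e k = inverse (real (Suc k))" for k
  have e0: "e \<longlonglongrightarrow> 0" unfolding e_def by (rule LIMSEQ_inverse_real_of_nat)
  have epos: "0 < e k" "e k \<le> 1" for k by (auto simp: e_def field_simps)
  have "(\<lambda>k. P0 + e k *\<^sub>R D0) \<longlonglongrightarrow> P0 + 0 *\<^sub>R D0" by (intro tendsto_intros e0)
  then have "\<forall>\<^sub>F k in sequentially. P0 + e k *\<^sub>R D0 \<in> V"
    using inv(3,4) M0 by (intro topological_tendstoD) auto
  then obtain N where N: "\<And>k. N \<le> k \<Longrightarrow> P0 + e k *\<^sub>R D0 \<in> V" by (auto simp: eventually_sequentially)
  define Q where "Q k = (1 / e (k + N)) *\<^sub>R (g (P0 + e (k + N) *\<^sub>R D0) - P0)" for k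
  have QN: "P0 + e (k + N) *\<^sub>R Q k = g (P0 + e (k + N) *\<^sub>R D0)" for k
    using epos[of "k+N"] by (simp add: Q_def)
  show ?thesis
  proof (rule that[of "\<lambda>k. e (k + N)" Q])
    show eN: "(\<lambda>k. e (k + N)) \<longlonglongrightarrow> 0" by (rule LIMSEQ_ignore_initial_segment[OF e0])
    show "0 < e (k + N)" for k by (rule epos)
    show "Q \<longlonglongrightarrow> D0"
    proof -
      have "((\<lambda>t. P0 + t *\<^sub>R D0) has_derivative (\<lambda>t. t *\<^sub>R D0)) (at 0)" by (auto intro!: derivative_eq_intros)
      from has_derivative_compose[OF this, of g id] dg
      have "((\<lambda>t. g (P0 + t *\<^sub>R D0)) has_derivative (\<lambda>t. t *\<^sub>R D0)) (at 0)" by simp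
      then have "(\<lambda>t. (1 / norm t) *\<^sub>R (g (P0 + t *\<^sub>R D0) - (P0 + t *\<^sub>R D0))) \<midarrow>0\<rightarrow> 0"
        by (simp add: has_derivative_at2 gP0)
      moreover have "filterlim (\<lambda>k. e (k + N)) (at 0) sequentially"
        unfolding filterlim_at using eN epos by (auto simp: less_imp_neq[symmetric])
      ultimately have "(\<lambda>k. (1 / norm (e (k + N))) *\<^sub>R (g (P0 + e (k + N) *\<^sub>R D0) - (P0 + e (k + N) *\<^sub>R D0))) \<longlonglongrightarrow> 0"
        by (rule filterlim_compose)
      moreover have "(1 / norm (e (k + N))) *\<^sub>R (g (P0 + e (k + N) *\<^sub>R D0) - (P0 + e (k + N) *\<^sub>R D0)) = Q k - D0" for k
      proof -
        have "norm (e (k + N)) = e (k + N)" "e (k + N) \<noteq> 0" using epos[of "k + N"] by auto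
        then show ?thesis by (simp add: Q_def diff_diff_eq[symmetric] scaleR_diff_right)
      qed
      ultimately show ?thesis by (simp add: LIM_zero_iff)
    qed
    show "G (P0 + e (k + N) *\<^sub>R Q k) \<in> S" for k
    proof -
      have "M (g (P0 + e (k + N) *\<^sub>R D0)) = P0 + e (k + N) *\<^sub>R D0"
        using inv(5) N[of "k + N"] by (metis homeomorphism_apply2 le_add2)
      then have "G (P0 + e (k + N) *\<^sub>R Q k) = G P0 + e (k + N) *\<^sub>R A D0"
        unfolding QN by (subst MG) (simp add: blinfun.bilinear_simps)
      also have "\<dots> = (1 - e (k + N)) *\<^sub>R G P0 + e (k + N) *\<^sub>R (G P0 + A D0)"
        by (simp add: algebra_simps)
      also have "\<dots> \<in> S" using S z epos[of "k+N"] unfolding A_def by (intro convexD) auto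
      finally show ?thesis .
    qed
  qed
qed

text \<open>
  A direction in the kernel of \<open>G' P0\<close> is admissible together with its negative, so \<open>c\<close> vanishes there and factors through
  \<open>G' P0\<close>; the factor is \<open>\<psi>\<close>. The directions that lead from \<open>G P0\<close> to other points of \<open>S\<close> give the sign of \<open>\<psi>\<close>.
\<close>

proposition multiplier_rule:
  fixes G :: "'p::euclidean_space \<Rightarrow> 'q::euclidean_space"
  assumes G: "\<And>P. (G has_derivative blinfun_apply (G' P)) (at P)" and G'c: "continuous_on UNIV G'"
    and surj: "surj (blinfun_apply (G' P0))"
    and S: "convex S" "G P0 \<in> S"
    and opt: "\<And>\<epsilon> P D. \<lbrakk>\<epsilon> \<longlonglongrightarrow> 0; \<And>k::nat. 0 < (\<epsilon> k :: real); P \<longlonglongrightarrow> D; \<And>k. G (P0 + \<epsilon> k *\<^sub>R P k) \<in> S\<rbrakk>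
        \<Longrightarrow> 0 \<le> c \<bullet> D"
  obtains \<psi> where "- \<psi> \<in> normal_cone S (G P0)" "\<And>D. c \<bullet> D = \<psi> \<bullet> G' P0 D"
proof -
  define A where "A = blinfun_apply (G' P0)"
  have lA: "linear A" unfolding A_def by (simp add: blinfun.bounded_linear_right bounded_linear.linear)
  then obtain R where R: "linear R" "A \<circ> R = id"
    using linear_surjective_right_inverse[of A] surj unfolding A_def by blast
  have AR: "A (R y) = y" for y using R(2) by (metis comp_apply id_apply)
  have nn: "0 \<le> c \<bullet> D" if D: "G P0 + A D \<in> S" for D
  proof -
    obtain \<epsilon> P where "\<epsilon> \<longlonglongrightarrow> 0" "\<And>k::nat. 0 < (\<epsilon> k :: real)" "P \<longlonglongrightarrow> D" "\<And>k. G (P0 + \<epsilon> k *\<^sub>R P k) \<in> S"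
      using curve_through_constraint[OF G G'c surj S D[unfolded A_def]] by blast
    then show ?thesis by (rule opt)
  qed
  have ker: "c \<bullet> D = 0" if "A D = 0" for D
  proof -
    have "A (- D) = 0" using that linear_neg[OF lA] by simp
    then show ?thesis using nn[of D] nn[of "- D"] that S(2) by simp
  qed
  define \<psi> where "\<psi> = adjoint R c"
  have \<psi>: "\<psi> \<bullet> y = c \<bullet> R y" for y unfolding \<psi>_def using adjoint_works[OF R(1), of y c] by (simp add: inner_commute)
  show ?thesis
  proof (rule that[of \<psi>])
    show "- \<psi> \<in> normal_cone S (G P0)"
      unfolding normal_cone_def
    proof (clarify)
      fix z assume "z \<in> S"
      then have "0 \<le> c \<bullet> R (z - G P0)" by (intro nn) (simp add: AR)
      then show "- \<psi> \<bullet> (z - G P0) \<le> 0" by (simp add: \<psi>)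
    qed
    show "c \<bullet> D = \<psi> \<bullet> G' P0 D" for D
    proof -
      have "A (D - R (A D)) = 0" using linear_diff[OF lA] AR by simp
      then have "c \<bullet> (D - R (A D)) = 0" by (rule ker)
      then show ?thesis by (simp add: \<psi> A_def inner_diff_right)
    qed
  qed
qed

section \<open>First variation of the weighted cost\<close>

text \<open>
  The curve of end points has only an approximate tangent, which is why the direction varies with \<open>k\<close>.
\<close>

lemma has_derivative_sequence:
  fixes f :: "'a::real_normed_vector \<Rightarrow> 'b::real_normed_vector"
  assumes f: "(f has_derivative f') (at p)" and e: "\<epsilon> \<longlonglongrightarrow> (0::real)" "\<And>k. 0 < \<epsilon> k" and q: "q \<longlonglongrightarrow> d"
  shows "(\<lambda>k. (1 / \<epsilon> k) *\<^sub>R (f (p + \<epsilon> k *\<^sub>R q k) - f p)) \<longlonglongrightarrow> f' d"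
proof -
  interpret f': bounded_linear f' using f by (rule has_derivative_bounded_linear)
  obtain C where C: "0 < C" "\<And>k. norm (q k) \<le> C"
    using convergent_imp_Bseq[of q] q by (auto simp: convergent_def Bseq_def)
  have "(\<lambda>k. (1 / \<epsilon> k) *\<^sub>R (f (p + \<epsilon> k *\<^sub>R q k) - f p) - f' (q k)) \<longlonglongrightarrow> 0"
  proof (rule tendstoI)
    fix \<eta> :: real assume \<eta>: "0 < \<eta>"
    then have "0 < \<eta> / (2 * C)" using C by simp
    then obtain \<delta> where \<delta>: "0 < \<delta>"
      "\<And>y. norm (y - p) < \<delta> \<Longrightarrow> norm (f y - f p - f' (y - p)) \<le> \<eta> / (2 * C) * norm (y - p)"
      using f unfolding has_derivative_at_alt by blast
    have "\<forall>\<^sub>F k in sequentially. \<epsilon> k < \<delta> / C" by (rule order_tendstoD(2)[OF e(1)]) (use \<delta> C in simp)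
    then show "\<forall>\<^sub>F k in sequentially. dist ((1 / \<epsilon> k) *\<^sub>R (f (p + \<epsilon> k *\<^sub>R q k) - f p) - f' (q k)) 0 < \<eta>"
    proof eventually_elim
      case (elim k)
      have "norm (\<epsilon> k *\<^sub>R q k) \<le> \<epsilon> k * C" using C(2)[of k] e(2)[of k] by (simp add: mult_left_mono)
      also have "\<epsilon> k * C < \<delta>" using elim C(1) by (simp add: field_simps)
      finally have "norm (\<epsilon> k *\<^sub>R q k) < \<delta>" .
      then have "norm (f (p + \<epsilon> k *\<^sub>R q k) - f p - f' (\<epsilon> k *\<^sub>R q k)) \<le> \<eta> / (2 * C) * norm (\<epsilon> k *\<^sub>R q k)"
        using \<delta>(2)[of "p + \<epsilon> k *\<^sub>R q k"] by simp
      also have "\<dots> \<le> \<eta> / (2 * C) * (\<epsilon> k * C)"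
        using \<open>norm (\<epsilon> k *\<^sub>R q k) \<le> \<epsilon> k * C\<close> \<eta> C by (intro mult_left_mono) auto
      also have "\<dots> = \<epsilon> k * (\<eta> / 2)" using C(1) by simp
      finally have b: "norm (f (p + \<epsilon> k *\<^sub>R q k) - f p - f' (\<epsilon> k *\<^sub>R q k)) \<le> \<epsilon> k * (\<eta> / 2)" .
      have "(1 / \<epsilon> k) *\<^sub>R (f (p + \<epsilon> k *\<^sub>R q k) - f p) - f' (q k) =
          (1 / \<epsilon> k) *\<^sub>R (f (p + \<epsilon> k *\<^sub>R q k) - f p - f' (\<epsilon> k *\<^sub>R q k))"
        using e(2)[of k] by (simp add: f'.scaleR scaleR_diff_right)
      then have "norm ((1 / \<epsilon> k) *\<^sub>R (f (p + \<epsilon> k *\<^sub>R q k) - f p) - f' (q k)) \<le> (1 / \<epsilon> k) * (\<epsilon> k * (\<eta> / 2))"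
        using mult_left_mono[OF b, of "1 / \<epsilon> k"] e(2)[of k] by simp
      also have "\<dots> = \<eta> / 2" using e(2)[of k] by simp
      also have "\<dots> < \<eta>" using \<eta> by simp
      finally show ?case by simp
    qed
  qed
  moreover have "(\<lambda>k. f' (q k)) \<longlonglongrightarrow> f' d" by (rule f'.tendsto[OF q])
  ultimately have "(\<lambda>k. ((1 / \<epsilon> k) *\<^sub>R (f (p + \<epsilon> k *\<^sub>R q k) - f p) - f' (q k)) + f' (q k)) \<longlonglongrightarrow> 0 + f' d"
    by (rule tendsto_add)
  then show ?thesis by simp
qed

text \<open>
  Choose \<open>\<mu>\<close> such that \<open>n = m - \<kappa> *\<^sub>R \<mu>\<close> has integral zero. The test function \<open>sgn n\<close> satisfies the constraint after
  subtraction of a constant \<open>c\<close>, and the constant does not see \<open>n\<close>. Hence the integral of \<open>norm (n t)\<close> is zero.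
\<close>

lemma du_Bois_Reymond:
  fixes m :: "real \<Rightarrow> 'a::euclidean_space" and \<kappa> :: "real \<Rightarrow> real"
  assumes m: "integrable lborel m" "\<And>t. t \<notin> {a..b} \<Longrightarrow> m t = 0"
    and \<kappa>: "integrable lborel \<kappa>" "\<And>t. t \<notin> {a..b} \<Longrightarrow> \<kappa> t = 0" "integral\<^sup>L lborel \<kappa> \<noteq> 0"
    and orth: "\<And>v. bounded_control a b v \<Longrightarrow> (\<integral>t. \<kappa> t *\<^sub>R v t \<partial>lborel) = 0 \<Longrightarrow> (\<integral>t. m t \<bullet> v t \<partial>lborel) = 0"
  obtains \<mu> where "AE t in lborel. m t = \<kappa> t *\<^sub>R \<mu>"
proof -
  define \<kappa>0 where "\<kappa>0 = integral\<^sup>L lborel \<kappa>"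
  define \<mu> where "\<mu> = (1 / \<kappa>0) *\<^sub>R integral\<^sup>L lborel m"
  define n where "n t = m t - \<kappa> t *\<^sub>R \<mu>" for t
  define v0 where "v0 t = sgn (n t)" for t
  define c where "c = (1 / \<kappa>0) *\<^sub>R (\<integral>t. \<kappa> t *\<^sub>R v0 t \<partial>lborel)"
  define v where "v t = v0 t - indicator {a..b} t *\<^sub>R c" for t
  have [measurable]: "m \<in> borel_measurable borel" "\<kappa> \<in> borel_measurable borel" using m \<kappa> by auto
  have nm [measurable]: "n \<in> borel_measurable borel" unfolding n_def by measurable
  have v0m [measurable]: "v0 \<in> borel_measurable borel" unfolding v0_def sgn_div_norm by measurable
  have n0: "n t = 0" if "t \<notin> {a..b}" for t using m(2) \<kappa>(2) that by (simp add: n_def)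
  have v0b: "norm (v0 t) \<le> 1" for t by (simp add: v0_def norm_sgn)
  have v: "bounded_control a b v"
  proof (rule bounded_controlI)
    show "v \<in> borel_measurable borel" unfolding v_def by measurable
    show "norm (v t) \<le> 1 + norm c" for t
    proof -
      have "norm (v t) \<le> norm (v0 t) + norm (indicator {a..b} t *\<^sub>R c)" unfolding v_def by (rule norm_triangle_ineq4)
      moreover have "norm (indicator {a..b} t *\<^sub>R c) \<le> norm c" by (simp add: indicator_def)
      ultimately show ?thesis using v0b[of t] by linarith
    qed
    show "v t = 0" if "t \<notin> {a..b}" for t using n0 that by (simp add: v_def v0_def)
  qed
  have ik: "integrable lborel (\<lambda>t. \<kappa> t *\<^sub>R v0 t)"
    using \<kappa>(1) v0b by (intro Bochner_Integration.integrable_bound[OF \<kappa>(1)]) (auto simp: mult_left_le)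
  have kc: "(\<lambda>t. \<kappa> t *\<^sub>R (indicator {a..b} t *\<^sub>R c)) = (\<lambda>t. \<kappa> t *\<^sub>R c)"
  proof
    show "\<kappa> t *\<^sub>R (indicator {a..b} t *\<^sub>R c) = \<kappa> t *\<^sub>R c" for t
      using \<kappa>(2)[of t] by (cases "t \<in> {a..b}") auto
  qed
  have mc: "(\<lambda>t. m t \<bullet> (indicator {a..b} t *\<^sub>R c)) = (\<lambda>t. m t \<bullet> c)"
  proof
    show "m t \<bullet> (indicator {a..b} t *\<^sub>R c) = m t \<bullet> c" for t
      using m(2)[of t] by (cases "t \<in> {a..b}") auto
  qed
  have "(\<integral>t. \<kappa> t *\<^sub>R v t \<partial>lborel) = (\<integral>t. \<kappa> t *\<^sub>R v0 t - \<kappa> t *\<^sub>R c \<partial>lborel)"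
    unfolding v_def scaleR_diff_right kc[THEN fun_cong] ..
  also have "\<dots> = (\<integral>t. \<kappa> t *\<^sub>R v0 t \<partial>lborel) - \<kappa>0 *\<^sub>R c"
    using ik \<kappa>(1) by (subst Bochner_Integration.integral_diff) (auto simp: \<kappa>0_def)
  also have "\<dots> = 0" using \<kappa>(3) by (simp add: c_def \<kappa>0_def)
  finally have 0: "(\<integral>t. m t \<bullet> v t \<partial>lborel) = 0" by (rule orth[OF v])
  have im: "integrable lborel (\<lambda>t. m t \<bullet> v0 t)"
  proof (rule Bochner_Integration.integrable_bound[OF m(1)])
    show "AE t in lborel. norm (m t \<bullet> v0 t) \<le> norm (m t)"
    proof (rule AE_I2)
      fix t
      have "norm (m t \<bullet> v0 t) \<le> norm (m t) * norm (v0 t)" by (simp add: Cauchy_Schwarz_ineq2)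
      also have "\<dots> \<le> norm (m t) * 1" using v0b by (intro mult_left_mono) auto
      finally show "norm (m t \<bullet> v0 t) \<le> norm (m t)" by simp
    qed
  qed measurable
  have mv: "(\<integral>t. m t \<bullet> v0 t \<partial>lborel) = integral\<^sup>L lborel m \<bullet> c"
  proof -
    have "(\<integral>t. m t \<bullet> v t \<partial>lborel) = (\<integral>t. m t \<bullet> v0 t - m t \<bullet> c \<partial>lborel)"
      unfolding v_def inner_diff_right mc[THEN fun_cong] ..
    also have "\<dots> = (\<integral>t. m t \<bullet> v0 t \<partial>lborel) - integral\<^sup>L lborel m \<bullet> c"
      using im m(1) by (subst Bochner_Integration.integral_diff) auto
    finally show ?thesis using 0 by simp
  qed
  have "(\<integral>t. norm (n t) \<partial>lborel) = (\<integral>t. m t \<bullet> v0 t - \<mu> \<bullet> (\<kappa> t *\<^sub>R v0 t) \<partial>lborel)"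
  proof (rule Bochner_Integration.integral_cong[OF refl])
    fix t
    have "n t \<bullet> v0 t = norm (n t)" by (cases "n t = 0") (simp_all add: v0_def sgn_div_norm dot_square_norm power2_eq_square)
    then show "norm (n t) = m t \<bullet> v0 t - \<mu> \<bullet> (\<kappa> t *\<^sub>R v0 t)" by (simp add: n_def inner_diff_left)
  qed
  also have "\<dots> = (\<integral>t. m t \<bullet> v0 t \<partial>lborel) - \<mu> \<bullet> (\<integral>t. \<kappa> t *\<^sub>R v0 t \<partial>lborel)"
    using Bochner_Integration.integral_diff[OF im integrable_inner_right[of \<mu>, OF ik]]
      integral_inner_right[of \<mu> lborel, OF ik] by (simp only:)
  also have "\<dots> = integral\<^sup>L lborel m \<bullet> c - \<mu> \<bullet> (\<kappa>0 *\<^sub>R c)" unfolding mv using \<kappa>(3) by (simp add: c_def \<kappa>0_def)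
  also have "\<dots> = 0" using \<kappa>(3) by (simp add: \<mu>_def \<kappa>0_def)
  finally have "(\<integral>t. norm (n t) \<partial>lborel) = 0" .
  moreover have "integrable lborel n" unfolding n_def using m(1) \<kappa>(1) by (intro Bochner_Integration.integrable_diff) auto
  ultimately have "AE t in lborel. norm (n t) = 0"
    using integral_nonneg_eq_0_iff_AE[of lborel "\<lambda>t. norm (n t)"] by simp
  then have "AE t in lborel. m t = \<kappa> t *\<^sub>R \<mu>" by (simp add: n_def)
  then show ?thesis by (rule that)
qed

lemma rl_kernel_bounded_away:
  assumes "0 < \<gamma>" "0 < \<delta>"
  obtains W where "0 < W" "\<And>r. \<delta> \<le> r \<Longrightarrow> r \<le> R \<Longrightarrow> rl_kernel \<gamma> r \<le> W"
proof -
  have G: "0 < Gamma \<gamma>" using assms by (simp add: Gamma_real_pos)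
  let ?W = "(\<delta> powr (\<gamma> - 1) + R powr (\<gamma> - 1) + 1) / Gamma \<gamma>"
  show ?thesis
  proof (rule that[of ?W])
    show "0 < ?W" using G by (intro divide_pos_pos add_nonneg_pos) auto
    fix r assume r: "\<delta> \<le> r" "r \<le> R"
    have "r powr (\<gamma> - 1) \<le> \<delta> powr (\<gamma> - 1) + R powr (\<gamma> - 1)"
    proof (cases "1 \<le> \<gamma>")
      case True
      then have "r powr (\<gamma> - 1) \<le> R powr (\<gamma> - 1)" using r assms by (intro powr_mono2) auto
      then show ?thesis using powr_ge_zero[of \<delta> "\<gamma> - 1"] by linarith
    next
      case False
      then have "r powr (\<gamma> - 1) \<le> \<delta> powr (\<gamma> - 1)" using r assms by (intro powr_mono2') auto
      then show ?thesis using powr_ge_zero[of R "\<gamma> - 1"] by linarith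
    qed
    then show "rl_kernel \<gamma> r \<le> ?W" using G r assms by (auto simp: rl_kernel_def intro!: divide_right_mono)
  qed
qed

text \<open>
  The problem near a fixed pair of state and velocity, with all representatives made explicit: \<open>\<Lambda>\<close> is the Lagrangian,
  defined for all times, \<open>A\<close> and \<open>B\<close> are its gradients in the state and in the velocity, \<open>x\<close> is the state, extended
  continuously to the line, and \<open>u\<close> is a bounded Borel version of its Caputo derivative. A perturbation consists of a
  change \<open>h\<close> of the state and a change \<open>v\<close> of the velocity.
\<close>

locale bolza =
  fixes a b \<alpha> \<beta> :: real
    and \<Lambda> :: "'e::euclidean_space \<Rightarrow> 'e \<Rightarrow> real \<Rightarrow> real"
    and A B :: "'e \<Rightarrow> 'e \<Rightarrow> real \<Rightarrow> 'e"
    and x u :: "real \<Rightarrow> 'e"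
  assumes ab: "a < b" and \<alpha>: "0 < \<alpha>" and \<beta>: "0 < \<beta>"
    and \<Lambda>_derivative: "\<And>y z t. ((\<lambda>p. \<Lambda> (fst p) (snd p) t) has_derivative
           (\<lambda>h. A y z t \<bullet> fst h + B y z t \<bullet> snd h)) (at (y, z))"
    and \<Lambda>_cont: "continuous_on UNIV (\<lambda>(y, z, t). \<Lambda> y z t)"
    and A_cont: "continuous_on UNIV (\<lambda>(y, z, t). A y z t)"
    and B_cont: "continuous_on UNIV (\<lambda>(y, z, t). B y z t)"
    and x_cont: "continuous_on UNIV x"
    and u_meas [measurable]: "u \<in> borel_measurable borel" and u_bounded: "bounded (range u)"
begin

definition weight :: "real \<Rightarrow> real" where "weight t = indicator {a..b} t * rl_kernel \<beta> (b - t)"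
definition state_grad :: "real \<Rightarrow> 'e" where "state_grad t = A (x t) (u t) t"
definition velocity_grad :: "real \<Rightarrow> 'e" where "velocity_grad t = B (x t) (u t) t"
definition cost_integral :: "(real \<Rightarrow> 'e) \<Rightarrow> (real \<Rightarrow> 'e) \<Rightarrow> real" where
  "cost_integral h v = (\<integral>t. weight t * \<Lambda> (x t + h t) (u t + v t) t \<partial>lborel)"
definition variation :: "(real \<Rightarrow> 'e) \<Rightarrow> (real \<Rightarrow> 'e) \<Rightarrow> real" where
  "variation h v = (\<integral>t. weight t * (state_grad t \<bullet> h t + velocity_grad t \<bullet> v t) \<partial>lborel)"

lemma x_meas [measurable]: "x \<in> borel_measurable borel"
  using x_cont by (rule borel_measurable_continuous_onI)

lemma compose_meas:
  fixes F :: "'e \<Rightarrow> 'e \<Rightarrow> real \<Rightarrow> 'z::euclidean_space"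
  assumes "continuous_on UNIV (\<lambda>(y, z, t). F y z t)"
    and [measurable]: "X \<in> borel_measurable borel" "U \<in> borel_measurable borel"
  shows "(\<lambda>t. F (X t) (U t) t) \<in> borel_measurable borel"
proof -
  have "(\<lambda>(y, z, t). F y z t) \<in> borel_measurable borel" using assms(1) by (rule borel_measurable_continuous_onI)
  moreover have "(\<lambda>t. (X t, U t, t)) \<in> borel_measurable borel" by measurable
  ultimately have "(\<lambda>t. (\<lambda>(y, z, t). F y z t) (X t, U t, t)) \<in> borel_measurable borel"
    by (rule measurable_compose[rotated])
  then show ?thesis by simp
qed

lemmas \<Lambda>_meas [measurable (raw)] = compose_meas[OF \<Lambda>_cont]
lemmas A_meas [measurable (raw)] = compose_meas[OF A_cont]
lemmas B_meas [measurable (raw)] = compose_meas[OF B_cont]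

lemma state_grad_measurable [measurable]: "state_grad \<in> borel_measurable borel" unfolding state_grad_def by measurable
lemma velocity_grad_measurable [measurable]: "velocity_grad \<in> borel_measurable borel" unfolding velocity_grad_def by measurable
lemma weight_measurable [measurable]: "weight \<in> borel_measurable borel" unfolding weight_def by measurable
lemma weight_nonneg [simp]: "0 \<le> weight t" using \<beta> by (simp add: weight_def)
lemma weight_outside: "t \<notin> {a..b} \<Longrightarrow> weight t = 0" by (simp add: weight_def)

lemma weight_integrable: "integrable lborel weight"
  unfolding weight_def by (rule integrable_rl_kernel_Icc[OF \<beta>])

lemma bounded_on_compact:
  fixes F :: "'e \<Rightarrow> 'e \<Rightarrow> real \<Rightarrow> 'z::euclidean_space"
  assumes "continuous_on UNIV (\<lambda>(y, z, t). F y z t)"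
  obtains C where "0 < C" "\<And>y z t. \<lbrakk>norm y \<le> M; norm z \<le> M; t \<in> {a..b}\<rbrakk> \<Longrightarrow> norm (F y z t) \<le> C"
proof -
  have "compact ((\<lambda>(y, z, t). F y z t) ` (cball 0 M \<times> cball 0 M \<times> {a..b}))"
    by (intro compact_continuous_image compact_Times compact_cball compact_Icc
        continuous_on_subset[OF assms]) auto
  then have "bounded ((\<lambda>(y, z, t). F y z t) ` (cball 0 M \<times> cball 0 M \<times> {a..b}))" by (rule compact_imp_bounded)
  then obtain C where C: "0 < C" "\<And>p. p \<in> (\<lambda>(y, z, t). F y z t) ` (cball 0 M \<times> cball 0 M \<times> {a..b}) \<Longrightarrow> norm p \<le> C"
    unfolding bounded_pos by blast
  show ?thesis
  proof (rule that[OF C(1)])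
    fix y z :: 'e and t assume "norm y \<le> M" "norm z \<le> M" "t \<in> {a..b}"
    then have "(y, z, t) \<in> cball 0 M \<times> cball 0 M \<times> {a..b}" by simp
    then have "(\<lambda>(y, z, t). F y z t) (y, z, t) \<in> (\<lambda>(y, z, t). F y z t) ` (cball 0 M \<times> cball 0 M \<times> {a..b})"
      by (rule imageI)
    then show "norm (F y z t) \<le> C" using C(2) by simp
  qed
qed

lemma state_velocity_bound:
  obtains X where "0 < X" "\<And>t. t \<in> {a..b} \<Longrightarrow> norm (x t) \<le> X" "\<And>t. norm (u t) \<le> X"
proof -
  have "bounded (x ` {a..b})"
    by (intro compact_imp_bounded compact_continuous_image continuous_on_subset[OF x_cont]) auto
  then obtain X1 where X1: "0 < X1" "\<And>t. t \<in> {a..b} \<Longrightarrow> norm (x t) \<le> X1" unfolding bounded_pos by blast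
  obtain X2 where X2: "0 < X2" "\<And>t. norm (u t) \<le> X2" using u_bounded unfolding bounded_pos by blast
  show ?thesis
  proof (rule that[of "max X1 X2"])
    show "norm (x t) \<le> max X1 X2" if "t \<in> {a..b}" for t using X1(2)[OF that] by simp
    show "norm (u t) \<le> max X1 X2" for t using X2(2)[of t] by simp
  qed (use X1 in simp)
qed

lemma \<Lambda>_lipschitz:
  obtains C where "0 < C"
    "\<And>y z y' z' t. \<lbrakk>norm y \<le> M; norm z \<le> M; norm y' \<le> M; norm z' \<le> M; t \<in> {a..b}\<rbrakk>
      \<Longrightarrow> \<bar>\<Lambda> y' z' t - \<Lambda> y z t\<bar> \<le> C * (norm (y' - y) + norm (z' - z)) \<and> norm (A y z t) \<le> C"
proof -
  obtain C1 where C1: "0 < C1" "\<And>y z t. \<lbrakk>norm y \<le> M; norm z \<le> M; t \<in> {a..b}\<rbrakk> \<Longrightarrow> norm (A y z t) \<le> C1"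
    by (rule bounded_on_compact[OF A_cont]) blast
  obtain C2 where C2: "0 < C2" "\<And>y z t. \<lbrakk>norm y \<le> M; norm z \<le> M; t \<in> {a..b}\<rbrakk> \<Longrightarrow> norm (B y z t) \<le> C2"
    by (rule bounded_on_compact[OF B_cont]) blast
  show ?thesis
  proof (rule that[of "C1 + C2"])
    show "0 < C1 + C2" using C1 C2 by simp
    fix y z y' z' :: 'e and t
    assume M: "norm y \<le> M" "norm z \<le> M" "norm y' \<le> M" "norm z' \<le> M" and t: "t \<in> {a..b}"
    let ?f = "\<lambda>p. \<Lambda> (fst p) (snd p) t"
    have "norm (?f (y', z') - ?f (y, z)) \<le> (C1 + C2) * norm ((y', z') - (y, z))"
    proof (rule differentiable_bound[where S = "cball 0 M \<times> cball 0 M"])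
      show "convex (cball 0 M \<times> cball 0 M :: ('e \<times> 'e) set)" by (intro convex_Times convex_cball)
      fix p :: "'e \<times> 'e" assume p: "p \<in> cball 0 M \<times> cball 0 M"
      show "(?f has_derivative (\<lambda>h. A (fst p) (snd p) t \<bullet> fst h + B (fst p) (snd p) t \<bullet> snd h)) (at p within cball 0 M \<times> cball 0 M)"
        using \<Lambda>_derivative[of t "fst p" "snd p"] by (simp add: has_derivative_at_withinI)
      have n: "norm (A (fst p) (snd p) t) \<le> C1" "norm (B (fst p) (snd p) t) \<le> C2"
        using p t by (auto intro!: C1(2) C2(2))
      show "onorm (\<lambda>h. A (fst p) (snd p) t \<bullet> fst h + B (fst p) (snd p) t \<bullet> snd h) \<le> C1 + C2"
      proof (rule onorm_bound)
        show "0 \<le> C1 + C2" using C1 C2 by simp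
        fix h :: "'e \<times> 'e"
        have "\<bar>A (fst p) (snd p) t \<bullet> fst h\<bar> \<le> norm (A (fst p) (snd p) t) * norm (fst h)" by (rule Cauchy_Schwarz_ineq2)
        also have "\<dots> \<le> C1 * norm h" using n C1 by (intro mult_mono) (auto simp: norm_fst_le[of "fst h" "snd h", simplified])
        finally have 1: "\<bar>A (fst p) (snd p) t \<bullet> fst h\<bar> \<le> C1 * norm h" .
        have "\<bar>B (fst p) (snd p) t \<bullet> snd h\<bar> \<le> norm (B (fst p) (snd p) t) * norm (snd h)" by (rule Cauchy_Schwarz_ineq2)
        also have "\<dots> \<le> C2 * norm h" using n C2 by (intro mult_mono) (auto simp: norm_snd_le[of "snd h" "fst h", simplified])
        finally have 2: "\<bar>B (fst p) (snd p) t \<bullet> snd h\<bar> \<le> C2 * norm h" .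
        show "norm (A (fst p) (snd p) t \<bullet> fst h + B (fst p) (snd p) t \<bullet> snd h) \<le> (C1 + C2) * norm h"
          using 1 2 by (simp add: distrib_right)
      qed
    qed (use M in auto)
    also have "\<dots> \<le> (C1 + C2) * (norm (y' - y) + norm (z' - z))"
      using C1 C2 by (intro mult_left_mono) (auto simp: norm_Pair sqrt_sum_squares_le_sum)
    finally have "\<bar>\<Lambda> y' z' t - \<Lambda> y z t\<bar> \<le> (C1 + C2) * (norm (y' - y) + norm (z' - z))" by simp
    moreover have "norm (A y z t) \<le> C1 + C2" using C1(2)[OF M(1,2) t] C2(1) by simp
    ultimately show "\<bar>\<Lambda> y' z' t - \<Lambda> y z t\<bar> \<le> (C1 + C2) * (norm (y' - y) + norm (z' - z)) \<and> norm (A y z t) \<le> C1 + C2"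
      by blast
  qed
qed

lemma cost_integrand_integrable:
  assumes [measurable]: "h \<in> borel_measurable borel" "v \<in> borel_measurable borel"
    and b: "\<And>t. t \<in> {a..b} \<Longrightarrow> norm (h t) \<le> M" "\<And>t. t \<in> {a..b} \<Longrightarrow> norm (v t) \<le> M"
  shows "integrable lborel (\<lambda>t. weight t * \<Lambda> (x t + h t) (u t + v t) t)"
proof -
  obtain X where X: "0 < X" "\<And>t. t \<in> {a..b} \<Longrightarrow> norm (x t) \<le> X" "\<And>t. norm (u t) \<le> X" using state_velocity_bound by blast
  obtain C where C: "0 < C" "\<And>y z t. \<lbrakk>norm y \<le> X + M; norm z \<le> X + M; t \<in> {a..b}\<rbrakk> \<Longrightarrow> norm (\<Lambda> y z t) \<le> C"
    by (rule bounded_on_compact[OF \<Lambda>_cont]) blast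
  show ?thesis
  proof (rule Bochner_Integration.integrable_bound[OF integrable_mult_left[OF weight_integrable, of C]])
    show "AE t in lborel. norm (weight t * \<Lambda> (x t + h t) (u t + v t) t) \<le> norm (weight t * C)"
    proof (rule AE_I2)
      fix t
      show "norm (weight t * \<Lambda> (x t + h t) (u t + v t) t) \<le> norm (weight t * C)"
      proof (cases "t \<in> {a..b}")
        case True
        have "norm (\<Lambda> (x t + h t) (u t + v t) t) \<le> C"
          using X b True by (intro C(2) order_trans[OF norm_triangle_ineq] add_mono) auto
        then show ?thesis using C(1) by (simp add: abs_mult mult_left_mono)
      qed (simp add: weight_outside)
    qed
  qed measurable
qed

lemma gradients_bounded:
  obtains C where "0 < C" "\<And>t. t \<in> {a..b} \<Longrightarrow> norm (state_grad t) \<le> C" "\<And>t. t \<in> {a..b} \<Longrightarrow> norm (velocity_grad t) \<le> C"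
proof -
  obtain X where X: "0 < X" "\<And>t. t \<in> {a..b} \<Longrightarrow> norm (x t) \<le> X" "\<And>t. norm (u t) \<le> X" using state_velocity_bound by blast
  obtain C1 where C1: "0 < C1" "\<And>y z t. \<lbrakk>norm y \<le> X; norm z \<le> X; t \<in> {a..b}\<rbrakk> \<Longrightarrow> norm (A y z t) \<le> C1"
    by (rule bounded_on_compact[OF A_cont]) blast
  obtain C2 where C2: "0 < C2" "\<And>y z t. \<lbrakk>norm y \<le> X; norm z \<le> X; t \<in> {a..b}\<rbrakk> \<Longrightarrow> norm (B y z t) \<le> C2"
    by (rule bounded_on_compact[OF B_cont]) blast
  show ?thesis
  proof (rule that[of "max C1 C2"])
    show "norm (state_grad t) \<le> max C1 C2" "norm (velocity_grad t) \<le> max C1 C2" if "t \<in> {a..b}" for t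
      using C1(2)[of "x t" "u t" t] C2(2)[of "x t" "u t" t] X that by (auto simp: state_grad_def velocity_grad_def intro: max.coboundedI1 max.coboundedI2)
  qed (use C1 in simp)
qed

lemma weight_mult_integrable:
  fixes F :: "real \<Rightarrow> 'z::euclidean_space"
  assumes [measurable]: "F \<in> borel_measurable borel" and F: "\<And>t. t \<in> {a..b} \<Longrightarrow> norm (F t) \<le> C"
  shows "integrable lborel (\<lambda>t. weight t *\<^sub>R F t)"
proof (rule Bochner_Integration.integrable_bound[OF integrable_mult_left[OF weight_integrable, of C]])
  show "AE t in lborel. norm (weight t *\<^sub>R F t) \<le> norm (weight t * C)"
  proof (rule AE_I2)
    fix t show "norm (weight t *\<^sub>R F t) \<le> norm (weight t * C)"
    proof (cases "t \<in> {a..b}")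
      case True
      then have "norm (F t) \<le> \<bar>C\<bar>" using F[OF True] by linarith
      then show ?thesis by (simp add: abs_mult mult_left_mono)
    qed (simp add: weight_outside)
  qed
qed measurable

lemma weighted_state_grad_integrable: "integrable lborel (\<lambda>t. weight t *\<^sub>R state_grad t)"
  and weighted_velocity_grad_integrable: "integrable lborel (\<lambda>t. weight t *\<^sub>R velocity_grad t)"
proof -
  obtain C where C: "0 < C" "\<And>t. t \<in> {a..b} \<Longrightarrow> norm (state_grad t) \<le> C" "\<And>t. t \<in> {a..b} \<Longrightarrow> norm (velocity_grad t) \<le> C"
    using gradients_bounded by blast
  show "integrable lborel (\<lambda>t. weight t *\<^sub>R state_grad t)" by (rule weight_mult_integrable[OF state_grad_measurable C(2)])
  show "integrable lborel (\<lambda>t. weight t *\<^sub>R velocity_grad t)" by (rule weight_mult_integrable[OF velocity_grad_measurable C(3)])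
qed

text \<open>
  Dominated convergence applies because \<open>\<Lambda>\<close> is Lipschitz on bounded sets, uniformly in time.
\<close>

proposition first_variation:
  assumes e: "\<epsilon> \<longlonglongrightarrow> (0::real)" "\<And>k. 0 < \<epsilon> k"
    and meas [measurable]: "\<And>k. h k \<in> borel_measurable borel" "\<And>k. v k \<in> borel_measurable borel"
      "h' \<in> borel_measurable borel" "v' \<in> borel_measurable borel"
    and bd: "\<And>k t. t \<in> {a..b} \<Longrightarrow> norm (h k t) \<le> M" "\<And>k t. t \<in> {a..b} \<Longrightarrow> norm (v k t) \<le> M"
    and lim: "\<And>t. t \<in> {a..b} \<Longrightarrow> (\<lambda>k. h k t) \<longlonglongrightarrow> h' t" "\<And>t. t \<in> {a..b} \<Longrightarrow> (\<lambda>k. v k t) \<longlonglongrightarrow> v' t"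
  shows "(\<lambda>k. (cost_integral (\<lambda>t. \<epsilon> k *\<^sub>R h k t) (\<lambda>t. \<epsilon> k *\<^sub>R v k t) - cost_integral (\<lambda>_. 0) (\<lambda>_. 0)) / \<epsilon> k) \<longlonglongrightarrow> variation h' v'"
proof -
  have "a \<in> {a..b}" using ab by simp
  then have M0: "0 \<le> M" using bd(1) order_trans[OF norm_ge_zero] by blast
  obtain X where X: "0 < X" "\<And>t. t \<in> {a..b} \<Longrightarrow> norm (x t) \<le> X" "\<And>t. norm (u t) \<le> X" using state_velocity_bound by blast
  obtain E where E: "0 < E" "\<And>k. norm (\<epsilon> k) \<le> E"
    using convergent_imp_Bseq[of \<epsilon>] e(1) by (auto simp: convergent_def Bseq_def)
  have Ek: "\<epsilon> k \<le> E" for k using E(2)[of k] by simp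
  obtain C where C: "0 < C"
    "\<And>y z y' z' t. \<lbrakk>norm y \<le> X + E * M; norm z \<le> X + E * M; norm y' \<le> X + E * M; norm z' \<le> X + E * M; t \<in> {a..b}\<rbrakk>
      \<Longrightarrow> \<bar>\<Lambda> y' z' t - \<Lambda> y z t\<bar> \<le> C * (norm (y' - y) + norm (z' - z)) \<and> norm (A y z t) \<le> C"
    by (rule \<Lambda>_lipschitz) blast
  let ?D = "\<lambda>k t. weight t * ((\<Lambda> (x t + \<epsilon> k *\<^sub>R h k t) (u t + \<epsilon> k *\<^sub>R v k t) t - \<Lambda> (x t) (u t) t) / \<epsilon> k)"
  have eb: "norm (\<epsilon> k *\<^sub>R q) \<le> E * M" if "norm q \<le> M" for k and q :: 'e
    using mult_mono[OF Ek that] e(2)[of k] E(1) by simp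
  have i0: "integrable lborel (\<lambda>t. weight t * \<Lambda> (x t) (u t) t)" using cost_integrand_integrable[of "\<lambda>_. 0" "\<lambda>_. 0" 0] by simp
  have ik: "integrable lborel (\<lambda>t. weight t * \<Lambda> (x t + \<epsilon> k *\<^sub>R h k t) (u t + \<epsilon> k *\<^sub>R v k t) t)" for k
    by (rule cost_integrand_integrable[where M = "E * M"]) (use bd eb in auto)
  have Deq: "(cost_integral (\<lambda>t. \<epsilon> k *\<^sub>R h k t) (\<lambda>t. \<epsilon> k *\<^sub>R v k t) - cost_integral (\<lambda>_. 0) (\<lambda>_. 0)) / \<epsilon> k = integral\<^sup>L lborel (?D k)" for k
  proof -
    have "integral\<^sup>L lborel (?D k) = (\<integral>t. (weight t * \<Lambda> (x t + \<epsilon> k *\<^sub>R h k t) (u t + \<epsilon> k *\<^sub>R v k t) t - weight t * \<Lambda> (x t) (u t) t) / \<epsilon> k \<partial>lborel)"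
      by (rule Bochner_Integration.integral_cong) (auto simp: algebra_simps diff_divide_distrib)
    also have "\<dots> = (cost_integral (\<lambda>t. \<epsilon> k *\<^sub>R h k t) (\<lambda>t. \<epsilon> k *\<^sub>R v k t) - cost_integral (\<lambda>_. 0) (\<lambda>_. 0)) / \<epsilon> k"
      unfolding cost_integral_def using ik[of k] i0 by simp
    finally show ?thesis ..
  qed
  show ?thesis
    unfolding Deq variation_def
  proof (rule integral_dominated_convergence[where w = "\<lambda>t. weight t * (C * (2 * M))"])
    show "integrable lborel (\<lambda>t. weight t * (C * (2 * M)))" using weight_integrable by simp
    show "AE t in lborel. (\<lambda>k. ?D k t) \<longlonglongrightarrow> weight t * (state_grad t \<bullet> h' t + velocity_grad t \<bullet> v' t)"
    proof (rule AE_I2)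
      fix t
      show "(\<lambda>k. ?D k t) \<longlonglongrightarrow> weight t * (state_grad t \<bullet> h' t + velocity_grad t \<bullet> v' t)"
      proof (cases "t \<in> {a..b}")
        case True
        have "(\<lambda>k. (h k t, v k t)) \<longlonglongrightarrow> (h' t, v' t)" using lim True by (intro tendsto_Pair)
        from has_derivative_sequence[OF \<Lambda>_derivative[of t "x t" "u t"] e this]
        show ?thesis by (intro tendsto_mult tendsto_const) (simp add: state_grad_def velocity_grad_def)
      qed (simp add: weight_outside)
    qed
    fix k
    show "AE t in lborel. norm (?D k t) \<le> weight t * (C * (2 * M))"
    proof (rule AE_I2)
      fix t
      show "norm (?D k t) \<le> weight t * (C * (2 * M))"
      proof (cases "t \<in> {a..b}")
        case True
        have n: "norm (x t + \<epsilon> k *\<^sub>R h k t) \<le> X + E * M" "norm (u t + \<epsilon> k *\<^sub>R v k t) \<le> X + E * M"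
          using X bd True eb by (intro order_trans[OF norm_triangle_ineq] add_mono; simp)+
        have n0: "norm (x t) \<le> X + E * M" "norm (u t) \<le> X + E * M"
          using X(2)[OF True] X(3)[of t] E(1) M0 mult_nonneg_nonneg[of E M] by linarith+
        have "\<bar>\<Lambda> (x t + \<epsilon> k *\<^sub>R h k t) (u t + \<epsilon> k *\<^sub>R v k t) t - \<Lambda> (x t) (u t) t\<bar> \<le>
            C * (norm (\<epsilon> k *\<^sub>R h k t) + norm (\<epsilon> k *\<^sub>R v k t))"
          using C(2)[OF n0 n True] by simp
        also have "\<dots> \<le> C * (\<epsilon> k * M + \<epsilon> k * M)"
          using bd True e(2)[of k] C(1) by (intro mult_left_mono add_mono) auto
        finally have "\<bar>\<Lambda> (x t + \<epsilon> k *\<^sub>R h k t) (u t + \<epsilon> k *\<^sub>R v k t) t - \<Lambda> (x t) (u t) t\<bar> / \<epsilon> k \<le> C * (2 * M)"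
          using e(2)[of k] by (simp add: field_simps)
        then have "weight t * (\<bar>\<Lambda> (x t + \<epsilon> k *\<^sub>R h k t) (u t + \<epsilon> k *\<^sub>R v k t) t - \<Lambda> (x t) (u t) t\<bar> / \<epsilon> k) \<le> weight t * (C * (2 * M))"
          by (rule mult_left_mono) simp
        then show ?thesis using e(2)[of k] by (simp add: abs_mult)
      qed (simp add: weight_outside)
    qed
  qed measurable
qed

end

section \<open>The integrated Euler-Lagrange equation and the motion of end points\<close>

lemma bounded_control_scaleR: "bounded_control a b v \<Longrightarrow> bounded_control a b (\<lambda>t. c *\<^sub>R v t)"
proof -
  assume v: "bounded_control a b v"
  note [measurable] = bounded_control_measurable[OF v]
  obtain C where C: "0 < C" "\<And>s. norm (v s) \<le> C * indicator {a..b} s"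
    using bounded_controlD[OF v] by blast
  show ?thesis
  proof (rule bounded_controlI)
    show "(\<lambda>t. c *\<^sub>R v t) \<in> borel_measurable borel" by measurable
    have "norm (v s) \<le> C" for s using C(2)[of s] C(1) by (cases "s \<in> {a..b}") auto
    then show "norm (c *\<^sub>R v s) \<le> \<bar>c\<bar> * C" for s by (simp add: mult_left_mono)
    show "c *\<^sub>R v s = 0" if "s \<notin> {a..b}" for s using v that by (simp add: bounded_control_def)
  qed
qed

lemma rl_left_bounded:
  fixes v :: "real \<Rightarrow> 'a::euclidean_space"
  assumes "0 < \<gamma>" "bounded_control a b v"
  obtains M where "\<And>t. t \<in> {a..b} \<Longrightarrow> norm (rl_left \<gamma> v t) \<le> M"
proof -
  have "bounded (rl_left \<gamma> v ` {a..b})"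
    by (intro compact_imp_bounded compact_continuous_image rl_left_continuous assms) auto
  then obtain M where M: "\<And>p. p \<in> rl_left \<gamma> v ` {a..b} \<Longrightarrow> norm p \<le> M" unfolding bounded_iff by blast
  show ?thesis by (rule that[of M]) (use M in blast)
qed

lemma bounded_control_bound:
  assumes "bounded_control a b v"
  obtains M where "\<And>t. norm (v t) \<le> M"
  using assms unfolding bounded_control_def bounded_iff by blast

context bolza begin

text \<open>
  The factor of \<open>v\<close> in the first variation once the state term has been integrated by parts.
\<close>

definition momentum :: "real \<Rightarrow> 'e" where
  "momentum t = indicator {a..b} t *\<^sub>R (weight t *\<^sub>R velocity_grad t + rl_right \<alpha> (\<lambda>t. weight t *\<^sub>R state_grad t) t)"

lemma momentum_integrable: "integrable lborel momentum"
proof -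
  have "momentum = (\<lambda>t. weight t *\<^sub>R velocity_grad t + indicator {a..b} t *\<^sub>R rl_right \<alpha> (\<lambda>t. weight t *\<^sub>R state_grad t) t)"
    by (auto simp: momentum_def fun_eq_iff indicator_def weight_outside)
  moreover have "integrable lborel (\<lambda>t. indicator {a..b} t *\<^sub>R rl_right \<alpha> (\<lambda>t. weight t *\<^sub>R state_grad t) t)"
    by (rule rl_right_integrable_Icc[OF \<alpha> weighted_state_grad_integrable]) (simp add: weight_outside)
  ultimately show ?thesis using weighted_velocity_grad_integrable by (simp add: Bochner_Integration.integrable_add)
qed

lemma variation_control:
  assumes v: "bounded_control a b v"
  shows "variation (rl_left \<alpha> v) v = (\<integral>t. momentum t \<bullet> v t \<partial>lborel)"
    and "integrable lborel (\<lambda>t. weight t * (state_grad t \<bullet> rl_left \<alpha> v t + velocity_grad t \<bullet> v t))"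
proof -
  note [measurable] = bounded_control_measurable[OF v]
  note dual = rl_integral_duality[OF \<alpha> weighted_state_grad_integrable _ v]
  have o: "weight t *\<^sub>R state_grad t = 0" if "t \<notin> {a..b}" for t using that by (simp add: weight_outside)
  obtain M where M: "\<And>t. norm (v t) \<le> M" using bounded_control_bound[OF v] by blast
  have iB: "integrable lborel (\<lambda>t. (weight t *\<^sub>R velocity_grad t) \<bullet> v t)"
  proof (rule Bochner_Integration.integrable_bound[OF integrable_mult_left[OF integrable_norm[OF weighted_velocity_grad_integrable], of M]])
    show "AE t in lborel. norm ((weight t *\<^sub>R velocity_grad t) \<bullet> v t) \<le> norm (norm (weight t *\<^sub>R velocity_grad t) * M)"
    proof (rule AE_I2)
      fix t
      have "norm ((weight t *\<^sub>R velocity_grad t) \<bullet> v t) \<le> norm (weight t *\<^sub>R velocity_grad t) * norm (v t)" by (simp only: real_norm_def Cauchy_Schwarz_ineq2)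
      also have "\<dots> \<le> norm (weight t *\<^sub>R velocity_grad t) * M" by (rule mult_left_mono[OF M]) simp
      finally show "norm ((weight t *\<^sub>R velocity_grad t) \<bullet> v t) \<le> norm (norm (weight t *\<^sub>R velocity_grad t) * M)" by simp
    qed
  qed measurable
  have e: "weight t * (state_grad t \<bullet> rl_left \<alpha> v t + velocity_grad t \<bullet> v t) = (weight t *\<^sub>R state_grad t) \<bullet> rl_left \<alpha> v t + (weight t *\<^sub>R velocity_grad t) \<bullet> v t" for t
    by (simp add: distrib_left)
  show "integrable lborel (\<lambda>t. weight t * (state_grad t \<bullet> rl_left \<alpha> v t + velocity_grad t \<bullet> v t))"
    unfolding e by (rule Bochner_Integration.integrable_add[OF dual(2)[OF o] iB])
  have "variation (rl_left \<alpha> v) v = (\<integral>t. (weight t *\<^sub>R state_grad t) \<bullet> rl_left \<alpha> v t \<partial>lborel) + (\<integral>t. (weight t *\<^sub>R velocity_grad t) \<bullet> v t \<partial>lborel)"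
    unfolding variation_def e by (rule Bochner_Integration.integral_add[OF dual(2)[OF o] iB])
  also have "\<dots> = (\<integral>t. rl_right \<alpha> (\<lambda>t. weight t *\<^sub>R state_grad t) t \<bullet> v t \<partial>lborel) + (\<integral>t. (weight t *\<^sub>R velocity_grad t) \<bullet> v t \<partial>lborel)"
    using dual(1)[OF o] by simp
  also have "\<dots> = (\<integral>t. rl_right \<alpha> (\<lambda>t. weight t *\<^sub>R state_grad t) t \<bullet> v t + (weight t *\<^sub>R velocity_grad t) \<bullet> v t \<partial>lborel)"
    by (rule Bochner_Integration.integral_add[symmetric, OF dual(3)[OF o] iB])
  also have "\<dots> = (\<integral>t. momentum t \<bullet> v t \<partial>lborel)"
    by (rule Bochner_Integration.integral_cong)
      (use v in \<open>auto simp: momentum_def indicator_def bounded_control_def inner_add_left\<close>)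
  finally show "variation (rl_left \<alpha> v) v = (\<integral>t. momentum t \<bullet> v t \<partial>lborel)" .
qed

lemma rl_left_endpoint:
  "rl_left \<alpha> v b = (\<integral>t. (indicator {a..b} t * rl_kernel \<alpha> (b - t)) *\<^sub>R v t \<partial>lborel)" if "bounded_control a b v"
  unfolding rl_left_def by (rule Bochner_Integration.integral_cong) (use that in \<open>auto simp: indicator_def bounded_control_def\<close>)

lemma endpoint_mass:
  "(\<integral>t. indicator {a..b} t * rl_kernel \<alpha> (b - t) \<partial>lborel) = rl_kernel (\<alpha> + 1) (b - a)"
proof -
  have "(\<integral>t. indicator {a..b} t * rl_kernel \<alpha> (b - t) \<partial>lborel) = (\<integral>t. indicator {a<..} t * rl_kernel \<alpha> (b - t) \<partial>lborel)"
  proof (rule integral_cong_AE)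
    show "AE t in lborel. indicator {a..b} t * rl_kernel \<alpha> (b - t) = indicator {a<..} t * rl_kernel \<alpha> (b - t)"
      using AE_lborel_singleton[of a] by eventually_elim (auto simp: indicator_def)
  qed measurable
  then show ?thesis using rl_kernel_has_integral_Ioi(2)[OF \<alpha>, of a b] by simp
qed

end

locale bolza_minimum = bolza a b \<alpha> \<beta> \<Lambda> A B x u
  for a b \<alpha> \<beta> and \<Lambda> :: "'e::euclidean_space \<Rightarrow> 'e \<Rightarrow> real \<Rightarrow> real" and A B x u +
  assumes minimal_fixed_ends: "\<And>v. bounded_control a b v \<Longrightarrow> rl_left \<alpha> v b = 0 \<Longrightarrow>
     cost_integral (\<lambda>_. 0) (\<lambda>_. 0) \<le> cost_integral (rl_left \<alpha> v) v"
begin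

lemma variation_nonneg_fixed_ends:
  assumes v: "bounded_control a b v" and vb: "rl_left \<alpha> v b = 0"
  shows "0 \<le> variation (rl_left \<alpha> v) v"
proof -
  note [measurable] = bounded_control_measurable[OF v]
  obtain M1 where M1: "\<And>t. norm (v t) \<le> M1" using bounded_control_bound[OF v] by blast
  obtain M2 where M2: "\<And>t. t \<in> {a..b} \<Longrightarrow> norm (rl_left \<alpha> v t) \<le> M2" using rl_left_bounded[OF \<alpha> v] by blast
  let ?e = "\<lambda>k. inverse (real (Suc k))"
  have lim: "(\<lambda>k. (cost_integral (\<lambda>t. ?e k *\<^sub>R rl_left \<alpha> v t) (\<lambda>t. ?e k *\<^sub>R v t) - cost_integral (\<lambda>_. 0) (\<lambda>_. 0)) / ?e k)
      \<longlonglongrightarrow> variation (rl_left \<alpha> v) v"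
    by (rule first_variation[where M = "max M1 M2", OF LIMSEQ_inverse_real_of_nat])
       (use M1 M2 in \<open>auto intro: max.coboundedI1 max.coboundedI2\<close>)
  have "0 \<le> (cost_integral (\<lambda>t. ?e k *\<^sub>R rl_left \<alpha> v t) (\<lambda>t. ?e k *\<^sub>R v t) - cost_integral (\<lambda>_. 0) (\<lambda>_. 0)) / ?e k" for k
  proof -
    have "cost_integral (\<lambda>_. 0) (\<lambda>_. 0) \<le> cost_integral (rl_left \<alpha> (\<lambda>t. ?e k *\<^sub>R v t)) (\<lambda>t. ?e k *\<^sub>R v t)"
      by (rule minimal_fixed_ends[OF bounded_control_scaleR[OF v]]) (simp add: rl_left_scaleR vb)
    moreover have "rl_left \<alpha> (\<lambda>t. ?e k *\<^sub>R v t) = (\<lambda>t. ?e k *\<^sub>R rl_left \<alpha> v t)"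
      by (rule ext) (rule rl_left_scaleR)
    ultimately show ?thesis by simp
  qed
  then show ?thesis by (intro LIMSEQ_le_const[OF lim]) auto
qed

text \<open>
  Both \<open>v\<close> and its negative are admissible, so the momentum is orthogonal to every control that does not move the final
  point.
\<close>

proposition Euler_Lagrange_integrated:
  obtains \<mu> where "AE t in lborel. momentum t = (indicator {a..b} t * rl_kernel \<alpha> (b - t)) *\<^sub>R \<mu>"
proof (rule du_Bois_Reymond[of momentum a b "\<lambda>t. indicator {a..b} t * rl_kernel \<alpha> (b - t)"])
  show "integrable lborel momentum" by (rule momentum_integrable)
  show "momentum t = 0" if "t \<notin> {a..b}" for t using that by (simp add: momentum_def)
  show "integrable lborel (\<lambda>t. indicator {a..b} t * rl_kernel \<alpha> (b - t))" by (rule integrable_rl_kernel_Icc[OF \<alpha>])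
  show "(\<integral>t. indicator {a..b} t * rl_kernel \<alpha> (b - t) \<partial>lborel) \<noteq> 0"
    using rl_kernel_pos[of "\<alpha> + 1" "b - a"] \<alpha> ab by (simp add: endpoint_mass)
  fix v :: "real \<Rightarrow> 'e"
  assume v: "bounded_control a b v" and "(\<integral>t. (indicator {a..b} t * rl_kernel \<alpha> (b - t)) *\<^sub>R v t \<partial>lborel) = 0"
  then have vb: "rl_left \<alpha> v b = 0" by (simp add: rl_left_endpoint)
  have 1: "0 \<le> (\<integral>t. momentum t \<bullet> v t \<partial>lborel)"
    using variation_nonneg_fixed_ends[OF v vb] by (simp add: variation_control(1)[OF v])
  have v': "bounded_control a b (\<lambda>t. (-1) *\<^sub>R v t)" by (rule bounded_control_scaleR[OF v])
  have "rl_left \<alpha> (\<lambda>t. (-1) *\<^sub>R v t) b = 0" by (simp only: rl_left_scaleR vb scaleR_zero_right)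
  from variation_nonneg_fixed_ends[OF v' this]
  have "0 \<le> - (\<integral>t. momentum t \<bullet> v t \<partial>lborel)" unfolding variation_control(1)[OF v'] by simp
  with 1 show "(\<integral>t. momentum t \<bullet> v t \<partial>lborel) = 0" by simp
qed (auto simp: that)

end

context bolza begin

text \<open>
  Along arbitrary controls the first variation depends only on the displacement of the final point.
\<close>

lemma variation_eq_endpoint:
  assumes \<mu>: "AE t in lborel. momentum t = (indicator {a..b} t * rl_kernel \<alpha> (b - t)) *\<^sub>R \<mu>"
    and v: "bounded_control a b v"
  shows "variation (rl_left \<alpha> v) v = \<mu> \<bullet> rl_left \<alpha> v b"
proof -
  note [measurable] = bounded_control_measurable[OF v]
  have [measurable]: "momentum \<in> borel_measurable borel" using momentum_integrable by auto
  have i: "integrable lborel (\<lambda>t. (indicator {a..b} t * rl_kernel \<alpha> (b - t)) *\<^sub>R v t)"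
  proof (rule integrable_bounded_control_mult[OF v])
    have "(\<lambda>s. indicator {a..b} s * (indicator {a..b} s * rl_kernel \<alpha> (b - s))) = (\<lambda>s. indicator {a..b} s * rl_kernel \<alpha> (b - s))"
      by (auto simp: indicator_def)
    then show "integrable lborel (\<lambda>s. indicator {a..b} s * (indicator {a..b} s * rl_kernel \<alpha> (b - s)))"
      using integrable_rl_kernel_Icc(1)[OF \<alpha>] by simp
  qed measurable
  have "variation (rl_left \<alpha> v) v = (\<integral>t. \<mu> \<bullet> ((indicator {a..b} t * rl_kernel \<alpha> (b - t)) *\<^sub>R v t) \<partial>lborel)"
    unfolding variation_control(1)[OF v]
    by (rule integral_cong_AE) (use \<mu> in \<open>auto elim!: eventually_mono\<close>)
  also have "\<dots> = \<mu> \<bullet> rl_left \<alpha> v b"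
    unfolding rl_left_endpoint[OF v] using i by (intro integral_inner_right)
  finally show ?thesis .
qed

text \<open>
  A constant velocity whose fractional integral reaches \<open>d\<close> at the final time: by \<open>endpoint_mass\<close>, the fractional integral of the
  constant \<open>1\<close> has the value \<open>rl_kernel (\<alpha> + 1) (b - a)\<close> at \<open>b\<close>.
\<close>

definition end_control :: "'e \<Rightarrow> real \<Rightarrow> 'e" where
  "end_control d t = indicator {a..b} t *\<^sub>R ((1 / rl_kernel (\<alpha> + 1) (b - a)) *\<^sub>R d)"

lemma end_control: "bounded_control a b (end_control d)"
  by (rule bounded_controlI[where C = "norm ((1 / rl_kernel (\<alpha> + 1) (b - a)) *\<^sub>R d)"])
    (auto simp: end_control_def[abs_def] indicator_def)

lemma end_control_endpoint: "rl_left \<alpha> (end_control d) b = d"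
proof -
  have "0 < rl_kernel (\<alpha> + 1) (b - a)" using rl_kernel_pos[of "\<alpha> + 1" "b - a"] \<alpha> ab by simp
  moreover have "rl_left \<alpha> (end_control d) b =
      (\<integral>t. (indicator {a..b} t * rl_kernel \<alpha> (b - t)) *\<^sub>R ((1 / rl_kernel (\<alpha> + 1) (b - a)) *\<^sub>R d) \<partial>lborel)"
    unfolding rl_left_endpoint[OF end_control]
    by (rule Bochner_Integration.integral_cong) (auto simp: end_control_def indicator_def)
  moreover have "\<dots> = rl_kernel (\<alpha> + 1) (b - a) *\<^sub>R ((1 / rl_kernel (\<alpha> + 1) (b - a)) *\<^sub>R d)"
    by (subst integral_scaleR_left) (auto simp: endpoint_mass integrable_rl_kernel_Icc[OF \<alpha>])
  ultimately show ?thesis by simp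
qed

lemma rl_left_end_control: "rl_left \<alpha> (end_control d) t = rl_left \<alpha> (indicator {a..b}) t *\<^sub>R ((1 / rl_kernel (\<alpha> + 1) (b - a)) *\<^sub>R d)"
proof -
  have "integrable lborel (\<lambda>s. rl_kernel \<alpha> (t - s) * indicator {a..b} s)"
    using integrable_rl_kernel_Icc(1)[OF \<alpha>, of a b t] by (simp add: mult.commute)
  moreover have "rl_left \<alpha> (end_control d) t = (\<integral>s. (rl_kernel \<alpha> (t - s) * indicator {a..b} s) *\<^sub>R ((1 / rl_kernel (\<alpha> + 1) (b - a)) *\<^sub>R d) \<partial>lborel)"
    unfolding rl_left_def by (rule Bochner_Integration.integral_cong) (auto simp: end_control_def)
  ultimately show ?thesis by (simp add: rl_left_def)
qed

text \<open>
  The displacement \<open>c\<close> of the initial point is realised by a constant, the displacement \<open>d\<close> of the final point by steering the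
  remaining \<open>d - c\<close>. The constant pairs with the integral of the weighted state gradient, the control with \<open>\<mu>\<close>.
\<close>

proposition end_variation:
  assumes \<mu>: "AE t in lborel. momentum t = (indicator {a..b} t * rl_kernel \<alpha> (b - t)) *\<^sub>R \<mu>"
    and e: "\<epsilon> \<longlonglongrightarrow> (0::real)" "\<And>k. 0 < \<epsilon> k" and cd: "c \<longlonglongrightarrow> c'" "d \<longlonglongrightarrow> d'"
  shows "(\<lambda>k. (cost_integral (\<lambda>t. \<epsilon> k *\<^sub>R (c k + rl_left \<alpha> (end_control (d k - c k)) t)) (\<lambda>t. \<epsilon> k *\<^sub>R end_control (d k - c k) t)
            - cost_integral (\<lambda>_. 0) (\<lambda>_. 0)) / \<epsilon> k)
    \<longlonglongrightarrow> ((\<integral>t. weight t *\<^sub>R state_grad t \<partial>lborel) - \<mu>) \<bullet> c' + \<mu> \<bullet> d'"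
proof -
  define r where "r = 1 / rl_kernel (\<alpha> + 1) (b - a)"
  define \<theta> where "\<theta> = rl_left \<alpha> (indicator {a..b} :: real \<Rightarrow> real)"
  have ind: "bounded_control a b (indicator {a..b} :: real \<Rightarrow> real)"
    by (rule bounded_controlI[where C = 1]) (auto simp: indicator_def)
  have h: "rl_left \<alpha> (end_control q) t = \<theta> t *\<^sub>R (r *\<^sub>R q)" for q t
    by (simp add: rl_left_end_control \<theta>_def r_def)
  have v: "end_control q t = indicator {a..b} t *\<^sub>R (r *\<^sub>R q)" for q t by (simp add: end_control_def r_def)
  have [measurable]: "\<theta> \<in> borel_measurable borel" unfolding \<theta>_def by measurable
  obtain T where T: "\<And>t. t \<in> {a..b} \<Longrightarrow> norm (\<theta> t) \<le> T" unfolding \<theta>_def using rl_left_bounded[OF \<alpha> ind] by blast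
  obtain C where C: "\<And>k. norm (c k) \<le> C" using convergent_imp_Bseq[of c] cd(1) by (auto simp: convergent_def Bseq_def)
  have "(\<lambda>k. d k - c k) \<longlonglongrightarrow> d' - c'" using cd by (intro tendsto_intros)
  then have "Bseq (\<lambda>k. d k - c k)" by (intro convergent_imp_Bseq) (auto simp: convergent_def)
  then obtain D where D: "\<And>k. norm (d k - c k) \<le> D" by (auto simp: Bseq_def)
  have rD: "norm (r *\<^sub>R (d k - c k)) \<le> \<bar>r\<bar> * D" for k
    using mult_left_mono[OF D[of k], of "\<bar>r\<bar>"] by simp
  have T0: "0 \<le> T" using T[of a] ab order_trans[OF norm_ge_zero] by fastforce
  have lim: "(\<lambda>k. (cost_integral (\<lambda>t. \<epsilon> k *\<^sub>R (c k + rl_left \<alpha> (end_control (d k - c k)) t)) (\<lambda>t. \<epsilon> k *\<^sub>R end_control (d k - c k) t)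
            - cost_integral (\<lambda>_. 0) (\<lambda>_. 0)) / \<epsilon> k)
      \<longlonglongrightarrow> variation (\<lambda>t. c' + rl_left \<alpha> (end_control (d' - c')) t) (end_control (d' - c'))"
  proof (rule first_variation[OF e, where M = "max (C + T * (\<bar>r\<bar> * D)) (\<bar>r\<bar> * D)"])
    show "norm (c k + rl_left \<alpha> (end_control (d k - c k)) t) \<le> max (C + T * (\<bar>r\<bar> * D)) (\<bar>r\<bar> * D)" if t: "t \<in> {a..b}" for k t
    proof -
      have "norm (\<theta> t *\<^sub>R (r *\<^sub>R (d k - c k))) \<le> T * (\<bar>r\<bar> * D)"
        unfolding norm_scaleR[of "\<theta> t"] using T[OF t] T0 by (intro mult_mono rD) auto
      then have "norm (c k + rl_left \<alpha> (end_control (d k - c k)) t) \<le> C + T * (\<bar>r\<bar> * D)"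
        unfolding h by (intro order_trans[OF norm_triangle_ineq] add_mono C)
      then show ?thesis by simp
    qed
    show "norm (end_control (d k - c k) t) \<le> max (C + T * (\<bar>r\<bar> * D)) (\<bar>r\<bar> * D)" if "t \<in> {a..b}" for k t
      unfolding v using that by (intro max.coboundedI2) (simp only: indicator_simps scaleR_one rD)
    show "(\<lambda>k. c k + rl_left \<alpha> (end_control (d k - c k)) t) \<longlonglongrightarrow> c' + rl_left \<alpha> (end_control (d' - c')) t" for t
      unfolding h using cd by (intro tendsto_intros)
    show "(\<lambda>k. end_control (d k - c k) t) \<longlonglongrightarrow> end_control (d' - c') t" for t
      unfolding v using cd by (intro tendsto_intros)
  qed (unfold h v, measurable)
  have "variation (\<lambda>t. c' + rl_left \<alpha> (end_control (d' - c')) t) (end_control (d' - c')) =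
      (\<integral>t. (weight t *\<^sub>R state_grad t) \<bullet> c' + weight t * (state_grad t \<bullet> rl_left \<alpha> (end_control (d' - c')) t + velocity_grad t \<bullet> end_control (d' - c') t) \<partial>lborel)"
    unfolding variation_def by (rule Bochner_Integration.integral_cong) (auto simp: inner_add_right algebra_simps)
  also have "\<dots> = (\<integral>t. weight t *\<^sub>R state_grad t \<partial>lborel) \<bullet> c' + variation (rl_left \<alpha> (end_control (d' - c'))) (end_control (d' - c'))"
    unfolding variation_def
    using Bochner_Integration.integral_add[OF integrable_inner_left[of c', OF weighted_state_grad_integrable] variation_control(2)[OF end_control]]
      integral_inner_left[of c', OF weighted_state_grad_integrable] by (simp only:)
  also have "variation (rl_left \<alpha> (end_control (d' - c'))) (end_control (d' - c')) = \<mu> \<bullet> (d' - c')"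
    by (simp add: variation_eq_endpoint[OF \<mu> end_control] end_control_endpoint)
  finally have "variation (\<lambda>t. c' + rl_left \<alpha> (end_control (d' - c')) t) (end_control (d' - c')) =
      ((\<integral>t. weight t *\<^sub>R state_grad t \<partial>lborel) - \<mu>) \<bullet> c' + \<mu> \<bullet> d'"
    by (simp add: inner_diff_left inner_diff_right)
  with lim show ?thesis by (simp only:)
qed

end

section \<open>Needle variations\<close>

text \<open>
  The primitive is continuous, so it attains all intermediate values.
\<close>

lemma split_by_primitive:
  fixes f :: "real \<Rightarrow> real"
  assumes f: "integrable lborel f" and supp: "\<And>t. t \<notin> {a..b} \<Longrightarrow> f t = 0" and ab: "a < b"
    and m: "0 \<le> m" "m \<le> integral\<^sup>L lborel f"
  obtains \<tau> where "\<tau> \<in> {a..b}" "(\<integral>t. indicator {..<\<tau>} t * f t \<partial>lborel) = m"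
proof -
  have [measurable]: "f \<in> borel_measurable borel" using f by auto
  have e: "rl_left 1 f \<tau> = (\<integral>t. indicator {..<\<tau>} t * f t \<partial>lborel)" for \<tau>
    unfolding rl_left_def by (rule Bochner_Integration.integral_cong) (auto simp: rl_kernel_1 indicator_def)
  have "rl_left 1 f a = integral\<^sup>L lborel (\<lambda>_::real. 0)"
    unfolding e by (rule Bochner_Integration.integral_cong) (use supp in \<open>auto simp: indicator_def\<close>)
  moreover have "rl_left 1 f b = integral\<^sup>L lborel f"
    unfolding e
  proof (rule integral_cong_AE)
    show "AE t in lborel. indicator {..<b} t * f t = f t"
      using AE_lborel_singleton[of b] by eventually_elim (use supp in \<open>auto simp: indicator_def not_less\<close>)
  qed measurable
  moreover have "continuous_on {a..b} (rl_left 1 f)" by (rule AC_continuous_on[OF rl_left_1_AC[OF f]])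
  ultimately obtain \<tau> where "a \<le> \<tau>" "\<tau> \<le> b" "rl_left 1 f \<tau> = m"
    using IVT'[of "rl_left 1 f" a m b] m ab by auto
  then show ?thesis using that[of \<tau>] e by simp
qed

context bolza begin

text \<open>
  Weierstrass' excess function of the Lagrangian in the velocity.
\<close>

definition excess :: "real \<Rightarrow> 'e \<Rightarrow> real" where
  "excess t z = \<Lambda> (x t) (u t + z) t - \<Lambda> (x t) (u t) t - velocity_grad t \<bullet> z"

lemma excess_meas [measurable]: "(\<lambda>t. excess t z) \<in> borel_measurable borel"
  unfolding excess_def by measurable

lemma \<Lambda>_linearization_x:
  assumes e: "0 < \<eta>"
  obtains \<rho> where "0 < \<rho>"
    "\<And>t h. \<lbrakk>t \<in> {a..b}; norm h \<le> \<rho>\<rbrakk> \<Longrightarrow> \<bar>\<Lambda> (x t + h) (u t) t - \<Lambda> (x t) (u t) t - state_grad t \<bullet> h\<bar> \<le> \<eta> * norm h"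
proof -
  obtain X where X: "0 < X" "\<And>t. t \<in> {a..b} \<Longrightarrow> norm (x t) \<le> X" "\<And>t. norm (u t) \<le> X" using state_velocity_bound by blast
  let ?K = "cball 0 (X + 1) \<times> cball 0 X \<times> {a..b} :: ('e \<times> 'e \<times> real) set"
  have "uniformly_continuous_on ?K (\<lambda>(y, z, t). A y z t)"
    by (intro compact_uniformly_continuous continuous_on_subset[OF A_cont] compact_Times compact_cball compact_Icc) auto
  then obtain \<rho>0 where \<rho>0: "0 < \<rho>0" and uc: "\<And>p q. p \<in> ?K \<Longrightarrow> q \<in> ?K \<Longrightarrow> dist q p < \<rho>0 \<Longrightarrow>
      dist ((\<lambda>(y, z, t). A y z t) q) ((\<lambda>(y, z, t). A y z t) p) < \<eta>"
    using e unfolding uniformly_continuous_on_def by blast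
  define \<rho> where "\<rho> = min (\<rho>0 / 2) 1"
  have \<rho>: "0 < \<rho>" "\<rho> < \<rho>0" "\<rho> \<le> 1" using \<rho>0 by (auto simp: \<rho>_def min_def)
  show ?thesis
  proof (rule that[OF \<rho>(1)])
    fix t and h :: 'e assume t: "t \<in> {a..b}" and h: "norm h \<le> \<rho>"
    define F where "F y = \<Lambda> y (u t) t - state_grad t \<bullet> y" for y
    have near: "norm (A y (u t) t - state_grad t) \<le> \<eta>" if y: "y \<in> cball (x t) \<rho>" for y
    proof -
      have yx: "norm (y - x t) \<le> \<rho>" using y by (simp add: dist_norm norm_minus_commute)
      have "norm y \<le> norm (x t) + norm (y - x t)" by (rule norm_triangle_sub)
      then have "norm y \<le> X + 1" using yx X(2)[OF t] \<rho>(3) by linarith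
      then have "dist ((\<lambda>(y, z, t). A y z t) (y, u t, t)) ((\<lambda>(y, z, t). A y z t) (x t, u t, t)) < \<eta>"
        using X(2)[OF t] X(3)[of t] t yx \<rho>(2) by (intro uc) (auto simp: dist_Pair_Pair dist_norm)
      then show ?thesis by (simp add: state_grad_def dist_norm)
    qed
    have "norm (F (x t + h) - F (x t)) \<le> \<eta> * norm (x t + h - x t)"
    proof (rule differentiable_bound[where S = "cball (x t) \<rho>"])
      fix y assume y: "y \<in> cball (x t) \<rho>"
      have "((\<lambda>y. (y, u t)) has_derivative (\<lambda>h. (h, 0))) (at y)" by (auto intro!: derivative_eq_intros)
      from has_derivative_compose[OF this \<Lambda>_derivative[of t y "u t"]]
      have "((\<lambda>y. \<Lambda> y (u t) t) has_derivative (\<lambda>h. A y (u t) t \<bullet> h)) (at y)" by simp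
      then have "(F has_derivative (\<lambda>h. (A y (u t) t - state_grad t) \<bullet> h)) (at y)"
        unfolding F_def by (rule has_derivative_eq_rhs[OF has_derivative_diff])
          (auto intro!: derivative_eq_intros simp: fun_eq_iff inner_diff_left)
      then show "(F has_derivative (\<lambda>h. (A y (u t) t - state_grad t) \<bullet> h)) (at y within cball (x t) \<rho>)"
        by (rule has_derivative_at_withinI)
      show "onorm (\<lambda>h. (A y (u t) t - state_grad t) \<bullet> h) \<le> \<eta>"
      proof (rule onorm_bound)
        fix k
        have "norm ((A y (u t) t - state_grad t) \<bullet> k) \<le> norm (A y (u t) t - state_grad t) * norm k"
          by (simp only: real_norm_def Cauchy_Schwarz_ineq2)
        also have "\<dots> \<le> \<eta> * norm k" using near[OF y] by (intro mult_right_mono) auto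
        finally show "norm ((A y (u t) t - state_grad t) \<bullet> k) \<le> \<eta> * norm k" .
      qed (use e in simp)
    qed (use h \<rho>(1) in \<open>auto simp: dist_norm\<close>)
    then show "\<bar>\<Lambda> (x t + h) (u t) t - \<Lambda> (x t) (u t) t - state_grad t \<bullet> h\<bar> \<le> \<eta> * norm h"
      by (simp add: F_def inner_add_right algebra_simps)
  qed
qed

lemma rl_right_weight:
  assumes t: "a \<le> t"
  shows "rl_right \<alpha> weight t = rl_kernel (\<alpha> + \<beta>) (b - t)"
proof -
  have "rl_right \<alpha> weight t = (\<integral>s. rl_kernel \<beta> (b - s) * rl_kernel \<alpha> (s - t) \<partial>lborel)"
    unfolding rl_right_def
  proof (rule Bochner_Integration.integral_cong[OF refl])
    fix s show "rl_kernel \<alpha> (s - t) *\<^sub>R weight s = rl_kernel \<beta> (b - s) * rl_kernel \<alpha> (s - t)"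
      using t by (cases "t < s \<and> s < b") (auto simp: weight_def indicator_def not_less)
  qed
  also have "\<dots> = rl_kernel (\<beta> + \<alpha>) (b - t)"
    by (subst integral_eq_nn_integral) (use \<alpha> \<beta> in \<open>auto simp: rl_kernel_convolution\<close>)
  finally show ?thesis by (simp add: add.commute)
qed

end

context bolza_minimum begin

text \<open>
  Suppose that \<open>N\<close> has positive measure, and let \<open>E \<subseteq> N\<close> have small measure \<open>m0\<close>. The control is \<open>z\<close> on a part of \<open>E\<close> and
  \<open>-z\<close> on the rest, balanced so that the final point stays fixed. On \<open>E\<close> the excess contributes at most \<open>-\<delta> * m0\<close>. The state
  changes by \<open>h\<close>, which is uniformly small by \<open>rl_kernel_small_set\<close>, while the weighted integral of \<open>norm (h t)\<close> is of order \<open>m0\<close> by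
  duality. Beyond its linear part, which the Euler-Lagrange equation removes, the dependence on the state
  therefore contributes at most an arbitrarily small multiple of \<open>m0\<close>, and the cost would decrease. Staying at distance \<open>\<delta>\<close> from \<open>b\<close>
  keeps the weight and its fractional integral bounded.
\<close>

lemma negative_excess_null:
  fixes z :: 'e and m :: nat
  defines "\<delta> \<equiv> 1 / real (Suc m)"
  defines "N \<equiv> {t \<in> {a..b}. \<delta> \<le> b - t \<and> weight t * excess t z \<le> - \<delta> \<and> weight t * excess t (- z) \<le> - \<delta>}"
  shows "emeasure lborel N = 0"
proof (rule ccontr)
  assume pos: "emeasure lborel N \<noteq> 0"
  have \<delta>: "0 < \<delta>" by (simp add: \<delta>_def)
  have N_meas [measurable]: "N \<in> sets borel" unfolding N_def by measurable
  have Nsub: "N \<subseteq> {a..b}" by (auto simp: N_def)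
  have Nfin: "emeasure lborel N < \<infinity>"
    by (rule emeasure_bounded_finite[OF bounded_subset[OF bounded_closed_interval Nsub]])
  then have mN: "0 < measure lborel N" using pos by (simp add: measure_def enn2real_positive_iff zero_less_iff_neq_zero)
  have N_int: "integrable lborel (indicator N :: real \<Rightarrow> real)" using Nfin by (intro integrable_real_indicator) auto
  obtain \<mu> where \<mu>: "AE t in lborel. momentum t = (indicator {a..b} t * rl_kernel \<alpha> (b - t)) *\<^sub>R \<mu>"
    using Euler_Lagrange_integrated by blast
  obtain X where X: "0 < X" "\<And>t. t \<in> {a..b} \<Longrightarrow> norm (x t) \<le> X" "\<And>t. norm (u t) \<le> X" using state_velocity_bound by blast
  obtain C where C: "0 < C"
    "\<And>y q y' q' t. \<lbrakk>norm y \<le> X + norm z + 1; norm q \<le> X + norm z + 1; norm y' \<le> X + norm z + 1; norm q' \<le> X + norm z + 1; t \<in> {a..b}\<rbrakk>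
      \<Longrightarrow> \<bar>\<Lambda> y' q' t - \<Lambda> y q t\<bar> \<le> C * (norm (y' - y) + norm (q' - q)) \<and> norm (A y q t) \<le> C"
    by (rule \<Lambda>_lipschitz) blast
  obtain W where W: "0 < W" "\<And>r. \<delta> \<le> r \<Longrightarrow> r \<le> b - a \<Longrightarrow> rl_kernel \<beta> r \<le> W"
    by (rule rl_kernel_bounded_away[OF \<beta> \<delta>]) blast
  have \<alpha>\<beta>: "0 < \<alpha> + \<beta>" using \<alpha> \<beta> by simp
  obtain W2 where W2: "0 < W2" "\<And>r. \<delta> \<le> r \<Longrightarrow> r \<le> b - a \<Longrightarrow> rl_kernel (\<alpha> + \<beta>) r \<le> W2"
    by (rule rl_kernel_bounded_away[OF \<alpha>\<beta> \<delta>]) blast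
  have wN: "weight t \<le> W" if "t \<in> N" for t using that W(2)[of "b - t"] by (auto simp: N_def weight_def)
  define \<eta> where "\<eta> = \<delta> / (4 * W2 * (norm z + 1))"
  have nz: "0 < norm z + 1" using norm_ge_zero[of z] by linarith
  have \<eta>: "0 < \<eta>" unfolding \<eta>_def using \<delta> W2(1) nz by (intro divide_pos_pos mult_pos_pos) auto
  obtain \<rho>1 where \<rho>1: "0 < \<rho>1" "\<And>t h. \<lbrakk>t \<in> {a..b}; norm h \<le> \<rho>1\<rbrakk> \<Longrightarrow>
      \<bar>\<Lambda> (x t + h) (u t) t - \<Lambda> (x t) (u t) t - state_grad t \<bullet> h\<bar> \<le> \<eta> * norm h"
    by (rule \<Lambda>_linearization_x[OF \<eta>]) blast
  define \<rho> where "\<rho> = min (min \<rho>1 1) (\<delta> / (8 * C * W))"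
  have \<rho>: "0 < \<rho>" "\<rho> \<le> \<rho>1" "\<rho> \<le> 1" "\<rho> \<le> \<delta> / (8 * C * W)" using \<rho>1(1) \<delta> C(1) W(1) by (auto simp: \<rho>_def)
  have \<rho>W: "2 * C * \<rho> * W \<le> \<delta> / 4" using \<rho>(4) C(1) W(1) by (simp add: field_simps)
  have rz: "0 < \<rho> / (norm z + 1)" using \<rho>(1) nz by simp
  obtain d where d: "0 < d" "\<And>E t. \<lbrakk>E \<in> sets borel; E \<subseteq> {a..b}; measure lborel E < d; t \<in> {a..b}\<rbrakk>
       \<Longrightarrow> (\<integral>s. indicator E s * rl_kernel \<alpha> (t - s) \<partial>lborel) < \<rho> / (norm z + 1)"
    by (rule rl_kernel_small_set[OF \<alpha> rz]) blast
  \<comment> \<open>the measure of the piece decides, through \<open>rl_kernel_small_set\<close>, how far the state moves\<close>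
  define m0 where "m0 = min (d / 2) (measure lborel N)"
  have m0: "0 < m0" "m0 < d" "m0 \<le> measure lborel N" using d(1) mN by (auto simp: m0_def min_def)
  obtain \<tau> where \<tau>: "(\<integral>t. indicator {..<\<tau>} t * indicator N t \<partial>lborel) = m0"
    by (rule split_by_primitive[OF N_int _ ab, of m0]) (use Nsub m0 in \<open>auto simp: indicator_def\<close>)
  define E where "E = N \<inter> {..<\<tau>}"
  have E_meas [measurable]: "E \<in> sets borel" unfolding E_def by measurable
  have EN: "E \<subseteq> N" and Esub: "E \<subseteq> {a..b}" using Nsub by (auto simp: E_def)
  have Efin: "emeasure lborel E < \<infinity>"
    by (rule emeasure_bounded_finite[OF bounded_subset[OF bounded_closed_interval Esub]])
  have E_int: "integrable lborel (indicator E :: real \<Rightarrow> real)" using Efin by (intro integrable_real_indicator) auto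
  have mE: "measure lborel E = m0"
  proof -
    have "measure lborel E = integral\<^sup>L lborel (indicator E)" using Efin by simp
    also have "\<dots> = (\<integral>t. indicator {..<\<tau>} t * indicator N t \<partial>lborel)"
      by (rule Bochner_Integration.integral_cong) (auto simp: E_def indicator_def)
    finally show ?thesis using \<tau> by simp
  qed
  \<comment> \<open>the integral of \<open>f\<close> is the effect on the final point of a unit control on \<open>E\<close>; \<open>\<sigma>\<close> halves it\<close>
  define f where "f t = indicator E t * rl_kernel \<alpha> (b - t)" for t
  have f_int: "integrable lborel f"
    by (rule Bochner_Integration.integrable_bound[OF integrable_rl_kernel_Icc(1)[OF \<alpha>, of a b b]])
       (use Esub in \<open>auto simp: f_def[abs_def] indicator_def subset_iff intro!: AE_I2\<close>)
  have f0: "0 \<le> f t" for t using \<alpha> by (simp add: f_def)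
  have fi0: "0 \<le> integral\<^sup>L lborel f" by (rule integral_nonneg_AE) (simp add: f0)
  obtain \<sigma> where \<sigma>: "(\<integral>t. indicator {..<\<sigma>} t * f t \<partial>lborel) = integral\<^sup>L lborel f / 2"
    by (rule split_by_primitive[OF f_int _ ab, of "integral\<^sup>L lborel f / 2"])
       (use Esub fi0 in \<open>auto simp: f_def indicator_def\<close>)
  define sg :: "real \<Rightarrow> real" where "sg t = indicator E t * (2 * indicator {..<\<sigma>} t - 1)" for t
  define v where "v t = sg t *\<^sub>R z" for t
  have sg_meas [measurable]: "sg \<in> borel_measurable borel" unfolding sg_def by measurable
  have sg_abs: "\<bar>sg t\<bar> = indicator E t" for t by (auto simp: sg_def indicator_def)
  have sg_cases: "t \<in> E \<and> (sg t = 1 \<or> sg t = -1) \<or> t \<notin> E \<and> sg t = 0" for t by (auto simp: sg_def indicator_def)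
  have v: "bounded_control a b v"
  proof (rule bounded_controlI)
    show "v \<in> borel_measurable borel" unfolding v_def by measurable
    show "norm (v t) \<le> norm z" for t by (simp add: v_def sg_abs indicator_def)
    show "v t = 0" if "t \<notin> {a..b}" for t using Esub that by (auto simp: v_def sg_def indicator_def)
  qed
  have vm [measurable]: "v \<in> borel_measurable borel" by (rule bounded_control_measurable[OF v])
  have vb: "rl_left \<alpha> v b = 0"
  proof -
    have i: "integrable lborel (\<lambda>t. 2 * (indicator {..<\<sigma>} t * f t))"
      by (rule integrable_mult_right, rule Bochner_Integration.integrable_bound[OF f_int])
         (use f_int f0 in \<open>auto simp: indicator_def\<close>)
    have e: "rl_kernel \<alpha> (b - t) *\<^sub>R v t = (2 * (indicator {..<\<sigma>} t * f t) - f t) *\<^sub>R z" for t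
      by (simp add: v_def sg_def f_def algebra_simps)
    have "(\<integral>t. 2 * (indicator {..<\<sigma>} t * f t) - f t \<partial>lborel) = 0"
      using Bochner_Integration.integral_diff[OF i f_int] \<sigma> by simp
    then show ?thesis unfolding rl_left_def e
      using Bochner_Integration.integrable_diff[OF i f_int] by (subst integral_scaleR_left) auto
  qed
  define h where "h = rl_left \<alpha> v"
  have hm [measurable]: "h \<in> borel_measurable borel" unfolding h_def by measurable
  define e where "e = rl_left \<alpha> (indicator E :: real \<Rightarrow> real)"
  have indE: "bounded_control a b (indicator E :: real \<Rightarrow> real)"
    by (rule bounded_controlI[where C = 1]) (use Esub in \<open>auto simp: indicator_def\<close>)
  have e0: "0 \<le> e t" for t unfolding e_def rl_left_def by (rule integral_nonneg_AE) (use \<alpha> in simp)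
  have he: "norm (h t) \<le> norm z * e t" for t
  proof -
    have "norm (h t) \<le> (\<integral>s. norm (rl_kernel \<alpha> (t - s) *\<^sub>R v s) \<partial>lborel)" unfolding h_def rl_left_def by (rule integral_norm_bound)
    also have "\<dots> = (\<integral>s. norm z * (rl_kernel \<alpha> (t - s) *\<^sub>R indicator E s) \<partial>lborel)"
      by (rule Bochner_Integration.integral_cong) (use \<alpha> in \<open>auto simp: v_def sg_abs abs_mult\<close>)
    also have "\<dots> = norm z * e t" unfolding e_def rl_left_def by (rule integral_mult_right_zero)
    finally show ?thesis .
  qed
  have h\<rho>: "norm (h t) \<le> \<rho>" if t: "t \<in> {a..b}" for t
  proof -
    have "e t = (\<integral>s. indicator E s * rl_kernel \<alpha> (t - s) \<partial>lborel)"
      unfolding e_def rl_left_def by (rule Bochner_Integration.integral_cong) auto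
    also have "\<dots> < \<rho> / (norm z + 1)" by (rule d(2)[OF E_meas Esub _ t]) (use mE m0 in simp)
    finally have "e t * (norm z + 1) \<le> \<rho>" using nz by (simp add: pos_less_divide_eq)
    then show ?thesis using he[of t] e0[of t] by (simp add: algebra_simps)
  qed
  have we: "(\<integral>t. weight t * e t \<partial>lborel) \<le> W2 * m0" and we_int: "integrable lborel (\<lambda>t. weight t * e t)"
  proof -
    note dual = rl_integral_duality[OF \<alpha> weight_integrable weight_outside indE]
    show "integrable lborel (\<lambda>t. weight t * e t)" using dual(2) by (simp add: e_def)
    have "(\<integral>t. weight t * e t \<partial>lborel) = (\<integral>s. rl_right \<alpha> weight s * indicator E s \<partial>lborel)"
      using dual(1) by (simp add: e_def)
    also have "\<dots> \<le> (\<integral>s. W2 * indicator E s \<partial>lborel)"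
    proof (rule integral_mono)
      show "integrable lborel (\<lambda>s. rl_right \<alpha> weight s * indicator E s)" using dual(3) by simp
      show "integrable lborel (\<lambda>s. W2 * indicator E s)" by (rule integrable_mult_right[OF E_int])
      show "rl_right \<alpha> weight s * indicator E s \<le> W2 * indicator E s" for s
      proof (cases "s \<in> E")
        case True
        then have "a \<le> s" "\<delta> \<le> b - s" using EN by (auto simp: N_def)
        then show ?thesis using True W2(2)[of "b - s"] by (simp add: rl_right_weight)
      qed simp
    qed
    also have "\<dots> = W2 * m0" using mE Efin by simp
    finally show "(\<integral>t. weight t * e t \<partial>lborel) \<le> W2 * m0" .
  qed
  \<comment> \<open>the first variation vanishes because the final point is fixed, so it may be subtracted from the increment of the cost\<close>
  let ?g = "\<lambda>t. weight t * \<Lambda> (x t + h t) (u t + v t) t - weight t * \<Lambda> (x t) (u t) t - weight t * (state_grad t \<bullet> h t + velocity_grad t \<bullet> v t)"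
  have i1: "integrable lborel (\<lambda>t. weight t * \<Lambda> (x t + h t) (u t + v t) t)"
  proof (rule cost_integrand_integrable[where M = "max \<rho> (norm z)"])
    show "norm (h t) \<le> max \<rho> (norm z)" if "t \<in> {a..b}" for t using h\<rho>[OF that] by simp
    show "norm (v t) \<le> max \<rho> (norm z)" for t
      by (rule max.coboundedI2) (simp add: v_def sg_abs indicator_def)
  qed measurable
  have i2: "integrable lborel (\<lambda>t. weight t * \<Lambda> (x t) (u t) t)" using cost_integrand_integrable[of "\<lambda>_. 0" "\<lambda>_. 0" 0] by simp
  have i3: "integrable lborel (\<lambda>t. weight t * (state_grad t \<bullet> h t + velocity_grad t \<bullet> v t))"
    unfolding h_def by (rule variation_control(2)[OF v])
  have "0 \<le> cost_integral h v - cost_integral (\<lambda>_. 0) (\<lambda>_. 0) - variation h v"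
    using minimal_fixed_ends[OF v vb] variation_eq_endpoint[OF \<mu> v] vb by (simp add: h_def)
  also have "\<dots> = integral\<^sup>L lborel ?g"
    unfolding cost_integral_def variation_def using i1 i2 i3 by simp
  also have "\<dots> \<le> (\<integral>t. (- 3 / 4 * \<delta>) * indicator E t + \<eta> * norm z * (weight t * e t) \<partial>lborel)"
  proof (rule integral_mono)
    show "integrable lborel ?g" using i1 i2 i3 by (intro Bochner_Integration.integrable_diff)
    show "integrable lborel (\<lambda>t. (- 3 / 4 * \<delta>) * indicator E t + \<eta> * norm z * (weight t * e t))"
      by (intro Bochner_Integration.integrable_add integrable_mult_right E_int we_int)
    fix t
    show "?g t \<le> (- 3 / 4 * \<delta>) * indicator E t + \<eta> * norm z * (weight t * e t)"
    proof (cases "t \<in> {a..b}")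
      case False
      then have "t \<notin> E" using Esub by blast
      then show ?thesis using False by (simp add: weight_outside)
    next
      case tab: True
      show ?thesis
      proof (cases "t \<in> E")
        case False
        then have "v t = 0" by (simp add: v_def sg_def)
        then have "?g t = weight t * (\<Lambda> (x t + h t) (u t) t - \<Lambda> (x t) (u t) t - state_grad t \<bullet> h t)" by (simp add: algebra_simps)
        also have "\<dots> \<le> weight t * (\<eta> * norm (h t))"
          using \<rho>1(2)[OF tab, of "h t"] h\<rho>[OF tab] \<rho>(2) by (intro mult_left_mono) auto
        also have "\<dots> \<le> weight t * (\<eta> * (norm z * e t))" using he \<eta> by (intro mult_left_mono) auto
        finally show ?thesis using False by (simp add: mult_ac)
      next
        case tE: True
        have vz: "v t = z \<or> v t = - z" using sg_cases[of t] tE by (auto simp: v_def)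
        have nv: "norm (v t) = norm z" using vz by auto
        have "norm (x t) \<le> X + norm z + 1" "norm (u t) \<le> X + norm z + 1"
          using X(2)[OF tab] X(3)[of t] norm_ge_zero[of z] by linarith+
        moreover have "norm (x t + h t) \<le> X + norm z + 1"
          using norm_triangle_ineq[of "x t" "h t"] X(2)[OF tab] h\<rho>[OF tab] \<rho>(3) norm_ge_zero[of z] by linarith
        moreover have "norm (u t + v t) \<le> X + norm z + 1"
          using norm_triangle_ineq[of "u t" "v t"] X(3)[of t] nv by linarith
        ultimately have L: "\<bar>\<Lambda> (x t + h t) (u t + v t) t - \<Lambda> (x t) (u t + v t) t\<bar> \<le> C * norm (h t)"
          and nA: "norm (state_grad t) \<le> C"
          using C(2)[of "x t" "u t + v t" "x t + h t" "u t + v t" t] C(2)[of "x t" "u t" "x t" "u t" t] tab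
          by (auto simp: state_grad_def)
        have "\<bar>state_grad t \<bullet> h t\<bar> \<le> norm (state_grad t) * norm (h t)" by (rule Cauchy_Schwarz_ineq2)
        also have "\<dots> \<le> C * norm (h t)" using nA by (intro mult_right_mono) auto
        finally have "\<Lambda> (x t + h t) (u t + v t) t - \<Lambda> (x t) (u t + v t) t - state_grad t \<bullet> h t \<le> 2 * (C * norm (h t))"
          using L by linarith
        also have "\<dots> \<le> 2 * C * \<rho>" using h\<rho>[OF tab] C(1) by (simp add: mult_left_mono)
        finally have "weight t * (\<Lambda> (x t + h t) (u t + v t) t - \<Lambda> (x t) (u t + v t) t - state_grad t \<bullet> h t) \<le> weight t * (2 * C * \<rho>)"
          by (rule mult_left_mono) simp
        also have "\<dots> \<le> W * (2 * C * \<rho>)" using wN[of t] tE EN C(1) \<rho>(1) by (intro mult_right_mono) auto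
        also have "\<dots> \<le> \<delta> / 4" using \<rho>W by (simp add: mult.commute mult.left_commute)
        finally have 1: "weight t * (\<Lambda> (x t + h t) (u t + v t) t - \<Lambda> (x t) (u t + v t) t - state_grad t \<bullet> h t) \<le> \<delta> / 4" .
        have 2: "weight t * excess t (v t) \<le> - \<delta>" using vz tE EN by (auto simp: N_def)
        have "?g t = weight t * (\<Lambda> (x t + h t) (u t + v t) t - \<Lambda> (x t) (u t + v t) t - state_grad t \<bullet> h t) + weight t * excess t (v t)"
          by (simp add: excess_def algebra_simps)
        then have "?g t \<le> - 3 / 4 * \<delta>" using 1 2 by linarith
        moreover have "0 \<le> \<eta> * norm z * (weight t * e t)" using \<eta> e0 by simp
        ultimately show ?thesis using tE by simp
      qed
    qed
  qed
  also have "\<dots> = (- 3 / 4 * \<delta>) * m0 + \<eta> * norm z * (\<integral>t. weight t * e t \<partial>lborel)"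
    using E_int we_int mE Efin by (subst Bochner_Integration.integral_add) auto
  also have "\<dots> \<le> (- 3 / 4 * \<delta>) * m0 + \<eta> * norm z * (W2 * m0)"
    using we \<eta> by (intro add_left_mono mult_left_mono) auto
  also have "\<eta> * norm z * (W2 * m0) \<le> \<delta> / 4 * m0"
  proof -
    have "\<eta> * norm z * W2 \<le> \<eta> * (norm z + 1) * W2" using \<eta> W2(1) by (intro mult_right_mono mult_left_mono) auto
    also have "\<dots> = \<delta> / 4" using W2(1) nz by (simp add: \<eta>_def)
    finally have "\<eta> * norm z * W2 * m0 \<le> \<delta> / 4 * m0" by (rule mult_right_mono) (use m0 in simp)
    then show ?thesis by (simp add: mult.assoc)
  qed
  also have "(- 3 / 4 * \<delta>) * m0 + \<delta> / 4 * m0 = - (\<delta> * m0) / 2" by simp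
  finally have "\<delta> * m0 \<le> 0" by simp
  then show False using \<delta> m0(1) by (simp add: mult_le_0_iff)
qed

text \<open>
  The excess is continuous in \<open>z\<close>, so a countable dense set of vectors suffices, and each of these excludes a null set of times.
\<close>

proposition Weierstrass_two_sided:
  "AE t in lborel. t \<in> {a..b} \<longrightarrow> (\<forall>z. 0 \<le> excess t z \<or> 0 \<le> excess t (- z))"
proof -
  obtain D :: "'e set" where D: "countable D" "\<And>S. open S \<Longrightarrow> S \<noteq> {} \<Longrightarrow> \<exists>d\<in>D. d \<in> S"
    using countable_dense_setE by blast
  have "AE t in lborel. \<forall>z\<in>D. \<forall>m. \<not> (t \<in> {a..b} \<and> 1 / real (Suc m) \<le> b - t \<and>
      weight t * excess t z \<le> - (1 / real (Suc m)) \<and> weight t * excess t (- z) \<le> - (1 / real (Suc m)))"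
    unfolding AE_ball_countable[OF D(1)] AE_all_countable
  proof (intro ballI allI)
    fix z :: 'e and m :: nat
    have "{t \<in> {a..b}. 1 / real (Suc m) \<le> b - t \<and> weight t * excess t z \<le> - (1 / real (Suc m)) \<and>
       weight t * excess t (- z) \<le> - (1 / real (Suc m))} \<in> null_sets lborel"
      using negative_excess_null[of m z] by (intro null_setsI) measurable
    from AE_not_in[OF this]
    show "AE t in lborel. \<not> (t \<in> {a..b} \<and> 1 / real (Suc m) \<le> b - t \<and>
      weight t * excess t z \<le> - (1 / real (Suc m)) \<and> weight t * excess t (- z) \<le> - (1 / real (Suc m)))"
      by eventually_elim simp
  qed
  with AE_lborel_singleton[of b] show ?thesis
  proof eventually_elim
    case (elim t)
    show ?case
    proof (intro impI allI, rule ccontr)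
      fix z assume t: "t \<in> {a..b}" and "\<not> (0 \<le> excess t z \<or> 0 \<le> excess t (- z))"
      then have z: "excess t z < 0" "excess t (- z) < 0" by auto
      have "continuous_on UNIV (\<lambda>z. \<Lambda> (x t) (u t + z) t)"
      proof -
        have "continuous_on UNIV (\<lambda>z. (x t, u t + z, t))" by (intro continuous_intros)
        from continuous_on_compose2[OF \<Lambda>_cont this] show ?thesis by simp
      qed
      then have ec: "continuous_on UNIV (excess t)" unfolding excess_def by (intro continuous_intros)
      then have ec': "continuous_on UNIV (\<lambda>z. excess t (- z))"
        by (rule continuous_on_compose2) (auto intro: continuous_intros)
      have "open {z. excess t z < 0 \<and> excess t (- z) < 0}"
        by (intro open_Collect_conj open_Collect_less ec ec' continuous_intros)
      moreover have "z \<in> {z. excess t z < 0 \<and> excess t (- z) < 0}" using z by simp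
      ultimately obtain d where d: "d \<in> D" "excess t d < 0" "excess t (- d) < 0" using D(2) by blast
      have tb: "t < b" using t elim(1) by auto
      then have wp: "0 < weight t" using t rl_kernel_pos[OF \<beta>, of "b - t"] by (simp add: weight_def)
      \<comment> \<open>strict inequalities at \<open>t\<close> hold with a margin \<open>1 / Suc m\<close>, which puts \<open>t\<close> into one of the countably many null sets\<close>
      let ?q = "min (b - t) (min (- (weight t * excess t d)) (- (weight t * excess t (- d))))"
      have "0 < ?q" using tb wp d by (simp add: mult_pos_neg)
      then obtain m where "inverse (real (Suc m)) < ?q" using reals_Archimedean by blast
      then have "1 / real (Suc m) < ?q" by (simp add: inverse_eq_divide)
      then have "1 / real (Suc m) \<le> b - t" "weight t * excess t d \<le> - (1 / real (Suc m))"
        "weight t * excess t (- d) \<le> - (1 / real (Suc m))" by linarith+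
      then show False using elim(2) d(1) t by blast
    qed
  qed
qed

end

section \<open>Continuous representatives and Caputo perturbations\<close>

lemma AE_lebesgue_on_Icc:
  "(AE t in lebesgue_on {a..b::real}. P t) \<longleftrightarrow> (AE t in lborel. t \<in> {a..b} \<longrightarrow> P t)"
  by (subst AE_restrict_space_iff) (auto simp: AE_completion_iff)

lemma negligible_AE_Icc:
  assumes "negligible {t \<in> {a..b::real}. \<not> P t}"
  shows "AE t in lborel. t \<in> {a..b} \<longrightarrow> P t"
proof -
  have "{t \<in> {a..b}. \<not> P t} \<in> null_sets lebesgue" using assms by (simp add: negligible_iff_null_sets)
  then have "AE t in lebesgue. t \<notin> {t \<in> {a..b}. \<not> P t}" by (rule AE_not_in)
  then have "AE t in lborel. t \<notin> {t \<in> {a..b}. \<not> P t}" by (simp only: AE_completion_iff)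
  then show ?thesis by (rule AE_mp) simp
qed

lemma integral_lebesgue_on_eq:
  fixes f G :: "real \<Rightarrow> 'a::euclidean_space"
  assumes S: "S \<in> sets lebesgue" and G: "G \<in> borel_measurable borel"
    and eq: "AE s in lborel. indicator S s *\<^sub>R f s = G s"
  shows "integral\<^sup>L (lebesgue_on S) f = integral\<^sup>L lborel G"
    and "f \<in> borel_measurable (lebesgue_on S)"
    and "integrable (lebesgue_on S) f \<longleftrightarrow> integrable lborel G"
proof -
  have Gl: "G \<in> borel_measurable lebesgue" using G by (intro measurable_completion) simp
  have ae: "AE s in lebesgue. G s = indicator S s *\<^sub>R f s"
    by (rule AE_completion) (use eq in \<open>auto elim: eventually_mono\<close>)
  then have m: "(\<lambda>s. indicator S s *\<^sub>R f s) \<in> borel_measurable lebesgue"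
    by (rule borel_measurable_AE[OF Gl])
  have "integral\<^sup>L (lebesgue_on S) f = integral\<^sup>L lebesgue (\<lambda>s. indicator S s *\<^sub>R f s)"
    by (rule integral_restrict_space) (use S in simp)
  also have "\<dots> = integral\<^sup>L lebesgue G"
    by (rule integral_cong_AE[OF m Gl]) (use ae in \<open>auto elim: eventually_mono\<close>)
  also have "\<dots> = integral\<^sup>L lborel G" by (rule integral_completion) (use G in simp)
  finally show "integral\<^sup>L (lebesgue_on S) f = integral\<^sup>L lborel G" .
  show "f \<in> borel_measurable (lebesgue_on S)"
    using m S by (simp add: borel_measurable_restrict_space_iff)
  have "integrable (lebesgue_on S) f \<longleftrightarrow> integrable lebesgue (\<lambda>s. indicator S s *\<^sub>R f s)"
    by (rule integrable_restrict_space) (use S in simp)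
  also have "\<dots> \<longleftrightarrow> integrable lebesgue G"
    by (rule integrable_cong_AE[OF m Gl]) (use ae in \<open>auto elim: eventually_mono\<close>)
  also have "\<dots> \<longleftrightarrow> integrable lborel G" by (rule integrable_completion) (use G in simp)
  finally show "integrable (lebesgue_on S) f \<longleftrightarrow> integrable lborel G" .
qed

text \<open>
  The fractional integrals before the passage to continuous representatives.
\<close>

definition frac_integral_left :: "real \<Rightarrow> real \<Rightarrow> (real \<Rightarrow> 'a::euclidean_space) \<Rightarrow> real \<Rightarrow> 'a" where
  "frac_integral_left a \<gamma> f t = (if \<gamma> = 0 then f t
     else integral\<^sup>L (lebesgue_on {a..t}) (\<lambda>s. ((t - s) powr (\<gamma> - 1) / Gamma \<gamma>) *\<^sub>R f s))"

definition frac_integral_right :: "real \<Rightarrow> real \<Rightarrow> (real \<Rightarrow> 'a::euclidean_space) \<Rightarrow> real \<Rightarrow> 'a" where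
  "frac_integral_right b \<gamma> f t = (if \<gamma> = 0 then f t
     else integral\<^sup>L (lebesgue_on {t..b}) (\<lambda>s. ((s - t) powr (\<gamma> - 1) / Gamma \<gamma>) *\<^sub>R f s))"

lemma frac_int_left_cont_rep: "frac_int_left a b \<gamma> f = cont_rep a b (frac_integral_left a \<gamma> f)"
  by (simp add: frac_int_left_def frac_integral_left_def[abs_def])

lemma frac_int_right_cont_rep: "frac_int_right a b \<gamma> f = cont_rep a b (frac_integral_right b \<gamma> f)"
  by (simp add: frac_int_right_def frac_integral_right_def[abs_def])

lemma frac_integral_left_eq:
  fixes f g :: "real \<Rightarrow> 'a::euclidean_space"
  assumes g: "0 < \<gamma>" and m [measurable]: "g \<in> borel_measurable borel"
    and supp: "\<And>s. s \<notin> {a..b} \<Longrightarrow> g s = 0"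
    and eq: "AE s in lborel. s \<in> {a..b} \<longrightarrow> f s = g s" and t: "t \<in> {a..b}"
  shows "frac_integral_left a \<gamma> f t = rl_left \<gamma> g t"
proof -
  have "integral\<^sup>L (lebesgue_on {a..t}) (\<lambda>s. ((t - s) powr (\<gamma> - 1) / Gamma \<gamma>) *\<^sub>R f s) =
      integral\<^sup>L lborel (\<lambda>s. rl_kernel \<gamma> (t - s) *\<^sub>R g s)"
  proof (rule integral_lebesgue_on_eq(1))
    show "AE s in lborel. indicator {a..t} s *\<^sub>R (((t - s) powr (\<gamma> - 1) / Gamma \<gamma>) *\<^sub>R f s) = rl_kernel \<gamma> (t - s) *\<^sub>R g s"
      using eq AE_lborel_singleton[of t]
    proof eventually_elim
      case (elim s)
      then show ?case using t supp[of s]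
        by (cases "a \<le> s"; cases "s < t") (auto simp: rl_kernel_def indicator_def)
    qed
  qed auto
  then show ?thesis using g by (simp add: frac_integral_left_def rl_left_def)
qed

lemma frac_integral_right_eq:
  fixes f g :: "real \<Rightarrow> 'a::euclidean_space"
  assumes g: "0 < \<gamma>" and m [measurable]: "g \<in> borel_measurable borel"
    and supp: "\<And>s. s \<notin> {a..b} \<Longrightarrow> g s = 0"
    and eq: "AE s in lborel. s \<in> {a..b} \<longrightarrow> f s = g s" and t: "t \<in> {a..b}"
  shows "frac_integral_right b \<gamma> f t = rl_right \<gamma> g t"
proof -
  have "integral\<^sup>L (lebesgue_on {t..b}) (\<lambda>s. ((s - t) powr (\<gamma> - 1) / Gamma \<gamma>) *\<^sub>R f s) =
      integral\<^sup>L lborel (\<lambda>s. rl_kernel \<gamma> (s - t) *\<^sub>R g s)"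
  proof (rule integral_lebesgue_on_eq(1))
    show "AE s in lborel. indicator {t..b} s *\<^sub>R (((s - t) powr (\<gamma> - 1) / Gamma \<gamma>) *\<^sub>R f s) = rl_kernel \<gamma> (s - t) *\<^sub>R g s"
      using eq AE_lborel_singleton[of t]
    proof eventually_elim
      case (elim s)
      then show ?case using t supp[of s]
        by (cases "s \<le> b"; cases "t < s") (auto simp: rl_kernel_def indicator_def)
    qed
  qed auto
  then show ?thesis using g by (simp add: frac_integral_right_def rl_right_def)
qed

text \<open>
  The set where two continuous functions differ contains an interval of positive length as soon as it is not empty.
\<close>

lemma continuous_AE_eq_imp_eq:
  fixes h k :: "real \<Rightarrow> 'a::euclidean_space"
  assumes ab: "a < b" and h: "continuous_on {a..b} h" and k: "continuous_on {a..b} k"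
    and ae: "AE t in lborel. t \<in> {a..b} \<longrightarrow> h t = k t" and t: "t \<in> {a..b}"
  shows "h t = k t"
proof (rule ccontr)
  assume ne: "h t \<noteq> k t"
  have "continuous_on {a..b} (\<lambda>s. norm (h s - k s))" by (intro continuous_intros h k)
  moreover have "0 < norm (h t - k t)" using ne by simp
  ultimately obtain d where d: "0 < d" "\<And>s. s \<in> {a..b} \<Longrightarrow> dist s t < d \<Longrightarrow> dist (norm (h s - k s)) (norm (h t - k t)) < norm (h t - k t)"
    using t unfolding continuous_on_iff by blast
  have ne': "h s \<noteq> k s" if "s \<in> {a..b}" "dist s t < d" for s using d(2)[OF that] by (auto simp: dist_real_def)
  define l where "l = max a (t - d / 2)"
  define r where "r = min b (t + d / 2)"
  have lr: "l < r" using t d(1) ab by (auto simp: l_def r_def)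
  have sub: "s \<in> {a..b} \<and> dist s t < d" if "s \<in> {l..r}" for s
    using that t d(1) by (auto simp: l_def r_def dist_real_def)
  have "AE s in lborel. s \<notin> {l..r}"
    using ae by eventually_elim (use sub ne' in blast)
  then have "{l..r} \<in> null_sets lborel" by (subst AE_iff_null_sets) auto
  then show False using lr by (simp add: null_sets_def)
qed

lemma is_cont_rep_AE:
  "is_cont_rep a b f h \<longleftrightarrow> continuous_on {a..b} h \<and> (AE t in lborel. t \<in> {a..b} \<longrightarrow> f t = h t)"
  by (simp add: is_cont_rep_def AE_lebesgue_on_Icc)

lemma cont_rep_eq:
  assumes ab: "a < b" and h: "is_cont_rep a b f h" and t: "t \<in> {a..b}"
  shows "cont_rep a b f t = h t"
proof -
  have ex: "\<exists>h. is_cont_rep a b f h" using h by (intro exI[of _ h])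
  then have "is_cont_rep a b f (cont_rep a b f)" using someI_ex[OF ex] by (simp add: cont_rep_def)
  then have c: "continuous_on {a..b} (cont_rep a b f)" "AE t in lborel. t \<in> {a..b} \<longrightarrow> f t = cont_rep a b f t"
    by (simp_all add: is_cont_rep_AE)
  have h': "continuous_on {a..b} h" "AE t in lborel. t \<in> {a..b} \<longrightarrow> f t = h t" using h by (simp_all add: is_cont_rep_AE)
  have "AE t in lborel. t \<in> {a..b} \<longrightarrow> cont_rep a b f t = h t"
    using c(2) h'(2) by eventually_elim auto
  then show ?thesis using continuous_AE_eq_imp_eq[OF ab c(1) h'(1)] t by blast
qed

text \<open>
  When no continuous representative exists, \<open>cont_rep\<close> returns its argument; if the result is continuous, the
  argument represents itself.
\<close>

lemma is_cont_rep_cont_rep: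
  assumes "continuous_on {a..b} (cont_rep a b f)"
  shows "is_cont_rep a b f (cont_rep a b f)"
proof (cases "\<exists>h. is_cont_rep a b f h")
  case True
  then show ?thesis using someI_ex[OF True] by (simp add: cont_rep_def)
next
  case False
  then have "cont_rep a b f = f" by (simp add: cont_rep_def)
  then show ?thesis using assms by (simp add: is_cont_rep_AE)
qed

text \<open>
  The integrals over the line use Borel functions, so Lebesgue measurable functions are replaced by Borel versions,
  one coordinate at a time.
\<close>

lemma lebesgue_on_ex_borel:
  fixes f :: "real \<Rightarrow> 'a::euclidean_space"
  assumes "f \<in> borel_measurable (lebesgue_on {a..b})"
  obtains g where "g \<in> borel_measurable borel" "AE t in lborel. t \<in> {a..b} \<longrightarrow> f t = g t"
proof -
  have "(\<lambda>s. indicator {a..b} s *\<^sub>R f s) \<in> borel_measurable lebesgue"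
    using assms by (simp add: borel_measurable_restrict_space_iff)
  then have m: "(\<lambda>s. (indicator {a..b} s *\<^sub>R f s) \<bullet> i) \<in> borel_measurable lebesgue" for i
    by (intro borel_measurable_inner) auto
  have "\<exists>g. g \<in> borel_measurable borel \<and> (AE s in lborel. (indicator {a..b} s *\<^sub>R f s) \<bullet> i = g s)" for i
    using completion_ex_borel_measurable_real[OF m[of i]] by auto
  then obtain g where g: "\<And>i. g i \<in> borel_measurable borel"
     "\<And>i. AE s in lborel. (indicator {a..b} s *\<^sub>R f s) \<bullet> i = g i s" by metis
  show ?thesis
  proof (rule that[of "\<lambda>s. \<Sum>i\<in>Basis. g i s *\<^sub>R i"])
    show "(\<lambda>s. \<Sum>i\<in>Basis. g i s *\<^sub>R i) \<in> borel_measurable borel" using g(1) by measurable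
    have "AE s in lborel. \<forall>i\<in>Basis. (indicator {a..b} s *\<^sub>R f s) \<bullet> i = g i s"
      using g(2) by (intro AE_finite_allI) auto
    then show "AE t in lborel. t \<in> {a..b} \<longrightarrow> f t = (\<Sum>i\<in>Basis. g i t *\<^sub>R i)"
    proof eventually_elim
      case (elim s)
      show ?case
      proof
        assume "s \<in> {a..b}"
        then have "\<forall>i\<in>Basis. f s \<bullet> i = g i s" using elim by simp
        then have "(\<Sum>i\<in>Basis. g i s *\<^sub>R i) = (\<Sum>i\<in>Basis. (f s \<bullet> i) *\<^sub>R i)" by (intro sum.cong) auto
        then show "f s = (\<Sum>i\<in>Basis. g i s *\<^sub>R i)" by (simp add: euclidean_representation)
      qed
    qed
  qed
qed

lemma Linfty_ex_bounded_borel: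
  fixes f :: "real \<Rightarrow> 'a::euclidean_space"
  assumes "f \<in> Linfty a b"
  obtains g where "g \<in> borel_measurable borel" "bounded (range g)" "AE t in lborel. t \<in> {a..b} \<longrightarrow> f t = g t"
proof -
  obtain C where C: "AE t in lborel. t \<in> {a..b} \<longrightarrow> norm (f t) \<le> C" and m: "f \<in> borel_measurable (lebesgue_on {a..b})"
    using assms by (auto simp: Linfty_def AE_lebesgue_on_Icc)
  obtain g where g [measurable]: "g \<in> borel_measurable borel" and ae: "AE t in lborel. t \<in> {a..b} \<longrightarrow> f t = g t"
    using lebesgue_on_ex_borel[OF m] by blast
  let ?g = "\<lambda>t. if norm (g t) \<le> C then g t else 0"
  show ?thesis
  proof (rule that[of ?g])
    show "?g \<in> borel_measurable borel" by measurable
    show "bounded (range ?g)" unfolding bounded_iff by (intro exI[of _ "max C 0"]) auto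
    show "AE t in lborel. t \<in> {a..b} \<longrightarrow> f t = ?g t" using ae C by eventually_elim auto
  qed
qed

lemma Linfty_I:
  fixes f :: "real \<Rightarrow> 'a::euclidean_space"
  assumes "g \<in> borel_measurable borel" "bounded (range g)" "AE t in lborel. t \<in> {a..b} \<longrightarrow> f t = g t"
  shows "f \<in> Linfty a b"
proof -
  obtain C where C: "\<And>t. norm (g t) \<le> C" using assms(2) by (auto simp: bounded_iff)
  have [measurable]: "g \<in> borel_measurable borel" by fact
  have "f \<in> borel_measurable (lebesgue_on {a..b})"
  proof (rule integral_lebesgue_on_eq(2))
    show "(\<lambda>t. indicator {a..b} t *\<^sub>R g t) \<in> borel_measurable borel" by measurable
    show "AE s in lborel. indicator {a..b} s *\<^sub>R f s = indicator {a..b} s *\<^sub>R g s"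
      using assms(3) by eventually_elim (auto simp: indicator_def)
  qed simp
  moreover have "AE t in lborel. t \<in> {a..b} \<longrightarrow> norm (f t) \<le> C" using assms(3) by eventually_elim (use C in auto)
  ultimately show ?thesis by (auto simp: Linfty_def AE_lebesgue_on_Icc)
qed

lemma bounded_control_restrict_continuous:
  fixes f :: "real \<Rightarrow> 'a::euclidean_space"
  assumes f: "continuous_on {a..b} f"
  shows "bounded_control a b (\<lambda>s. indicator {a..b} s *\<^sub>R f s)"
proof -
  have "bounded (f ` {a..b})" by (intro compact_imp_bounded compact_continuous_image f) auto
  then obtain C where C: "0 < C" "\<And>s. s \<in> {a..b} \<Longrightarrow> norm (f s) \<le> C" unfolding bounded_pos by blast
  show ?thesis
  proof (rule bounded_controlI)
    show "(\<lambda>s. indicator {a..b} s *\<^sub>R f s) \<in> borel_measurable borel"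
      by (rule borel_measurable_continuous_on_indicator[OF _ f]) simp
    show "norm (indicator {a..b} s *\<^sub>R f s) \<le> C" for s using C by (auto simp: indicator_def)
    show "indicator {a..b} s *\<^sub>R f s = 0" if "s \<notin> {a..b}" for s using that by simp
  qed
qed

lemma frac_integral_left_caputo_add:
  fixes f v :: "real \<Rightarrow> 'a::euclidean_space"
  assumes \<alpha>: "0 < \<alpha>" "\<alpha> \<le> 1" and f: "continuous_on {a..b} f" and v: "bounded_control a b v" and t: "t \<in> {a..b}"
  shows "frac_integral_left a (1 - \<alpha>) (\<lambda>s. f s + rl_left \<alpha> v s) t = frac_integral_left a (1 - \<alpha>) f t + rl_left 1 v t"
proof (cases "\<alpha> = 1")
  case True then show ?thesis by (simp add: frac_integral_left_def)
next
  case False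
  then have a1: "0 < 1 - \<alpha>" "\<alpha> < 1" using \<alpha> by auto
  let ?f = "\<lambda>s. indicator {a..b} s *\<^sub>R f s" and ?e = "\<lambda>s. indicator {a..b} s *\<^sub>R rl_left \<alpha> v s"
  have bf: "bounded_control a b ?f" by (rule bounded_control_restrict_continuous[OF f])
  have be: "bounded_control a b ?e" by (rule bounded_control_restrict_continuous[OF rl_left_continuous[OF \<alpha>(1) v]])
  note [measurable] = bounded_control_measurable[OF bf] bounded_control_measurable[OF be]
  have "frac_integral_left a (1 - \<alpha>) (\<lambda>s. f s + rl_left \<alpha> v s) t = rl_left (1 - \<alpha>) (\<lambda>s. ?f s + ?e s) t"
  proof (rule frac_integral_left_eq[OF a1(1) _ _ _ t])
    show "(\<lambda>s. ?f s + ?e s) \<in> borel_measurable borel" by (rule borel_measurable_add) measurable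
  qed auto
  also have "\<dots> = rl_left (1 - \<alpha>) ?f t + rl_left (1 - \<alpha>) ?e t" by (rule rl_left_add[OF a1(1) bf be])
  also have "rl_left (1 - \<alpha>) ?f t = frac_integral_left a (1 - \<alpha>) f t"
  proof (rule frac_integral_left_eq[OF a1(1) _ _ _ t, symmetric])
    show "?f \<in> borel_measurable borel" by measurable
  qed auto
  also have "rl_left (1 - \<alpha>) ?e t = rl_left (1 - \<alpha>) (rl_left \<alpha> v) t"
    unfolding rl_left_def[of "1 - \<alpha>"]
  proof (rule Bochner_Integration.integral_cong[OF refl])
    fix s
    show "rl_kernel (1 - \<alpha>) (t - s) *\<^sub>R ?e s = rl_kernel (1 - \<alpha>) (t - s) *\<^sub>R rl_left \<alpha> v s"
      using t rl_left_start[OF v, of s \<alpha>] by (cases "s \<le> a"; cases "s < t") (auto simp: indicator_def)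
  qed
  also have "\<dots> = rl_left 1 v t" by (rule rl_left_semigroup(1)[OF \<alpha>(1) a1(2) integrable_bounded_control[OF v]])
  finally show ?thesis .
qed

text \<open>
  By the semigroup law, adding the fractional integral of \<open>v\<close> to the state adds an ordinary primitive \<open>V\<close> of \<open>v\<close> to the
  absolutely continuous function \<open>F\<close> whose derivative is the Caputo derivative. Where \<open>F\<close> and \<open>V\<close> are both
  differentiable, the derivatives add up.
\<close>

proposition caputo_perturbation:
  fixes x v :: "real \<Rightarrow> 'a::euclidean_space" and c :: 'a
  assumes ab: "a < b" and \<alpha>: "0 < \<alpha>" "\<alpha> \<le> 1" and x: "x \<in> caputo_AC_Linfty a b \<alpha>"
    and u: "u \<in> borel_measurable borel" "bounded (range u)" "AE t in lborel. t \<in> {a..b} \<longrightarrow> caputo_deriv a b \<alpha> x t = u t"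
    and v: "bounded_control a b v"
  defines "X \<equiv> \<lambda>t. x t + (c + rl_left \<alpha> v t)"
  shows "X \<in> caputo_AC_Linfty a b \<alpha>"
    and "AE t in lborel. t \<in> {a..b} \<longrightarrow> caputo_deriv a b \<alpha> X t = u t + v t"
    and "X a = x a + c"
proof -
  have xc: "continuous_on {a..b} x" and xAC: "frac_int_left a b (1 - \<alpha>) (\<lambda>t. x t - x a) \<in> AC a b"
    using x by (auto simp: caputo_AC_Linfty_def caputo_AC_def AC_left_def)
  show Xa: "X a = x a + c" by (simp add: X_def rl_left_start[OF v])
  have XX: "(\<lambda>t. X t - X a) = (\<lambda>t. (x t - x a) + rl_left \<alpha> v t)" unfolding Xa by (auto simp: X_def)
  have Xc: "continuous_on {a..b} X" unfolding X_def by (intro continuous_intros xc rl_left_continuous \<alpha> v)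
  define F where "F = frac_int_left a b (1 - \<alpha>) (\<lambda>t. x t - x a)"
  define V where "V = rl_left 1 v"
  have iv: "integrable lborel v" by (rule integrable_bounded_control[OF v])
  have F_AC: "F \<in> AC a b" using xAC by (simp add: F_def)
  have V_AC: "V \<in> AC a b" unfolding V_def by (rule rl_left_1_AC[OF iv])
  have FV: "(\<lambda>t. F t + V t) \<in> AC a b" by (rule AC_add[OF F_AC V_AC])
  have Frep: "is_cont_rep a b (frac_integral_left a (1 - \<alpha>) (\<lambda>t. x t - x a)) F"
    unfolding F_def frac_int_left_cont_rep
    by (rule is_cont_rep_cont_rep) (rule AC_continuous_on[OF xAC[unfolded frac_int_left_cont_rep]])
  have raw: "frac_integral_left a (1 - \<alpha>) (\<lambda>t. X t - X a) t = frac_integral_left a (1 - \<alpha>) (\<lambda>t. x t - x a) t + V t"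
    if "t \<in> {a..b}" for t
    unfolding XX V_def by (rule frac_integral_left_caputo_add[OF \<alpha> _ v that]) (intro continuous_intros xc)
  have "AE t in lborel. t \<in> {a..b} \<longrightarrow> frac_integral_left a (1 - \<alpha>) (\<lambda>t. x t - x a) t = F t"
    using Frep by (simp add: is_cont_rep_AE)
  then have "AE t in lborel. t \<in> {a..b} \<longrightarrow> frac_integral_left a (1 - \<alpha>) (\<lambda>t. X t - X a) t = F t + V t"
    by eventually_elim (use raw in auto)
  then have rep: "is_cont_rep a b (frac_integral_left a (1 - \<alpha>) (\<lambda>t. X t - X a)) (\<lambda>t. F t + V t)"
    using AC_continuous_on[OF FV] by (simp add: is_cont_rep_AE)
  define G where "G = frac_int_left a b (1 - \<alpha>) (\<lambda>t. X t - X a)"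
  have G: "G t = F t + V t" if "t \<in> {a..b}" for t
    unfolding G_def frac_int_left_cont_rep by (rule cont_rep_eq[OF ab rep that])
  have G_AC: "G \<in> AC a b" by (rule AC_same_increments[OF FV]) (use G in auto)
  have Xint: "integrable (lebesgue_on {a..b}) (\<lambda>t. X t - X a)"
    by (intro continuous_imp_integrable_real continuous_intros Xc) 
  have cap: "X \<in> caputo_AC a b \<alpha>"
    using Xc Xint G_AC by (simp add: caputo_AC_def AC_left_def G_def)
  have dF: "AE t in lborel. t \<in> {a..b} \<longrightarrow> (\<exists>D. (F has_vector_derivative D) (at t within {a..b}))"
    by (rule negligible_AE_Icc[OF AC_has_vector_derivative_ae[OF F_AC ab]])
  have dV: "AE t in lborel. t \<in> {a..b} \<longrightarrow> (V has_vector_derivative v t) (at t within {a..b})"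
    unfolding V_def by (rule negligible_AE_Icc[OF rl_left_1_has_vector_derivative_ae[OF iv ab]])
  show der: "AE t in lborel. t \<in> {a..b} \<longrightarrow> caputo_deriv a b \<alpha> X t = u t + v t"
    using dF dV u(3)
  proof eventually_elim
    case (elim t)
    show ?case
    proof
      assume t: "t \<in> {a..b}"
      obtain D where D: "(F has_vector_derivative D) (at t within {a..b})" using elim t by blast
      have vd: "vector_derivative F (at t within {a..b}) = D"
        using vector_derivative_within_cbox[of a b t F D] ab t D by simp
      have "caputo_deriv a b \<alpha> x t = D"
        by (simp add: caputo_deriv_def frac_deriv_left_def F_def[symmetric] vd)
      then have uD: "u t = D" using elim t by simp
      have "((\<lambda>t. F t + V t) has_vector_derivative (D + v t)) (at t within {a..b})"
        using D elim t by (intro has_vector_derivative_add) auto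
      then have "(G has_vector_derivative (D + v t)) (at t within {a..b})"
        using has_vector_derivative_transform[OF t G] by simp
      then have "vector_derivative G (at t within {a..b}) = D + v t"
        using vector_derivative_within_cbox[of a b t G "D + v t"] ab t by simp
      then show "caputo_deriv a b \<alpha> X t = u t + v t"
        by (simp add: caputo_deriv_def frac_deriv_left_def G_def[symmetric] uD)
    qed
  qed
  have "caputo_deriv a b \<alpha> X \<in> Linfty a b"
  proof (rule Linfty_I[OF _ _ der])
    show "(\<lambda>t. u t + v t) \<in> borel_measurable borel" using u(1) bounded_control_measurable[OF v] by measurable
    obtain C1 where C1: "\<And>t. norm (u t) \<le> C1" using u(2) by (auto simp: bounded_iff)
    obtain C2 where C2: "\<And>t. norm (v t) \<le> C2" using bounded_control_bound[OF v] by blast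
    show "bounded (range (\<lambda>t. u t + v t))"
      unfolding bounded_iff by (intro exI[of _ "C1 + C2"]) (auto intro: order_trans[OF norm_triangle_ineq] add_mono C1 C2)
  qed
  then show "X \<in> caputo_AC_Linfty a b \<alpha>" using cap by (simp add: caputo_AC_Linfty_def)
qed

text \<open>
  The cost evaluates a continuous representative at \<open>b\<close>. For bounded integrands the fractional integral is continuous,
  hence equal to its representative.
\<close>

lemma frac_int_left_at_end:
  fixes F f :: "real \<Rightarrow> 'a::euclidean_space"
  assumes ab: "a < b" and \<beta>: "0 < \<beta>" and f: "bounded_control a b f"
    and eq: "AE t in lborel. t \<in> {a..b} \<longrightarrow> F t = f t"
  shows "frac_int_left a b \<beta> F b = rl_left \<beta> f b"
proof -
  note [measurable] = bounded_control_measurable[OF f]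
  have r: "frac_integral_left a \<beta> F t = rl_left \<beta> f t" if "t \<in> {a..b}" for t
    by (rule frac_integral_left_eq[OF \<beta> _ _ eq that]) (use f in \<open>auto simp: bounded_control_def\<close>)
  have "is_cont_rep a b (frac_integral_left a \<beta> F) (rl_left \<beta> f)"
    unfolding is_cont_rep_AE using rl_left_continuous[OF \<beta> f] r by (auto intro!: AE_I2)
  from cont_rep_eq[OF ab this, of b] show ?thesis using ab by (simp add: frac_int_left_cont_rep)
qed

section \<open>Necessary conditions for the Bolza problem\<close>

lemma grad_eqI:
  assumes "(f has_derivative (\<lambda>h. D \<bullet> h)) (at z)"
  shows "grad f z = D"
  unfolding grad_def
proof (rule the_equality)
  show "GDERIV f z :> D" using assms by (simp add: gderiv_def inner_commute)
  fix D' assume "GDERIV f z :> D'"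
  then have "(f has_derivative (\<lambda>h. D' \<bullet> h)) (at z)" by (simp add: gderiv_def inner_commute)
  then have "(\<lambda>h. D' \<bullet> h) = (\<lambda>h. D \<bullet> h)" using assms by (rule has_derivative_unique)
  then have "D' \<bullet> (D' - D) = D \<bullet> (D' - D)" by metis
  then have "(D' - D) \<bullet> (D' - D) = 0" by (simp add: inner_diff_left)
  then show "D' = D" by simp
qed

lemma linear_functional_vector:
  fixes F :: "'a::euclidean_space \<Rightarrow> real"
  assumes "linear F"
  shows "F h = (\<Sum>i\<in>Basis. F i *\<^sub>R i) \<bullet> h"
proof -
  have "F h = F (\<Sum>i\<in>Basis. (h \<bullet> i) *\<^sub>R i)" by (simp add: euclidean_representation)
  also have "\<dots> = (\<Sum>i\<in>Basis. (h \<bullet> i) * F i)" using assms by (simp add: linear_sum linear_scale)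
  also have "\<dots> = (\<Sum>i\<in>Basis. F i *\<^sub>R i) \<bullet> h" by (simp add: inner_sum_left inner_commute[of h] mult.commute)
  finally show ?thesis .
qed

lemma inner_matrix_transpose:
  fixes M :: "real^'n^'m"
  shows "(transpose M *v \<psi>) \<bullet> h = \<psi> \<bullet> (M *v h)"
  by (metis dot_lmul_matrix matrix_transpose_mul transpose_matrix_vector)

text \<open>
  Freezing the time outside \<open>{a..b}\<close> extends the Lagrangian continuously to all times.
\<close>

definition clamp_to :: "real \<Rightarrow> real \<Rightarrow> real \<Rightarrow> real" where
  "clamp_to a b t = max a (min b t)"

lemma clamp_to_continuous: "continuous_on UNIV (clamp_to a b)"
  unfolding clamp_to_def by (intro continuous_intros)

lemma clamp_to_in: "a \<le> b \<Longrightarrow> clamp_to a b t \<in> {a..b}" by (auto simp: clamp_to_def)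
lemma clamp_to_id: "t \<in> {a..b} \<Longrightarrow> clamp_to a b t = t" by (auto simp: clamp_to_def)

text \<open>
  Derivatives within the slab are restricted to directions that keep the time fixed, where they become full derivatives. The
  coordinates of the two gradients are values of the derivative at basis vectors, so continuity and
  differentiability are inherited.
\<close>

lemma C2_slab_gradients:
  fixes L :: "'e::euclidean_space \<Rightarrow> 'e \<Rightarrow> real \<Rightarrow> real"
  assumes ab: "a < b" and L: "C2_on (UNIV \<times> UNIV \<times> {a..b}) (\<lambda>(x1, x2, t). L x1 x2 t)"
  defines "\<Lambda> \<equiv> \<lambda>y z t. L y z (clamp_to a b t)"
  obtains A B :: "'e \<Rightarrow> 'e \<Rightarrow> real \<Rightarrow> 'e" where
    "\<And>y z t. ((\<lambda>p. \<Lambda> (fst p) (snd p) t) has_derivative (\<lambda>h. A y z t \<bullet> fst h + B y z t \<bullet> snd h)) (at (y, z))"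
    "continuous_on UNIV (\<lambda>(y, z, t). \<Lambda> y z t)"
    "continuous_on UNIV (\<lambda>(y, z, t). A y z t)"
    "continuous_on UNIV (\<lambda>(y, z, t). B y z t)"
    "\<And>y z t. \<exists>H. ((\<lambda>z. B y z t) has_derivative H) (at z)"
proof -
  let ?D = "UNIV \<times> UNIV \<times> {a..b} :: ('e \<times> 'e \<times> real) set"
  let ?L = "\<lambda>(x1, x2, t). L x1 x2 t"
  obtain L' where L': "\<And>p. p \<in> ?D \<Longrightarrow> (?L has_derivative blinfun_apply (L' p)) (at p within ?D)" and C1: "C1_on ?D L'"
    using L unfolding C2_on_def by blast
  obtain L'' where L'': "\<And>p. p \<in> ?D \<Longrightarrow> (L' has_derivative blinfun_apply (L'' p)) (at p within ?D)"
    using C1 unfolding C1_on_def by blast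
  have cl: "(y, z, clamp_to a b t) \<in> ?D" for y z t using clamp_to_in[of a b t] ab by simp
  have L'cont: "continuous_on ?D L'"
    using L'' by (meson continuous_on_eq_continuous_within has_derivative_continuous)
  have Lcont: "continuous_on ?D ?L"
    using L' by (meson continuous_on_eq_continuous_within has_derivative_continuous)
  have k: "continuous_on UNIV (\<lambda>(y, z, t). (y, z, clamp_to a b t) :: 'e \<times> 'e \<times> real)"
    unfolding split_beta' by (intro continuous_intros continuous_on_compose2[OF clamp_to_continuous]) auto
  have sub: "(\<lambda>(y, z, t). (y, z, clamp_to a b t) :: 'e \<times> 'e \<times> real) ` UNIV \<subseteq> ?D" using cl by auto
  have L'k: "continuous_on UNIV (\<lambda>(y, z, t). L' (y, z, clamp_to a b t))"
    using continuous_on_compose2[OF L'cont k sub] by (simp add: split_beta')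
  define A where "A y z t = (\<Sum>i\<in>Basis. L' (y, z, clamp_to a b t) (i, 0, 0) *\<^sub>R i)" for y z t
  define B where "B y z t = (\<Sum>i\<in>Basis. L' (y, z, clamp_to a b t) (0, i, 0) *\<^sub>R i)" for y z t
  have AB: "L' (y, z, clamp_to a b t) (h1, h2, 0) = A y z t \<bullet> h1 + B y z t \<bullet> h2" for y z t h1 h2
  proof -
    let ?F = "L' (y, z, clamp_to a b t)"
    have 1: "linear (\<lambda>h. ?F (h, 0, 0))" and 2: "linear (\<lambda>h. ?F (0, h, 0))"
    proof -
      have s: "?F (r *\<^sub>R h, 0, 0) = r *\<^sub>R ?F (h, 0, 0)" "?F (0, r *\<^sub>R h, 0) = r *\<^sub>R ?F (0, h, 0)" for r h
        using blinfun.scaleR_right[of ?F r "(h, 0, 0)"] blinfun.scaleR_right[of ?F r "(0, h, 0)"] by simp_all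
      show "linear (\<lambda>h. ?F (h, 0, 0))" "linear (\<lambda>h. ?F (0, h, 0))"
        by (auto intro!: linearI simp: blinfun.add_right[symmetric] s)
    qed
    have "?F (h1, h2, 0) = ?F ((h1, 0, 0) + (0, h2, 0))" by simp
    also have "\<dots> = ?F (h1, 0, 0) + ?F (0, h2, 0)" by (rule blinfun.add_right)
    finally show ?thesis using linear_functional_vector[OF 1, of h1] linear_functional_vector[OF 2, of h2]
      by (simp add: A_def B_def)
  qed
  show ?thesis
  proof (rule that[of A B])
    show "((\<lambda>p. \<Lambda> (fst p) (snd p) t) has_derivative (\<lambda>h. A y z t \<bullet> fst h + B y z t \<bullet> snd h)) (at (y, z))" for y z t
    proof -
      let ?k = "\<lambda>p :: 'e \<times> 'e. (fst p, snd p, clamp_to a b t)"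
      have dk: "(?k has_derivative (\<lambda>h. (fst h, snd h, 0))) (at (y, z))"
        by (auto intro!: derivative_eq_intros)
      have "(?L has_derivative blinfun_apply (L' (?k (y, z)))) (at (?k (y, z)) within range ?k)"
        by (rule has_derivative_subset[OF L']) (use cl in auto)
      from has_derivative_in_compose[OF dk this]
      show ?thesis by (simp add: AB \<Lambda>_def)
    qed
    show "continuous_on UNIV (\<lambda>(y, z, t). \<Lambda> y z t)"
      using continuous_on_compose2[OF Lcont k sub] by (simp add: split_beta' \<Lambda>_def)
    show "continuous_on UNIV (\<lambda>(y, z, t). A y z t)"
      using L'k unfolding A_def split_beta' by (intro continuous_intros)
    show "continuous_on UNIV (\<lambda>(y, z, t). B y z t)"
      using L'k unfolding B_def split_beta' by (intro continuous_intros)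
    show "\<exists>H. ((\<lambda>z. B y z t) has_derivative H) (at z)" for y z t
    proof -
      let ?k = "\<lambda>z :: 'e. (y, z, clamp_to a b t)"
      have dk: "(?k has_derivative (\<lambda>h. (0, h, 0))) (at z)"
        by (auto intro!: derivative_eq_intros)
      have "(L' has_derivative blinfun_apply (L'' (?k z))) (at (?k z) within range ?k)"
        by (rule has_derivative_subset[OF L'']) (use cl in auto)
      from has_derivative_in_compose[OF dk this]
      have d: "((\<lambda>z. L' (?k z)) has_derivative (\<lambda>h. L'' (?k z) (0, h, 0))) (at z)" .
      have "((\<lambda>z. B y z t) has_derivative (\<lambda>h. \<Sum>i\<in>Basis. L'' (?k z) (0, h, 0) (0, i, 0) *\<^sub>R i)) (at z)"
        unfolding B_def by (auto intro!: derivative_eq_intros d simp: blinfun.zero_right)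
      then show ?thesis by blast
    qed
  qed
qed

context bolza begin

lemma integrand_control:
  assumes [measurable]: "h \<in> borel_measurable borel" "v \<in> borel_measurable borel"
    and b: "\<And>t. t \<in> {a..b} \<Longrightarrow> norm (h t) \<le> M" "\<And>t. t \<in> {a..b} \<Longrightarrow> norm (v t) \<le> M"
  shows "bounded_control a b (\<lambda>t. indicator {a..b} t *\<^sub>R \<Lambda> (x t + h t) (u t + v t) t)"
proof -
  obtain X where X: "0 < X" "\<And>t. t \<in> {a..b} \<Longrightarrow> norm (x t) \<le> X" "\<And>t. norm (u t) \<le> X" using state_velocity_bound by blast
  obtain C where C: "0 < C" "\<And>y z t. \<lbrakk>norm y \<le> X + M; norm z \<le> X + M; t \<in> {a..b}\<rbrakk> \<Longrightarrow> norm (\<Lambda> y z t) \<le> C"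
    by (rule bounded_on_compact[OF \<Lambda>_cont]) blast
  show ?thesis
  proof (rule bounded_controlI)
    show "norm (indicator {a..b} t *\<^sub>R \<Lambda> (x t + h t) (u t + v t) t) \<le> C" for t
    proof (cases "t \<in> {a..b}")
      case True
      have "norm (\<Lambda> (x t + h t) (u t + v t) t) \<le> C"
        using X b True by (intro C(2) order_trans[OF norm_triangle_ineq] add_mono) auto
      then show ?thesis using True by simp
    qed (use C in simp)
  qed auto
qed

lemma cost_integral_eq_rl_left:
  "cost_integral h v = rl_left \<beta> (\<lambda>t. indicator {a..b} t *\<^sub>R \<Lambda> (x t + h t) (u t + v t) t) b"
  unfolding cost_integral_def rl_left_def by (rule Bochner_Integration.integral_cong) (auto simp: weight_def)

text \<open>
  The integrated Euler-Lagrange equation gives \<open>p\<close> as a kernel with factor \<open>\<mu>\<close> minus a fractional integral of order \<open>\<alpha>\<close>. Integrating to the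
  order \<open>1 - \<alpha>\<close> turns the kernel into \<open>1\<close> and the fractional integral into an ordinary one. For \<open>\<alpha> < 1\<close> the pointwise integral vanishes at
  \<open>b\<close>, where the representative takes the value \<open>\<mu>\<close>; the equality is therefore claimed only almost everywhere.
\<close>

lemma right_integral_representative:
  fixes p :: "real \<Rightarrow> 'e"
  assumes \<alpha>1: "\<alpha> \<le> 1" and p: "AE t in lborel. t \<in> {a..b} \<longrightarrow> p t = weight t *\<^sub>R velocity_grad t"
    and \<mu>: "AE t in lborel. momentum t = (indicator {a..b} t * rl_kernel \<alpha> (b - t)) *\<^sub>R \<mu>"
  shows "is_cont_rep a b (frac_integral_right b (1 - \<alpha>) p) (\<lambda>t. \<mu> - rl_right 1 (\<lambda>t. weight t *\<^sub>R state_grad t) t)"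
  unfolding is_cont_rep_AE
proof
  let ?f = "\<lambda>t. weight t *\<^sub>R state_grad t" and ?g = "\<lambda>t. weight t *\<^sub>R velocity_grad t"
  have [measurable]: "?f \<in> borel_measurable borel" "?g \<in> borel_measurable borel" by measurable
  have "continuous_on {a..b} (rl_left 1 ?f)" by (rule AC_continuous_on[OF rl_left_1_AC[OF weighted_state_grad_integrable]])
  then show "continuous_on {a..b} (\<lambda>t. \<mu> - rl_right 1 ?f t)"
    unfolding rl_right_1_eq[OF weighted_state_grad_integrable] by (intro continuous_intros)
  have rf0: "rl_right \<alpha> ?f s = 0" if "b \<le> s" for s
  proof -
    have "(\<lambda>r. rl_kernel \<alpha> (r - s) *\<^sub>R ?f r) = (\<lambda>_. 0)"
    proof
      show "rl_kernel \<alpha> (r - s) *\<^sub>R ?f r = 0" for r using that by (cases "r \<le> b") (auto simp: weight_outside)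
    qed
    then show ?thesis by (simp add: rl_right_def)
  qed
  have g: "AE s in lborel. a \<le> s \<longrightarrow> ?g s = rl_kernel \<alpha> (b - s) *\<^sub>R \<mu> - rl_right \<alpha> ?f s"
    using \<mu>
  proof eventually_elim
    case (elim s)
    show ?case
    proof
      assume "a \<le> s"
      show "?g s = rl_kernel \<alpha> (b - s) *\<^sub>R \<mu> - rl_right \<alpha> ?f s"
      proof (cases "s \<le> b")
        case True
        then show ?thesis using elim \<open>a \<le> s\<close> by (simp add: momentum_def eq_diff_eq)
      next
        case False
        then show ?thesis by (simp add: weight_outside rf0)
      qed
    qed
  qed
  have k1: "rl_kernel 1 (b - t) = 1" if "t < b" for t using that by (simp add: rl_kernel_1)
  show "AE t in lborel. t \<in> {a..b} \<longrightarrow> frac_integral_right b (1 - \<alpha>) p t = \<mu> - rl_right 1 ?f t"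
  proof (cases "\<alpha> = 1")
    case True
    show ?thesis using g p AE_lborel_singleton[of b]
    proof eventually_elim
      case (elim t)
      then show ?case using k1[of t] True by (auto simp: frac_integral_right_def)
    qed
  next
    case False
    then have a1: "0 < 1 - \<alpha>" "\<alpha> < 1" using \<alpha>1 by auto
    have "frac_integral_right b (1 - \<alpha>) p t = \<mu> - rl_right 1 ?f t" if t: "t \<in> {a..b}" "t \<noteq> b" for t
    proof -
      have nn: "(\<integral>\<^sup>+s. ennreal (rl_kernel \<alpha> (b - s) * rl_kernel (1 - \<alpha>) (s - t)) \<partial>lborel) = ennreal (rl_kernel 1 (b - t))"
        using rl_kernel_convolution[OF \<alpha> a1(1), of b t] by simp
      have i1: "integrable lborel (\<lambda>s. rl_kernel \<alpha> (b - s) * rl_kernel (1 - \<alpha>) (s - t))"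
        by (rule integrableI_nonneg) (use \<alpha> a1 nn in auto)
      have v1: "(\<integral>s. rl_kernel \<alpha> (b - s) * rl_kernel (1 - \<alpha>) (s - t) \<partial>lborel) = 1"
        by (subst integral_eq_nn_integral) (use \<alpha> a1 nn k1[of t] t in auto)
      have "frac_integral_right b (1 - \<alpha>) p t = rl_right (1 - \<alpha>) ?g t"
        by (rule frac_integral_right_eq[OF a1(1) _ _ p t(1)]) (auto simp: weight_outside)
      also have "\<dots> = (\<integral>s. (rl_kernel \<alpha> (b - s) * rl_kernel (1 - \<alpha>) (s - t)) *\<^sub>R \<mu> -
          rl_kernel (1 - \<alpha>) (s - t) *\<^sub>R rl_right \<alpha> ?f s \<partial>lborel)"
        unfolding rl_right_def[of "1 - \<alpha>"]
      proof (rule integral_cong_AE)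
        show "AE s in lborel. rl_kernel (1 - \<alpha>) (s - t) *\<^sub>R ?g s = (rl_kernel \<alpha> (b - s) * rl_kernel (1 - \<alpha>) (s - t)) *\<^sub>R \<mu> -
          rl_kernel (1 - \<alpha>) (s - t) *\<^sub>R rl_right \<alpha> ?f s"
          using g
        proof eventually_elim
          case (elim s)
          then show ?case using t(1) by (cases "s \<le> t") (auto simp: scaleR_diff_right mult.commute)
        qed
      qed measurable
      also have "\<dots> = \<mu> - rl_right (1 - \<alpha>) (rl_right \<alpha> ?f) t"
        unfolding rl_right_def[of "1 - \<alpha>"]
        using i1 v1 rl_right_semigroup(2)[OF \<alpha> a1(2) weighted_state_grad_integrable, of t]
        by (subst Bochner_Integration.integral_diff) auto
      also have "rl_right (1 - \<alpha>) (rl_right \<alpha> ?f) t = rl_right 1 ?f t"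
        by (rule rl_right_semigroup(1)[OF \<alpha> a1(2) weighted_state_grad_integrable])
      finally show ?thesis .
    qed
    then show ?thesis using AE_lborel_singleton[of b] by (auto elim!: eventually_mono)
  qed
qed

end

theorem theorem3p2:
  fixes a b \<alpha> \<beta> :: real
    and \<phi> :: "real^'n \<Rightarrow> real^'n \<Rightarrow> real"
    and L :: "real^'n \<Rightarrow> real^'n \<Rightarrow> real \<Rightarrow> real"
    and g :: "real^'n \<Rightarrow> real^'n \<Rightarrow> real^'j"
    and S :: "(real^'j) set"
    and x :: "real \<Rightarrow> real^'n"
  defines "u \<equiv> caputo_deriv a b \<alpha> x"
    and "w \<equiv> \<lambda>t. (b - t) powr (\<beta> - 1) / Gamma \<beta>"
  defines "p \<equiv> \<lambda>t. w t *\<^sub>R grad (\<lambda>y. L (x t) y t) (u t)"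
  assumes "a < b" and "0 < \<alpha>" and "\<alpha> \<le> 1" and "0 < \<beta>"
    and "C2_on UNIV (\<lambda>(x1, x2). \<phi> x1 x2)"
    and "C2_on (UNIV \<times> UNIV \<times> {a..b}) (\<lambda>(x1, x2, t). L x1 x2 t)"
    and "C1_on UNIV (\<lambda>(x1, x2). g x1 x2)"
    and "S \<noteq> {}" and "closed S" and "convex S"
    and "x \<in> admissible a b \<alpha> g S"
    and "\<forall>X \<in> admissible a b \<alpha> g S. cost a b \<alpha> \<beta> \<phi> L x \<le> cost a b \<alpha> \<beta> \<phi> L X"
    and "regular_at g (x a) (x b)"
  shows
    "(p \<in> AC_right a b \<alpha> \<and>
      (AE t in lebesgue_on {a..b}.
         frac_deriv_right a b \<alpha> p t = - (w t *\<^sub>R grad (\<lambda>y. L y (u t) t) (x t))))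
     \<and>
     (\<exists>\<psi>. - \<psi> \<in> normal_cone S (g (x a) (x b)) \<and>
        frac_int_right a b (1 - \<alpha>) p a =
          grad (\<lambda>y. \<phi> y (x b)) (x a)
          - transpose (jacobian (\<lambda>y. g y (x b)) (at (x a))) *v \<psi> \<and>
        - frac_int_right a b (1 - \<alpha>) p b =
          grad (\<lambda>y. \<phi> (x a) y) (x b)
          - transpose (jacobian (\<lambda>y. g (x a) y) (at (x b))) *v \<psi>)
     \<and>
     (AE t in lebesgue_on {a..b}.
        pos_semidef (w t *\<^sub>R hessian (\<lambda>y. L (x t) y t) (u t)))"
proof -
  note ab = \<open>a < b\<close> and \<alpha> = \<open>0 < \<alpha>\<close> \<open>\<alpha> \<le> 1\<close> and \<beta> = \<open>0 < \<beta>\<close>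
  obtain A B where bolza_data:
    "\<And>y z t. ((\<lambda>p. L (fst p) (snd p) (clamp_to a b t)) has_derivative (\<lambda>h. A y z t \<bullet> fst h + B y z t \<bullet> snd h)) (at (y, z))"
    "continuous_on UNIV (\<lambda>(y, z, t). L y z (clamp_to a b t))"
    "continuous_on UNIV (\<lambda>(y, z, t). A y z t)"
    "continuous_on UNIV (\<lambda>(y, z, t). B y z t)"
    and B_diff: "\<And>y z t. \<exists>H. ((\<lambda>z. B y z t) has_derivative H) (at z)"
    by (rule C2_slab_gradients[OF ab \<open>C2_on (UNIV \<times> UNIV \<times> {a..b}) _\<close>]) blast
  define \<Lambda> where "\<Lambda> y z t = L y z (clamp_to a b t)" for y z t
  have x_space: "x \<in> caputo_AC_Linfty a b \<alpha>" and gS: "g (x a) (x b) \<in> S"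
    using \<open>x \<in> admissible a b \<alpha> g S\<close> by (auto simp: admissible_def)
  have xc: "continuous_on {a..b} x" using x_space by (simp add: caputo_AC_Linfty_def caputo_AC_def)
  \<comment> \<open>continuous and Borel versions of state and velocity, as required by \<open>bolza\<close>\<close>
  define xx where "xx t = x (clamp_to a b t)" for t
  have xx: "xx t = x t" if "t \<in> {a..b}" for t using that by (simp add: xx_def clamp_to_id)
  have xxc: "continuous_on UNIV xx"
    unfolding xx_def using clamp_to_in ab by (intro continuous_on_compose2[OF xc clamp_to_continuous]) auto
  obtain uu where uu: "uu \<in> borel_measurable borel" "bounded (range uu)" "AE t in lborel. t \<in> {a..b} \<longrightarrow> u t = uu t"
    using Linfty_ex_bounded_borel[of u a b] x_space by (auto simp: caputo_AC_Linfty_def u_def)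
  interpret P: bolza a b \<alpha> \<beta> \<Lambda> A B xx uu
    by unfold_locales (use ab \<alpha> \<beta> bolza_data xxc uu in \<open>auto simp: \<Lambda>_def\<close>)
  have w_eq: "w t = P.weight t" if "t \<in> {a..b}" "t \<noteq> b" for t
    using that by (simp add: w_def P.weight_def rl_kernel_def)
  define X where "X c v t = x t + (c + rl_left \<alpha> v t)" for c v t
  have Xa: "X c v a = x a + c" and Xb: "X c v b = x b + (c + rl_left \<alpha> v b)"
    and X_space: "X c v \<in> caputo_AC_Linfty a b \<alpha>"
    and X_cost: "cost a b \<alpha> \<beta> \<phi> L (X c v) = \<phi> (X c v a) (X c v b) + P.cost_integral (\<lambda>t. c + rl_left \<alpha> v t) v"
    if v: "bounded_control a b v" for c v
  proof -
    have X_abs: "X c v = (\<lambda>t. x t + (c + rl_left \<alpha> v t))" by (simp add: X_def fun_eq_iff)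
    note pert = caputo_perturbation[OF ab \<alpha> x_space uu(1,2) uu(3)[unfolded u_def] v, of c, folded X_abs]
    show "X c v a = x a + c" "X c v b = x b + (c + rl_left \<alpha> v b)" by (simp_all add: X_def rl_left_start[OF v])
    show "X c v \<in> caputo_AC_Linfty a b \<alpha>" by (rule pert(1))
    obtain M1 where M1: "\<And>t. t \<in> {a..b} \<Longrightarrow> norm (rl_left \<alpha> v t) \<le> M1" using rl_left_bounded[OF \<alpha>(1) v] by blast
    obtain M2 where M2: "\<And>t. norm (v t) \<le> M2" using bounded_control_bound[OF v] by blast
    note [measurable] = bounded_control_measurable[OF v]
    let ?f = "\<lambda>t. indicator {a..b} t *\<^sub>R \<Lambda> (xx t + (c + rl_left \<alpha> v t)) (uu t + v t) t"
    have f: "bounded_control a b ?f"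
    proof (rule P.integrand_control[where M = "max (norm c + M1) M2"])
      show "norm (c + rl_left \<alpha> v t) \<le> max (norm c + M1) M2" if "t \<in> {a..b}" for t
        by (rule max.coboundedI1, rule order_trans[OF norm_triangle_ineq]) (use M1[OF that] in simp)
      show "norm (v t) \<le> max (norm c + M1) M2" for t by (rule max.coboundedI2[OF M2])
    qed measurable
    have ae: "AE t in lborel. t \<in> {a..b} \<longrightarrow> L (X c v t) (caputo_deriv a b \<alpha> (X c v) t) t = ?f t"
      using pert(2) by eventually_elim (auto simp: X_def \<Lambda>_def xx clamp_to_id)
    have "frac_int_left a b \<beta> (\<lambda>t. L (X c v t) (caputo_deriv a b \<alpha> (X c v) t) t) b = rl_left \<beta> ?f b"
      by (rule frac_int_left_at_end[OF ab \<beta> f ae])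
    also have "\<dots> = P.cost_integral (\<lambda>t. c + rl_left \<alpha> v t) v" by (rule P.cost_integral_eq_rl_left[symmetric])
    finally show "cost a b \<alpha> \<beta> \<phi> L (X c v) = \<phi> (X c v a) (X c v b) + P.cost_integral (\<lambda>t. c + rl_left \<alpha> v t) v"
      by (simp add: cost_def)
  qed
  have zero: "bounded_control a b (\<lambda>_. 0 :: real^'n)" by (rule bounded_controlI[where C = 0]) auto
  have X0: "X 0 (\<lambda>_. 0) = x" by (auto simp: X_def fun_eq_iff rl_left_def)
  have cost_x: "cost a b \<alpha> \<beta> \<phi> L x = \<phi> (x a) (x b) + P.cost_integral (\<lambda>_. 0) (\<lambda>_. 0)"
    using X_cost[OF zero, of 0] unfolding X0 by (simp add: rl_left_def)
  have minimal: "\<phi> (x a) (x b) + P.cost_integral (\<lambda>_. 0) (\<lambda>_. 0) \<le>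
      \<phi> (x a + c) (x b + (c + rl_left \<alpha> v b)) + P.cost_integral (\<lambda>t. c + rl_left \<alpha> v t) v"
    if v: "bounded_control a b v" and "g (x a + c) (x b + (c + rl_left \<alpha> v b)) \<in> S" for c v
  proof -
    have "X c v \<in> admissible a b \<alpha> g S" using X_space[OF v] that(2) by (simp add: admissible_def Xa[OF v] Xb[OF v])
    then have "cost a b \<alpha> \<beta> \<phi> L x \<le> cost a b \<alpha> \<beta> \<phi> L (X c v)"
      using \<open>\<forall>X \<in> admissible a b \<alpha> g S. _ X\<close> by blast
    then show ?thesis by (simp add: cost_x X_cost[OF v] Xa[OF v] Xb[OF v])
  qed
  interpret P: bolza_minimum a b \<alpha> \<beta> \<Lambda> A B xx uu
  proof unfold_locales
    fix v :: "real \<Rightarrow> real^'n" assume "bounded_control a b v" "rl_left \<alpha> v b = 0"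
    then show "P.cost_integral (\<lambda>_. 0) (\<lambda>_. 0) \<le> P.cost_integral (rl_left \<alpha> v) v" using minimal[of v 0] gS by simp
  qed
  obtain \<mu> where \<mu>: "AE t in lborel. P.momentum t = (indicator {a..b} t * rl_kernel \<alpha> (b - t)) *\<^sub>R \<mu>"
    using P.Euler_Lagrange_integrated by blast
  have dz: "((\<lambda>z. L y z t) has_derivative (\<lambda>h. B y z t \<bullet> h)) (at z)"
    and dy: "((\<lambda>y. L y z t) has_derivative (\<lambda>h. A y z t \<bullet> h)) (at y)" if t: "t \<in> {a..b}" for y z t
  proof -
    have "((\<lambda>z. (y, z)) has_derivative (\<lambda>h. (0, h))) (at z)" by (auto intro!: derivative_eq_intros)
    from has_derivative_compose[OF this bolza_data(1)[where t = t]]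
    show "((\<lambda>z. L y z t) has_derivative (\<lambda>h. B y z t \<bullet> h)) (at z)" by (simp add: clamp_to_id[OF t])
    have "((\<lambda>y. (y, z)) has_derivative (\<lambda>h. (h, 0))) (at y)" by (auto intro!: derivative_eq_intros)
    from has_derivative_compose[OF this bolza_data(1)[where t = t]]
    show "((\<lambda>y. L y z t) has_derivative (\<lambda>h. A y z t \<bullet> h)) (at y)" by (simp add: clamp_to_id[OF t])
  qed
  have grad_z: "grad (\<lambda>z. L y z t) z = B y z t" and grad_y: "grad (\<lambda>y. L y z t) y = A y z t"
    if "t \<in> {a..b}" for y z t
    using grad_eqI[OF dz[OF that]] grad_eqI[OF dy[OF that]] by auto
  define f where "f t = P.weight t *\<^sub>R P.state_grad t" for t
  have f_int: "integrable lborel f" unfolding f_def by (rule P.weighted_state_grad_integrable)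
  have f0: "f t = 0" if "t \<notin> {a..b}" for t using that by (simp add: f_def P.weight_outside)
  have p_ae: "AE t in lborel. t \<in> {a..b} \<longrightarrow> p t = P.weight t *\<^sub>R P.velocity_grad t"
    using uu(3) AE_lborel_singleton[of b] by eventually_elim (auto simp: p_def w_eq grad_z P.velocity_grad_def xx)
  have f_ae: "AE t in lborel. t \<in> {a..b} \<longrightarrow> w t *\<^sub>R grad (\<lambda>y. L y (u t) t) (x t) = f t"
    using uu(3) AE_lborel_singleton[of b] by eventually_elim (auto simp: f_def w_eq grad_y P.state_grad_def xx)
  \<comment> \<open>\<open>q\<close> is the continuous representative of the right fractional integral of \<open>p\<close>; it has the value \<open>\<mu>\<close> at \<open>b\<close>\<close>
  define q where "q t = \<mu> - rl_right 1 f t" for t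
  have q_eq: "q t = (\<mu> - integral\<^sup>L lborel f) + rl_left 1 f t" for t
    by (simp add: q_def rl_right_1_eq[OF f_int])
  have q_rep: "is_cont_rep a b (frac_integral_right b (1 - \<alpha>) p) q"
    unfolding q_def f_def by (rule P.right_integral_representative[OF \<alpha>(2) p_ae \<mu>])
  have pq: "frac_int_right a b (1 - \<alpha>) p t = q t" if "t \<in> {a..b}" for t
    unfolding frac_int_right_cont_rep by (rule cont_rep_eq[OF ab q_rep that])
  have p_AC: "frac_int_right a b (1 - \<alpha>) p \<in> AC a b"
    by (rule AC_same_increments[OF rl_left_1_AC[OF f_int]]) (simp add: pq q_eq)
  have p_int: "integrable (lebesgue_on {a..b}) p"
  proof (subst integral_lebesgue_on_eq(3)[where G = "\<lambda>t. P.weight t *\<^sub>R P.velocity_grad t"])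
    show "AE t in lborel. indicator {a..b} t *\<^sub>R p t = P.weight t *\<^sub>R P.velocity_grad t"
      using p_ae by eventually_elim (auto simp: P.weight_outside indicator_def)
  qed (use P.weighted_velocity_grad_integrable in auto)
  have EL: "AE t in lebesgue_on {a..b}. frac_deriv_right a b \<alpha> p t = - (w t *\<^sub>R grad (\<lambda>y. L y (u t) t) (x t))"
    unfolding AE_lebesgue_on_Icc
    using f_ae negligible_AE_Icc[OF rl_left_1_has_vector_derivative_ae[OF f_int ab]]
  proof eventually_elim
    case (elim t)
    show ?case
    proof
      assume t: "t \<in> {a..b}"
      have "((\<lambda>t. (\<mu> - integral\<^sup>L lborel f) + rl_left 1 f t) has_vector_derivative 0 + f t) (at t within {a..b})"
        by (rule has_vector_derivative_add[OF has_vector_derivative_const]) (use elim t in auto)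
      then have D: "(q has_vector_derivative f t) (at t within {a..b})" by (simp add: q_eq[abs_def])
      have "(frac_int_right a b (1 - \<alpha>) p has_vector_derivative f t) (at t within {a..b})"
        using has_vector_derivative_transform[OF t pq D] by simp
      then have "vector_derivative (frac_int_right a b (1 - \<alpha>) p) (at t within {a..b}) = f t"
        using vector_derivative_within_cbox[of a b t] ab t by simp
      then show "frac_deriv_right a b \<alpha> p t = - (w t *\<^sub>R grad (\<lambda>y. L y (u t) t) (x t))"
        using elim t by (simp add: frac_deriv_right_def)
    qed
  qed
  have part1: "p \<in> AC_right a b \<alpha>" using p_int p_AC by (simp add: AC_right_def)
  have ra: "rl_left 1 f a = 0"
  proof -
    have "(\<lambda>s. rl_kernel 1 (a - s) *\<^sub>R f s) = (\<lambda>_. 0)"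
    proof
      show "rl_kernel 1 (a - s) *\<^sub>R f s = 0" for s using f0[of s] by (cases "a \<le> s") auto
    qed
    then show ?thesis by (simp add: rl_left_def)
  qed
  have rb: "rl_right 1 f b = 0"
  proof -
    have "(\<lambda>s. rl_kernel 1 (s - b) *\<^sub>R f s) = (\<lambda>_. 0)"
    proof
      show "rl_kernel 1 (s - b) *\<^sub>R f s = 0" for s using f0[of s] by (cases "s \<le> b") auto
    qed
    then show ?thesis by (simp add: rl_right_def)
  qed
  have qa: "q a = \<mu> - integral\<^sup>L lborel f" and qb: "q b = \<mu>"
    using ra rb q_eq[of a] q_def[of b] by simp_all
  obtain G' where G': "\<And>P. ((\<lambda>(x1, x2). g x1 x2) has_derivative blinfun_apply (G' P)) (at P)" "continuous_on UNIV G'"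
    using \<open>C1_on UNIV (\<lambda>(x1, x2). g x1 x2)\<close> unfolding C1_on_def by auto
  obtain \<Phi>' where \<Phi>': "\<And>P. ((\<lambda>(x1, x2). \<phi> x1 x2) has_derivative blinfun_apply (\<Phi>' P)) (at P)"
    using \<open>C2_on UNIV (\<lambda>(x1, x2). \<phi> x1 x2)\<close> unfolding C2_on_def by auto
  define P0 where "P0 = (x a, x b)"
  have surj: "surj (blinfun_apply (G' P0))"
    using \<open>regular_at g (x a) (x b)\<close> frechet_derivative_at[OF G'(1)[of P0]] by (simp add: regular_at_def P0_def)
  define \<phi>1 where "\<phi>1 = grad (\<lambda>y. \<phi> y (x b)) (x a)"
  define \<phi>2 where "\<phi>2 = grad (\<lambda>y. \<phi> (x a) y) (x b)"
  have inl: "((\<lambda>y. (y, x b)) has_derivative (\<lambda>h. (h, 0))) (at (x a))" by (auto intro!: derivative_eq_intros)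
  have inr: "((\<lambda>y. (x a, y)) has_derivative (\<lambda>h. (0, h))) (at (x b))" by (auto intro!: derivative_eq_intros)
  have \<phi>_split: "\<Phi>' P0 (c, d) = \<phi>1 \<bullet> c + \<phi>2 \<bullet> d" for c d
  proof -
    have l1: "linear (\<lambda>h. \<Phi>' P0 (h, 0))" and l2: "linear (\<lambda>h. \<Phi>' P0 (0, h))"
      using has_derivative_linear[OF has_derivative_compose[OF inl \<Phi>'(1)[of "(x a, x b)"]]]
        has_derivative_linear[OF has_derivative_compose[OF inr \<Phi>'(1)[of "(x a, x b)"]]] by (simp_all add: P0_def)
    have "\<phi>1 = (\<Sum>i\<in>Basis. \<Phi>' P0 (i, 0) *\<^sub>R i)"
      unfolding \<phi>1_def
    proof (rule grad_eqI)
      show "((\<lambda>y. \<phi> y (x b)) has_derivative (\<lambda>h. (\<Sum>i\<in>Basis. \<Phi>' P0 (i, 0) *\<^sub>R i) \<bullet> h)) (at (x a))"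
        using has_derivative_compose[OF inl \<Phi>'(1)[of "(x a, x b)"]] unfolding linear_functional_vector[OF l1, symmetric]
        by (simp add: P0_def)
    qed
    moreover have "\<phi>2 = (\<Sum>i\<in>Basis. \<Phi>' P0 (0, i) *\<^sub>R i)"
      unfolding \<phi>2_def
    proof (rule grad_eqI)
      show "((\<lambda>y. \<phi> (x a) y) has_derivative (\<lambda>h. (\<Sum>i\<in>Basis. \<Phi>' P0 (0, i) *\<^sub>R i) \<bullet> h)) (at (x b))"
        using has_derivative_compose[OF inr \<Phi>'(1)[of "(x a, x b)"]] unfolding linear_functional_vector[OF l2, symmetric]
        by (simp add: P0_def)
    qed
    moreover have "\<Phi>' P0 (c, d) = \<Phi>' P0 (c, 0) + \<Phi>' P0 (0, d)" by (simp add: blinfun.add_right[symmetric])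
    ultimately show ?thesis using linear_functional_vector[OF l1, of c] linear_functional_vector[OF l2, of d] by simp
  qed
  \<comment> \<open>the derivative of the cost with respect to the end points, as given by \<open>end_variation\<close>\<close>
  define cc where "cc = (\<phi>1 - q a, \<phi>2 + q b)"
  obtain \<psi> where \<psi>: "- \<psi> \<in> normal_cone S ((\<lambda>(x1, x2). g x1 x2) P0)" "\<And>D. cc \<bullet> D = \<psi> \<bullet> G' P0 D"
  proof (rule multiplier_rule[OF G' surj \<open>convex S\<close>, where c = cc])
    show "(\<lambda>(x1, x2). g x1 x2) P0 \<in> S" using gS by (simp add: P0_def)
    fix \<epsilon> :: "nat \<Rightarrow> real" and Q :: "nat \<Rightarrow> (real^'n) \<times> (real^'n)" and D
    assume e: "\<epsilon> \<longlonglongrightarrow> 0" "\<And>k. 0 < \<epsilon> k" and Q: "Q \<longlonglongrightarrow> D"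
      and feas: "\<And>k. (\<lambda>(x1, x2). g x1 x2) (P0 + \<epsilon> k *\<^sub>R Q k) \<in> S"
    define c where "c k = fst (Q k)" for k
    define d where "d k = snd (Q k)" for k
    have cd: "c \<longlonglongrightarrow> fst D" "d \<longlonglongrightarrow> snd D" unfolding c_def d_def using Q by (auto intro: tendsto_intros)
    let ?cost_integral = "\<lambda>k. P.cost_integral (\<lambda>t. \<epsilon> k *\<^sub>R (c k + rl_left \<alpha> (P.end_control (d k - c k)) t)) (\<lambda>t. \<epsilon> k *\<^sub>R P.end_control (d k - c k) t)"
    have limJ: "(\<lambda>k. (?cost_integral k - P.cost_integral (\<lambda>_. 0) (\<lambda>_. 0)) / \<epsilon> k) \<longlonglongrightarrow> (integral\<^sup>L lborel f - \<mu>) \<bullet> fst D + \<mu> \<bullet> snd D"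
      using P.end_variation[OF \<mu> e cd] unfolding f_def[abs_def] .
    have lim\<phi>: "(\<lambda>k. (1 / \<epsilon> k) *\<^sub>R ((\<lambda>(x1, x2). \<phi> x1 x2) (P0 + \<epsilon> k *\<^sub>R Q k) - (\<lambda>(x1, x2). \<phi> x1 x2) P0)) \<longlonglongrightarrow> \<Phi>' P0 D"
      by (rule has_derivative_sequence[OF \<Phi>' e Q])
    have nonneg: "0 \<le> (1 / \<epsilon> k) *\<^sub>R ((\<lambda>(x1, x2). \<phi> x1 x2) (P0 + \<epsilon> k *\<^sub>R Q k) - (\<lambda>(x1, x2). \<phi> x1 x2) P0)
        + (?cost_integral k - P.cost_integral (\<lambda>_. 0) (\<lambda>_. 0)) / \<epsilon> k" for k
    proof -
      let ?v = "\<lambda>t. \<epsilon> k *\<^sub>R P.end_control (d k - c k) t"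
      have v: "bounded_control a b ?v" by (rule bounded_control_scaleR[OF P.end_control])
      have vt: "rl_left \<alpha> ?v t = \<epsilon> k *\<^sub>R rl_left \<alpha> (P.end_control (d k - c k)) t" for t by (rule rl_left_scaleR)
      have vb: "\<epsilon> k *\<^sub>R c k + rl_left \<alpha> ?v b = \<epsilon> k *\<^sub>R d k"
        unfolding vt by (simp add: P.end_control_endpoint algebra_simps)
      have PQ: "P0 + \<epsilon> k *\<^sub>R Q k = (x a + \<epsilon> k *\<^sub>R c k, x b + \<epsilon> k *\<^sub>R d k)"
        by (simp add: P0_def c_def d_def prod_eq_iff)
      have "\<phi> (x a) (x b) + P.cost_integral (\<lambda>_. 0) (\<lambda>_. 0) \<le>
        \<phi> (x a + \<epsilon> k *\<^sub>R c k) (x b + (\<epsilon> k *\<^sub>R c k + rl_left \<alpha> ?v b)) + P.cost_integral (\<lambda>t. \<epsilon> k *\<^sub>R c k + rl_left \<alpha> ?v t) ?v"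
        by (rule minimal[OF v]) (use feas[of k] in \<open>simp add: vb PQ\<close>)
      then have "0 \<le> (\<phi> (x a + \<epsilon> k *\<^sub>R c k) (x b + \<epsilon> k *\<^sub>R d k) - \<phi> (x a) (x b)) + (?cost_integral k - P.cost_integral (\<lambda>_. 0) (\<lambda>_. 0))"
        unfolding vb by (simp add: vt scaleR_add_right)
      then have "0 \<le> ((\<phi> (x a + \<epsilon> k *\<^sub>R c k) (x b + \<epsilon> k *\<^sub>R d k) - \<phi> (x a) (x b)) + (?cost_integral k - P.cost_integral (\<lambda>_. 0) (\<lambda>_. 0))) / \<epsilon> k"
        using e(2)[of k] by simp
      then show ?thesis unfolding PQ by (simp add: P0_def add_divide_distrib)
    qed
    have "0 \<le> \<Phi>' P0 D + ((integral\<^sup>L lborel f - \<mu>) \<bullet> fst D + \<mu> \<bullet> snd D)"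
      by (rule LIMSEQ_le_const[OF tendsto_add[OF lim\<phi> limJ]]) (use nonneg in auto)
    then show "0 \<le> cc \<bullet> D"
      using \<phi>_split[of "fst D" "snd D"] by (simp add: cc_def qa qb inner_prod_def inner_diff_left inner_add_left algebra_simps)
  qed blast
  have jac1: "jacobian (\<lambda>y. g y (x b)) (at (x a)) *v h = G' P0 (h, 0)"
    and jac2: "jacobian (\<lambda>y. g (x a) y) (at (x b)) *v h = G' P0 (0, h)" for h
  proof -
    have d1: "((\<lambda>y. g y (x b)) has_derivative (\<lambda>h. G' P0 (h, 0))) (at (x a))"
      using has_derivative_compose[OF inl G'(1)[of "(x a, x b)"]] by (simp add: P0_def)
    have d2: "((\<lambda>y. g (x a) y) has_derivative (\<lambda>h. G' P0 (0, h))) (at (x b))"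
      using has_derivative_compose[OF inr G'(1)[of "(x a, x b)"]] by (simp add: P0_def)
    show "jacobian (\<lambda>y. g y (x b)) (at (x a)) *v h = G' P0 (h, 0)"
      using matrix_works[OF has_derivative_linear[OF d1, folded linear_matrix_vector_mul_eq]] by (simp add: jacobian_def frechet_derivative_at[OF d1, symmetric])
    show "jacobian (\<lambda>y. g (x a) y) (at (x b)) *v h = G' P0 (0, h)"
      using matrix_works[OF has_derivative_linear[OF d2, folded linear_matrix_vector_mul_eq]] by (simp add: jacobian_def frechet_derivative_at[OF d2, symmetric])
  qed
  have t1: "\<phi>1 - q a = transpose (jacobian (\<lambda>y. g y (x b)) (at (x a))) *v \<psi>"
  proof (rule vector_eq_ldot[THEN iffD1, rule_format])
    fix h
    show "h \<bullet> (\<phi>1 - q a) = h \<bullet> (transpose (jacobian (\<lambda>y. g y (x b)) (at (x a))) *v \<psi>)"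
      using \<psi>(2)[of "(h, 0)"] inner_matrix_transpose[of "jacobian (\<lambda>y. g y (x b)) (at (x a))" \<psi> h]
      by (simp add: cc_def jac1 inner_commute)
  qed
  have t2: "\<phi>2 + q b = transpose (jacobian (\<lambda>y. g (x a) y) (at (x b))) *v \<psi>"
  proof (rule vector_eq_ldot[THEN iffD1, rule_format])
    fix h
    show "h \<bullet> (\<phi>2 + q b) = h \<bullet> (transpose (jacobian (\<lambda>y. g (x a) y) (at (x b))) *v \<psi>)"
      using \<psi>(2)[of "(0, h)"] inner_matrix_transpose[of "jacobian (\<lambda>y. g (x a) y) (at (x b))" \<psi> h]
      by (simp add: cc_def jac2 inner_commute)
  qed
  have part2: "frac_int_right a b (1 - \<alpha>) p a = \<phi>1 - transpose (jacobian (\<lambda>y. g y (x b)) (at (x a))) *v \<psi>"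
    "- frac_int_right a b (1 - \<alpha>) p b = \<phi>2 - transpose (jacobian (\<lambda>y. g (x a) y) (at (x b))) *v \<psi>"
    unfolding t1[symmetric] t2[symmetric] using pq[of a] pq[of b] ab by auto
  have part3: "AE t in lebesgue_on {a..b}. pos_semidef (w t *\<^sub>R hessian (\<lambda>y. L (x t) y t) (u t))"
    unfolding AE_lebesgue_on_Icc
    using P.Weierstrass_two_sided uu(3)
  proof eventually_elim
    case (elim t)
    show ?case
    proof
      assume t: "t \<in> {a..b}"
      have ut: "u t = uu t" using elim t by simp
      let ?l = "\<lambda>z. L (x t) z t" and ?G = "\<lambda>z. B (x t) z t"
      have dl: "(?l has_derivative (\<lambda>h. ?G z \<bullet> h)) (at z)" for z by (rule dz[OF t])
      obtain H where H: "(?G has_derivative H) (at (u t))" using B_diff by blast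
      have "0 \<le> ?l (u t + z) - ?l (u t) - ?G (u t) \<bullet> z \<or> 0 \<le> ?l (u t - z) - ?l (u t) + ?G (u t) \<bullet> z" for z
      proof -
        have "0 \<le> P.excess t z \<or> 0 \<le> P.excess t (- z)" using elim t by blast
        then show ?thesis by (simp add: P.excess_def P.velocity_grad_def \<Lambda>_def xx[OF t] clamp_to_id[OF t] ut)
      qed
      from hessian_nonneg_from_two_sided_excess[OF dl H this]
      have nn: "0 \<le> H z \<bullet> z" for z .
      have sym: "H h \<bullet> k = H k \<bullet> h" for h k by (rule second_derivative_symmetric[OF dl H])
      have "grad ?l = ?G" by (rule ext) (rule grad_z[OF t])
      then have hess: "hessian ?l (u t) = matrix H"
        by (simp add: hessian_def jacobian_def frechet_derivative_at[OF H, symmetric])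
      have mv: "matrix H *v z = H z" for z by (rule matrix_works[OF has_derivative_linear[OF H, folded linear_matrix_vector_mul_eq]])
      have "H (axis j 1) $ i = H (axis i 1) $ j" for i j
        using sym[of "axis j 1" "axis i 1"] by (simp add: inner_axis)
      then have tr: "transpose (matrix H) = matrix H" by (simp add: transpose_def matrix_def vec_eq_iff)
      have w0: "0 \<le> w t" using \<beta> by (auto simp: w_def intro!: divide_nonneg_nonneg Gamma_real_nonneg)
      show "pos_semidef (w t *\<^sub>R hessian ?l (u t))"
        unfolding hess pos_semidef_def
      proof
        show "transpose (w t *\<^sub>R matrix H) = w t *\<^sub>R matrix H"
          using tr by (simp add: transpose_def vec_eq_iff)
        show "\<forall>z. 0 \<le> z \<bullet> ((w t *\<^sub>R matrix H) *v z)"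
          using nn w0 by (simp add: scaleR_matrix_vector_assoc[symmetric] mv inner_commute)
      qed
    qed
  qed
  show ?thesis
    using part1 EL \<psi>(1) part2 part3 unfolding \<phi>1_def \<phi>2_def P0_def by auto
qed

end
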